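(* Let $K$ be a commutative ring and let $A$ be an associative $K$-algebra that is projective as a $K$-module and is given by a presentation $\mathcal P=\langle X\mid R\rangle$, i.e. $A=KX^*/J$ where $X$ is a set, $R\subseteq KX^*$ and $J=(R)$ is the two-sided ideal of $KX^*$ generated by $R$. Then there is an exact sequence of $A$-bimodules \[0\to \pi_2(\mathcal P)\to A\otimes_K KR\otimes_K A\to J/J^2\to 0.\]
   Context: Conventions: algebras are associative and unital. An $A$-bimodule means a left $A\otimes_K A^{op}$-module (so $K$ acts the same way on both sides). $X^*$ is the free monoid on the set $X$, and $KX^*$ is its monoid algebra, i.e. the free associative $K$-algebra on $X$. $KX$ and $KR$ denote the free $K$-modules on the sets $X$ and $R$; the basis element of $KR$ corresponding to $r\in R\subseteq KX^*$ is written $\overline r$, to distinguish it from the element $r\in KX^*$. A presentation of a $K$-algebra is $\mathcal P=\langle X\mid R\rangle$ with $X$ a set and $R\subseteq KX^*$ any subset (neither need be finite); it presents $A\cong KX^*/(R)$. The $A$-bimodule $J/J^2$ is called the relation bimodule. Definition of $\pi_2(\mathcal P)$: let $\alpha\colon KX^*\otimes_K KR\otimes_K KX^*\to J$ be the surjective $KX^*$-bimodule homomorphism with $\alpha(u\otimes\overline r\otimes v)=urv$, and let $H=\ker\alpha$. For $r_i,r_j\in R$ and $u\in X^*$ put \[[r_i,u,r_j]=1\otimes\overline{r_i}\otimes ur_j-r_iu\otimes\overline{r_j}\otimes 1\in H.\] Let $D$ be the sub-$KX^*$-bimodule of $H$ generated by all $[r_i,u,r_j]$ with $r_i,r_j\in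 R$, $u\in X^*$. One has $JH+HJ\subseteq D$, so $H/D$ is an $A$-bimodule, and $\pi_2(\mathcal P):=H/D$. *)

theory Defs
  imports "HOL-Algebra.Module" "HOL-Algebra.QuotRing" "HOL-Algebra.Ideal_Product"
begin

section \<open>Modules over a commutative ring\<close>

text \<open>
  Modules use the record of \<^theory>\<open>HOL-Algebra.Module\<close>, which extends the ring record.  For
  modules that are not rings the fields \<^const>\<open>mult\<close> and \<^const>\<open>one\<close> are \<^const>\<open>undefined\<close> and
  never used.
\<close>

definition mod_hom ::
  "('k, 'r) ring_scheme \<Rightarrow> ('k, 'a, 'm) module_scheme \<Rightarrow> ('k, 'b, 'n) module_scheme \<Rightarrow> ('a \<Rightarrow> 'b) set"
  where "mod_hom K M N =
    {f \<in> carrier M \<rightarrow> carrier N.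
       (\<forall>x\<in>carrier M. \<forall>y\<in>carrier M. f (x \<oplus>\<^bsub>M\<^esub> y) = f x \<oplus>\<^bsub>N\<^esub> f y) \<and>
       (\<forall>k\<in>carrier K. \<forall>x\<in>carrier M. f (k \<odot>\<^bsub>M\<^esub> x) = k \<odot>\<^bsub>N\<^esub> f x)}"

text \<open>
  Projectivity is the lifting property against surjections \<open>g: M \<rightarrow> N\<close>.  A formula can only
  quantify over modules on fixed types; the types of \<open>M\<close> and \<open>N\<close> are chosen so that the
  canonical surjection from the free module on the carrier of \<open>P\<close> onto \<open>P\<close> is among the test
  maps.  That instance splits \<open>P\<close> off a free module, so lifting against surjections between modules
  on arbitrary types follows, and nothing is lost.
\<close>

definition projective_module :: "('k, 'r) ring_scheme \<Rightarrow> ('k, 'a) module \<Rightarrow> bool"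
  where "projective_module K P \<longleftrightarrow> module K P \<and>
    (\<forall>(M :: ('k, 'a \<Rightarrow> 'k) module) (N :: ('k, 'a) module) g h.
       module K M \<longrightarrow> module K N \<longrightarrow> g \<in> mod_hom K M N \<longrightarrow> g ` carrier M = carrier N \<longrightarrow>
       h \<in> mod_hom K P N \<longrightarrow>
       (\<exists>h' \<in> mod_hom K P M. \<forall>x\<in>carrier P. g (h' x) = h x))"

text \<open>The free module on a set \<open>S\<close>: finitely supported functions, zero outside \<open>S\<close>.\<close>

definition free_mod :: "('k, 'r) ring_scheme \<Rightarrow> 's set \<Rightarrow> ('k, 's \<Rightarrow> 'k) module"
  where "free_mod K S =
    \<lparr>carrier = {c. finite {s. c s \<noteq> \<zero>\<^bsub>K\<^esub>} \<and> (\<forall>s\<in>S. c s \<in> carrier K) \<and> (\<forall>s. s \<notin> S \<longrightarrow> c s = \<zero>\<^bsub>K\<^esub>)},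
     mult = undefined, one = undefined,
     zero = (\<lambda>s. \<zero>\<^bsub>K\<^esub>),
     add = (\<lambda>c d s. c s \<oplus>\<^bsub>K\<^esub> d s),
     smult = (\<lambda>k c s. k \<otimes>\<^bsub>K\<^esub> c s)\<rparr>"

definition free_basis :: "('k, 'r) ring_scheme \<Rightarrow> 's \<Rightarrow> 's \<Rightarrow> 'k"
  where "free_basis K s = (\<lambda>t. if t = s then \<one>\<^bsub>K\<^esub> else \<zero>\<^bsub>K\<^esub>)"

definition lin_ext ::
  "('k, 'r) ring_scheme \<Rightarrow> ('k, 'a, 'm) module_scheme \<Rightarrow> ('s \<Rightarrow> 'a) \<Rightarrow> ('s \<Rightarrow> 'k) \<Rightarrow> 'a"
  where "lin_ext K M \<phi> c = (\<Oplus>\<^bsub>M\<^esub>s\<in>{s. c s \<noteq> \<zero>\<^bsub>K\<^esub>}. c s \<odot>\<^bsub>M\<^esub> \<phi> s)"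

definition mod_span :: "('k, 'r) ring_scheme \<Rightarrow> ('k, 'a, 'm) module_scheme \<Rightarrow> 'a set \<Rightarrow> 'a set"
  where "mod_span K M S = \<Inter>{N. submodule N K M \<and> S \<subseteq> N}"

definition quot_smult :: "('k, 'a, 'm) module_scheme \<Rightarrow> 'a set \<Rightarrow> 'k \<Rightarrow> 'a set \<Rightarrow> 'a set"
  where "quot_smult M N k B = (\<Union>x\<in>B. N +>\<^bsub>M\<^esub> (k \<odot>\<^bsub>M\<^esub> x))"

definition quot_mod :: "('k, 'a, 'm) module_scheme \<Rightarrow> 'a set \<Rightarrow> ('k, 'a set) module"
  where "quot_mod M N =
    \<lparr>carrier = a_rcosets\<^bsub>M\<^esub> N, mult = undefined, one = undefined, zero = N, add = set_add M,
     smult = quot_smult M N\<rparr>"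


section \<open>The tensor product of three modules\<close>

text \<open>
  \<open>P \<otimes> V \<otimes> Q\<close> is the free module on the triples \<open>(p, v, q)\<close> modulo the trilinearity relations.
\<close>

definition tensor_rels ::
  "('k, 'r) ring_scheme \<Rightarrow> ('k, 'p, 'm) module_scheme \<Rightarrow> ('k, 'v, 'n) module_scheme \<Rightarrow>
   ('k, 'q, 'o) module_scheme \<Rightarrow> ('p \<times> 'v \<times> 'q \<Rightarrow> 'k) set"
  where "tensor_rels K P V Q =
    (let F = free_mod K (carrier P \<times> carrier V \<times> carrier Q);
         b = (\<lambda>p v q. free_basis K (p, v, q))
     in {b (p \<oplus>\<^bsub>P\<^esub> p') v q \<ominus>\<^bsub>F\<^esub> (b p v q \<oplus>\<^bsub>F\<^esub> b p' v q) | p p' v q.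
           p \<in> carrier P \<and> p' \<in> carrier P \<and> v \<in> carrier V \<and> q \<in> carrier Q} \<union>
        {b p (v \<oplus>\<^bsub>V\<^esub> v') q \<ominus>\<^bsub>F\<^esub> (b p v q \<oplus>\<^bsub>F\<^esub> b p v' q) | p v v' q.
           p \<in> carrier P \<and> v \<in> carrier V \<and> v' \<in> carrier V \<and> q \<in> carrier Q} \<union>
        {b p v (q \<oplus>\<^bsub>Q\<^esub> q') \<ominus>\<^bsub>F\<^esub> (b p v q \<oplus>\<^bsub>F\<^esub> b p v q') | p v q q'.
           p \<in> carrier P \<and> v \<in> carrier V \<and> q \<in> carrier Q \<and> q' \<in> carrier Q} \<union>
        {b (k \<odot>\<^bsub>P\<^esub> p) v q \<ominus>\<^bsub>F\<^esub> k \<odot>\<^bsub>F\<^esub> b p v q | k p v q.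
           k \<in> carrier K \<and> p \<in> carrier P \<and> v \<in> carrier V \<and> q \<in> carrier Q} \<union>
        {b p (k \<odot>\<^bsub>V\<^esub> v) q \<ominus>\<^bsub>F\<^esub> k \<odot>\<^bsub>F\<^esub> b p v q | k p v q.
           k \<in> carrier K \<and> p \<in> carrier P \<and> v \<in> carrier V \<and> q \<in> carrier Q} \<union>
        {b p v (k \<odot>\<^bsub>Q\<^esub> q) \<ominus>\<^bsub>F\<^esub> k \<odot>\<^bsub>F\<^esub> b p v q | k p v q.
           k \<in> carrier K \<and> p \<in> carrier P \<and> v \<in> carrier V \<and> q \<in> carrier Q})"

definition tensor_kernel ::
  "('k, 'r) ring_scheme \<Rightarrow> ('k, 'p, 'm) module_scheme \<Rightarrow> ('k, 'v, 'n) module_scheme \<Rightarrow>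
   ('k, 'q, 'o) module_scheme \<Rightarrow> ('p \<times> 'v \<times> 'q \<Rightarrow> 'k) set"
  where "tensor_kernel K P V Q =
    mod_span K (free_mod K (carrier P \<times> carrier V \<times> carrier Q)) (tensor_rels K P V Q)"

definition tensor ::
  "('k, 'r) ring_scheme \<Rightarrow> ('k, 'p, 'm) module_scheme \<Rightarrow> ('k, 'v, 'n) module_scheme \<Rightarrow>
   ('k, 'q, 'o) module_scheme \<Rightarrow> ('k, ('p \<times> 'v \<times> 'q \<Rightarrow> 'k) set) module"
  where "tensor K P V Q =
    quot_mod (free_mod K (carrier P \<times> carrier V \<times> carrier Q)) (tensor_kernel K P V Q)"

definition pure_tensor ::
  "('k, 'r) ring_scheme \<Rightarrow> ('k, 'p, 'm) module_scheme \<Rightarrow> ('k, 'v, 'n) module_scheme \<Rightarrow>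
   ('k, 'q, 'o) module_scheme \<Rightarrow> 'p \<Rightarrow> 'v \<Rightarrow> 'q \<Rightarrow> ('p \<times> 'v \<times> 'q \<Rightarrow> 'k) set"
  where "pure_tensor K P V Q p v q =
    tensor_kernel K P V Q +>\<^bsub>free_mod K (carrier P \<times> carrier V \<times> carrier Q)\<^esub> free_basis K (p, v, q)"

text \<open>
  The linear map into \<open>M\<close> induced by a trilinear map \<open>\<phi>\<close>.  By trilinearity the linear extension of
  \<open>\<phi>\<close> is constant on each coset, so that \<^const>\<open>the_elem\<close> picks its only value there.
\<close>

definition tensor_lift ::
  "('k, 'r) ring_scheme \<Rightarrow> ('k, 'a, 'm) module_scheme \<Rightarrow> ('p \<Rightarrow> 'v \<Rightarrow> 'q \<Rightarrow> 'a) \<Rightarrow>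
   ('p \<times> 'v \<times> 'q \<Rightarrow> 'k) set \<Rightarrow> 'a"
  where "tensor_lift K M \<phi> T = the_elem (lin_ext K M (\<lambda>(p, v, q). \<phi> p v q) ` T)"


section \<open>Algebras and bimodules\<close>

locale assoc_algebra = module K A + ring A for K and A (structure) +
  assumes smult_mult_left:
      "\<lbrakk>k \<in> carrier K; x \<in> carrier A; y \<in> carrier A\<rbrakk> \<Longrightarrow> (k \<odot>\<^bsub>A\<^esub> x) \<otimes>\<^bsub>A\<^esub> y = k \<odot>\<^bsub>A\<^esub> (x \<otimes>\<^bsub>A\<^esub> y)"
    and smult_mult_right:
      "\<lbrakk>k \<in> carrier K; x \<in> carrier A; y \<in> carrier A\<rbrakk> \<Longrightarrow> x \<otimes>\<^bsub>A\<^esub> (k \<odot>\<^bsub>A\<^esub> y) = k \<odot>\<^bsub>A\<^esub> (x \<otimes>\<^bsub>A\<^esub> y)"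

text \<open>
  A left module over \<open>A \<otimes>\<^sub>K A\<^sup>o\<^sup>p\<close> is spelled out as a left and a right action of \<open>A\<close> that commute and
  through which \<open>K\<close> acts in the same way on both sides.
\<close>

record ('k, 'a, 'm) bimod = "('k, 'm) module" +
  lact :: "'a \<Rightarrow> 'm \<Rightarrow> 'm"
  ract :: "'m \<Rightarrow> 'a \<Rightarrow> 'm"

locale bimodule = assoc_algebra K A + M?: module K M
  for K and A and M :: "('k, 'a, 'm, 'z) bimod_scheme" (structure) +
  assumes lact_closed: "\<lbrakk>a \<in> carrier A; x \<in> carrier M\<rbrakk> \<Longrightarrow> lact M a x \<in> carrier M"
    and ract_closed: "\<lbrakk>a \<in> carrier A; x \<in> carrier M\<rbrakk> \<Longrightarrow> ract M x a \<in> carrier M"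
    and lact_add: "\<lbrakk>a \<in> carrier A; x \<in> carrier M; y \<in> carrier M\<rbrakk> \<Longrightarrow>
      lact M a (x \<oplus>\<^bsub>M\<^esub> y) = lact M a x \<oplus>\<^bsub>M\<^esub> lact M a y"
    and ract_add: "\<lbrakk>a \<in> carrier A; x \<in> carrier M; y \<in> carrier M\<rbrakk> \<Longrightarrow>
      ract M (x \<oplus>\<^bsub>M\<^esub> y) a = ract M x a \<oplus>\<^bsub>M\<^esub> ract M y a"
    and add_lact: "\<lbrakk>a \<in> carrier A; b \<in> carrier A; x \<in> carrier M\<rbrakk> \<Longrightarrow>
      lact M (a \<oplus>\<^bsub>A\<^esub> b) x = lact M a x \<oplus>\<^bsub>M\<^esub> lact M b x"
    and add_ract: "\<lbrakk>a \<in> carrier A; b \<in> carrier A; x \<in> carrier M\<rbrakk> \<Longrightarrow>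
      ract M x (a \<oplus>\<^bsub>A\<^esub> b) = ract M x a \<oplus>\<^bsub>M\<^esub> ract M x b"
    and lact_mult: "\<lbrakk>a \<in> carrier A; b \<in> carrier A; x \<in> carrier M\<rbrakk> \<Longrightarrow>
      lact M (a \<otimes>\<^bsub>A\<^esub> b) x = lact M a (lact M b x)"
    and ract_mult: "\<lbrakk>a \<in> carrier A; b \<in> carrier A; x \<in> carrier M\<rbrakk> \<Longrightarrow>
      ract M x (a \<otimes>\<^bsub>A\<^esub> b) = ract M (ract M x a) b"
    and lact_one: "x \<in> carrier M \<Longrightarrow> lact M \<one>\<^bsub>A\<^esub> x = x"
    and ract_one: "x \<in> carrier M \<Longrightarrow> ract M x \<one>\<^bsub>A\<^esub> = x"
    and lact_ract: "\<lbrakk>a \<in> carrier A; b \<in> carrier A; x \<in> carrier M\<rbrakk> \<Longrightarrow>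
      ract M (lact M a x) b = lact M a (ract M x b)"
    and smult_lact: "\<lbrakk>k \<in> carrier K; x \<in> carrier M\<rbrakk> \<Longrightarrow> lact M (k \<odot>\<^bsub>A\<^esub> \<one>\<^bsub>A\<^esub>) x = k \<odot>\<^bsub>M\<^esub> x"
    and smult_ract: "\<lbrakk>k \<in> carrier K; x \<in> carrier M\<rbrakk> \<Longrightarrow> ract M x (k \<odot>\<^bsub>A\<^esub> \<one>\<^bsub>A\<^esub>) = k \<odot>\<^bsub>M\<^esub> x"

definition bimod_hom ::
  "('k, 'r) ring_scheme \<Rightarrow> ('k, 'a, 'x) module_scheme \<Rightarrow> ('k, 'a, 'm, 'y) bimod_scheme \<Rightarrow>
   ('k, 'a, 'n, 'z) bimod_scheme \<Rightarrow> ('m \<Rightarrow> 'n) set"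
  where "bimod_hom K A M N =
    {f \<in> mod_hom K M N.
       (\<forall>a\<in>carrier A. \<forall>x\<in>carrier M. f (lact M a x) = lact N a (f x)) \<and>
       (\<forall>a\<in>carrier A. \<forall>x\<in>carrier M. f (ract M x a) = ract N (f x) a)}"

definition short_exact ::
  "('k, 'r) ring_scheme \<Rightarrow> ('k, 'a, 'x) module_scheme \<Rightarrow> ('k, 'a, 'l) bimod \<Rightarrow> ('l \<Rightarrow> 'm) \<Rightarrow>
   ('k, 'a, 'm) bimod \<Rightarrow> ('m \<Rightarrow> 'n) \<Rightarrow> ('k, 'a, 'n) bimod \<Rightarrow> bool"
  where "short_exact K A L f M g N \<longleftrightarrow>
    bimodule K A L \<and> bimodule K A M \<and> bimodule K A N \<and>
    f \<in> bimod_hom K A L M \<and> g \<in> bimod_hom K A M N \<and>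
    inj_on f (carrier L) \<and>
    f ` carrier L = {x \<in> carrier M. g x = \<zero>\<^bsub>N\<^esub>} \<and>
    g ` carrier M = carrier N"

definition subbimodule ::
  "('k, 'a, 'x) module_scheme \<Rightarrow> 'm set \<Rightarrow> ('k, 'a, 'm, 'z) bimod_scheme \<Rightarrow> bool"
  where "subbimodule A N M \<longleftrightarrow> subgroup N (add_monoid M) \<and>
    (\<forall>a\<in>carrier A. \<forall>x\<in>N. lact M a x \<in> N \<and> ract M x a \<in> N)"

definition bimod_span ::
  "('k, 'a, 'x) module_scheme \<Rightarrow> ('k, 'a, 'm, 'z) bimod_scheme \<Rightarrow> 'm set \<Rightarrow> 'm set"
  where "bimod_span A M S = \<Inter>{N. subbimodule A N M \<and> S \<subseteq> N}"

definition restrict_bimod :: "('k, 'a, 'm) bimod \<Rightarrow> 'm set \<Rightarrow> ('k, 'a, 'm) bimod"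
  where "restrict_bimod M N = M\<lparr>carrier := N\<rparr>"

definition regular_bimod :: "('k, 'a) module \<Rightarrow> ('k, 'a, 'a) bimod"
  where "regular_bimod A = module.extend A (bimod.fields (mult A) (mult A))"

definition quot_algebra :: "('k, 'a, 'x) module_scheme \<Rightarrow> 'a set \<Rightarrow> ('k, 'a set) module"
  where "quot_algebra A I = ring.extend (A Quot I) (module.fields (quot_smult A I))"

text \<open>
  If \<open>N\<close> is a subbimodule of the \<open>A\<close>-bimodule \<open>M\<close> with \<open>I M + M I \<subseteq> N\<close>, then \<open>M / N\<close> is a bimodule over
  \<open>A / I\<close>, the class of \<open>a\<close> acting through \<open>a\<close>.
\<close>

definition quot_bimod :: "('k, 'a, 'm, 'z) bimod_scheme \<Rightarrow> 'm set \<Rightarrow> ('k, 'a set, 'm set) bimod"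
  where "quot_bimod M N = module.extend (quot_mod M N)
    (bimod.fields
      (\<lambda>C B. \<Union>a\<in>C. \<Union>x\<in>B. N +>\<^bsub>M\<^esub> lact M a x)
      (\<lambda>B C. \<Union>x\<in>B. \<Union>a\<in>C. N +>\<^bsub>M\<^esub> ract M x a))"

text \<open>The bimodule \<open>A \<otimes> V \<otimes> A\<close>, with \<open>a (p \<otimes> v \<otimes> q) b = ap \<otimes> v \<otimes> qb\<close>.\<close>

definition tensor_bimod ::
  "('k, 'r) ring_scheme \<Rightarrow> ('k, 'a) module \<Rightarrow> ('k, 'v) module \<Rightarrow>
   ('k, 'a, ('a \<times> 'v \<times> 'a \<Rightarrow> 'k) set) bimod"
  where "tensor_bimod K A V = module.extend (tensor K A V A)
    (bimod.fields
      (\<lambda>a. tensor_lift K (tensor K A V A) (\<lambda>p v q. pure_tensor K A V A (a \<otimes>\<^bsub>A\<^esub> p) v q))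
      (\<lambda>T b. tensor_lift K (tensor K A V A) (\<lambda>p v q. pure_tensor K A V A p v (q \<otimes>\<^bsub>A\<^esub> b)) T))"


section \<open>Presentations\<close>

text \<open>The free algebra on \<open>X\<close>: the monoid algebra of the monoid of words in \<open>X\<close>.\<close>

definition free_alg :: "('k, 'r) ring_scheme \<Rightarrow> 'x set \<Rightarrow> ('k, 'x list \<Rightarrow> 'k) module"
  where "free_alg K X = (free_mod K (lists X))
    \<lparr>mult := (\<lambda>f g w. finsum K (\<lambda>(u, v). f u \<otimes>\<^bsub>K\<^esub> g v) {(u, v). u @ v = w}),
     one := free_basis K []\<rparr>"

definition rel_ideal :: "('k, 'r) ring_scheme \<Rightarrow> 'x set \<Rightarrow> ('x list \<Rightarrow> 'k) set \<Rightarrow> ('x list \<Rightarrow> 'k) set"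
  where "rel_ideal K X R = genideal (free_alg K X) R"

definition presented_alg ::
  "('k, 'r) ring_scheme \<Rightarrow> 'x set \<Rightarrow> ('x list \<Rightarrow> 'k) set \<Rightarrow> ('k, ('x list \<Rightarrow> 'k) set) module"
  where "presented_alg K X R = quot_algebra (free_alg K X) (rel_ideal K X R)"

definition relation_bimod ::
  "('k, 'r) ring_scheme \<Rightarrow> 'x set \<Rightarrow> ('x list \<Rightarrow> 'k) set \<Rightarrow>
   ('k, ('x list \<Rightarrow> 'k) set, ('x list \<Rightarrow> 'k) set) bimod"
  where "relation_bimod K X R =
    (let F = free_alg K X; J = rel_ideal K X R
     in quot_bimod (restrict_bimod (regular_bimod F) J) (ideal_prod F J J))"

text \<open>
  In the following, \<^term>\<open>free_mod K R\<close> is \<open>KR\<close> and \<^term>\<open>free_basis K r\<close> is its basis element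
  \<open>r\<close> with a bar.
\<close>

type_synonym ('k, 'x) free_tensor =
  "(('x list \<Rightarrow> 'k) \<times> (('x list \<Rightarrow> 'k) \<Rightarrow> 'k) \<times> ('x list \<Rightarrow> 'k) \<Rightarrow> 'k) set"

definition pres_bimod ::
  "('k, 'r) ring_scheme \<Rightarrow> 'x set \<Rightarrow> ('x list \<Rightarrow> 'k) set \<Rightarrow>
   ('k, 'x list \<Rightarrow> 'k, ('k, 'x) free_tensor) bimod"
  where "pres_bimod K X R = tensor_bimod K (free_alg K X) (free_mod K R)"

text \<open>
  The map \<open>\<alpha>\<close>: the trilinear map below sends \<open>(u, \<rho>, v)\<close> to \<open>u \<epsilon>(\<rho>) v\<close>, where \<open>\<epsilon>\<close> is the linear map
  from \<open>KR\<close> to the free algebra that takes the basis element of \<open>r\<close> to \<open>r\<close>.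
\<close>

definition pres_map ::
  "('k, 'r) ring_scheme \<Rightarrow> 'x set \<Rightarrow> ('k, 'x) free_tensor \<Rightarrow> 'x list \<Rightarrow> 'k"
  where "pres_map K X =
    (let F = free_alg K X
     in tensor_lift K F (\<lambda>u \<rho> v. u \<otimes>\<^bsub>F\<^esub> lin_ext K F (\<lambda>r. r) \<rho> \<otimes>\<^bsub>F\<^esub> v))"

definition pres_kernel ::
  "('k, 'r) ring_scheme \<Rightarrow> 'x set \<Rightarrow> ('x list \<Rightarrow> 'k) set \<Rightarrow>
   ('k, 'x list \<Rightarrow> 'k, ('k, 'x) free_tensor) bimod"
  where "pres_kernel K X R = restrict_bimod (pres_bimod K X R)
    {T \<in> carrier (pres_bimod K X R). pres_map K X T = \<zero>\<^bsub>free_alg K X\<^esub>}"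

definition peiffer ::
  "('k, 'r) ring_scheme \<Rightarrow> 'x set \<Rightarrow> ('x list \<Rightarrow> 'k) set \<Rightarrow>
   ('x list \<Rightarrow> 'k) \<Rightarrow> 'x list \<Rightarrow> ('x list \<Rightarrow> 'k) \<Rightarrow> ('k, 'x) free_tensor"
  where "peiffer K X R r u s =
    (let F = free_alg K X; M = pres_bimod K X R;
         t = (\<lambda>f r g. pure_tensor K F (free_mod K R) F f (free_basis K r) g)
     in t \<one>\<^bsub>F\<^esub> r (free_basis K u \<otimes>\<^bsub>F\<^esub> s) \<ominus>\<^bsub>M\<^esub> t (r \<otimes>\<^bsub>F\<^esub> free_basis K u) s \<one>\<^bsub>F\<^esub>)"

definition peiffer_span ::
  "('k, 'r) ring_scheme \<Rightarrow> 'x set \<Rightarrow> ('x list \<Rightarrow> 'k) set \<Rightarrow> ('k, 'x) free_tensor set"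
  where "peiffer_span K X R = bimod_span (free_alg K X) (pres_kernel K X R)
    {peiffer K X R r u s | r u s. r \<in> R \<and> u \<in> lists X \<and> s \<in> R}"

definition pi2 ::
  "('k, 'r) ring_scheme \<Rightarrow> 'x set \<Rightarrow> ('x list \<Rightarrow> 'k) set \<Rightarrow>
   ('k, ('x list \<Rightarrow> 'k) set, ('k, 'x) free_tensor set) bimod"
  where "pi2 K X R = quot_bimod (pres_kernel K X R) (peiffer_span K X R)"

end

theory Submission
  imports Defs
begin

text \<open>
  Write \<open>F\<close> for the free algebra, \<open>J\<close> for the ideal of relations, \<open>A = F / J\<close>, \<open>T = F \<otimes> KR \<otimes> F\<close> with its map \<open>\<alpha>\<close>
  onto \<open>J\<close>, \<open>H\<close> for the kernel of \<open>\<alpha>\<close>, \<open>D\<close> for the span of the Peiffer elements and \<open>\<psi>\<close> for the base change map from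
  \<open>T\<close> onto \<open>A \<otimes> KR \<otimes> A\<close>.

  The kernel of \<open>\<psi>\<close> is \<open>J T + T J\<close>, and \<open>\<alpha>\<close> maps it onto \<open>J\<^sup>2\<close>.  So \<open>\<alpha>\<close> induces a surjection of \<open>A \<otimes> KR \<otimes> A\<close>
  onto \<open>J / J\<^sup>2\<close>, whose kernel is the image of \<open>H\<close>.  What remains is to identify the kernel of \<open>\<psi>\<close> on
  \<open>H\<close>, that is, to show \<open>H \<inter> (J T + T J) = D\<close>.  The inclusion of \<open>D\<close> is clear from the shape of its
  generators.

  For the converse, the generators of \<open>D\<close> force the identity \<open>t \<alpha>(u) - \<alpha>(t) u \<in> D\<close> for all \<open>t\<close> and \<open>u\<close> in \<open>T\<close>
  (lemma \<open>peiffer_identity\<close>), so that \<open>H J\<close> and \<open>J H\<close> lie in \<open>D\<close> and \<open>J T\<close> in \<open>T J + D\<close>.  Hence it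
  suffices that \<open>H \<inter> T J \<subseteq> H J\<close>.  Homologically, the quotient of \<open>H \<inter> T J\<close> by \<open>H J\<close> is \<open>Tor\<^sub>1(J, A) = Tor\<^sub>2(A, A)\<close>
  over \<open>F\<close>, and it vanishes because over a free algebra a module that is projective over \<open>K\<close> has a
  projective resolution of length one.  This is made explicit by a section \<open>\<sigma>\<close> of \<open>\<alpha>\<close> that is linear
  for the right action (lemma \<open>right_linear_section\<close>): the projection \<open>1 - \<sigma>\<alpha>\<close> of \<open>T\<close> onto \<open>H\<close> maps \<open>T J\<close>
  into \<open>H J\<close> and fixes \<open>H\<close> (lemma \<open>kernel_of_base_change_in_D\<close>).  The section is built along words from
  a \<open>K\<close>-linear section of \<open>F \<rightarrow> A\<close> and \<open>K\<close>-linear lifts from \<open>A\<close> to \<open>T\<close>, which exist since \<open>A\<close> is projective.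
\<close>

section \<open>Linear maps, submodules and quotient modules\<close>

lemma mod_homI:
  assumes "\<And>x. x \<in> carrier M \<Longrightarrow> f x \<in> carrier N"
    and "\<And>x y. x \<in> carrier M \<Longrightarrow> y \<in> carrier M \<Longrightarrow> f (x \<oplus>\<^bsub>M\<^esub> y) = f x \<oplus>\<^bsub>N\<^esub> f y"
    and "\<And>k x. k \<in> carrier K \<Longrightarrow> x \<in> carrier M \<Longrightarrow> f (k \<odot>\<^bsub>M\<^esub> x) = k \<odot>\<^bsub>N\<^esub> f x"
  shows "f \<in> mod_hom K M N"
  using assms by (auto simp: mod_hom_def)

lemma mod_hom_closed: "f \<in> mod_hom K M N \<Longrightarrow> x \<in> carrier M \<Longrightarrow> f x \<in> carrier N"
  and mod_hom_add: "f \<in> mod_hom K M N \<Longrightarrow> x \<in> carrier M \<Longrightarrow> y \<in> carrier M \<Longrightarrow>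
    f (x \<oplus>\<^bsub>M\<^esub> y) = f x \<oplus>\<^bsub>N\<^esub> f y"
  and mod_hom_smult: "f \<in> mod_hom K M N \<Longrightarrow> k \<in> carrier K \<Longrightarrow> x \<in> carrier M \<Longrightarrow>
    f (k \<odot>\<^bsub>M\<^esub> x) = k \<odot>\<^bsub>N\<^esub> f x"
  by (auto simp: mod_hom_def)

lemma mod_hom_zero:
  assumes "module K M" "module K N" "f \<in> mod_hom K M N"
  shows "f \<zero>\<^bsub>M\<^esub> = \<zero>\<^bsub>N\<^esub>"
proof -
  interpret M: module K M by fact
  interpret N: module K N by fact
  have "f (\<zero>\<^bsub>K\<^esub> \<odot>\<^bsub>M\<^esub> \<zero>\<^bsub>M\<^esub>) = \<zero>\<^bsub>K\<^esub> \<odot>\<^bsub>N\<^esub> f \<zero>\<^bsub>M\<^esub>"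
    using assms by (intro mod_hom_smult[of f K M N]) auto
  then show ?thesis
    using mod_hom_closed[OF assms(3), of "\<zero>\<^bsub>M\<^esub>"] by simp
qed

lemma mod_hom_neg:
  assumes "module K M" "module K N" "f \<in> mod_hom K M N" "x \<in> carrier M"
  shows "f (\<ominus>\<^bsub>M\<^esub> x) = \<ominus>\<^bsub>N\<^esub> f x"
proof -
  interpret M: module K M by fact
  interpret N: module K N by fact
  have "f (\<ominus>\<^bsub>M\<^esub> x) \<oplus>\<^bsub>N\<^esub> f x = \<zero>\<^bsub>N\<^esub>"
    using assms by (simp flip: mod_hom_add[OF assms(3)] add: M.M.l_neg mod_hom_zero)
  then show ?thesis
    using assms by (metis M.M.a_inv_closed N.M.minus_equality mod_hom_closed)
qed

lemma mod_hom_minus: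
  assumes "module K M" "module K N" "f \<in> mod_hom K M N" "x \<in> carrier M" "y \<in> carrier M"
  shows "f (x \<ominus>\<^bsub>M\<^esub> y) = f x \<ominus>\<^bsub>N\<^esub> f y"
proof -
  interpret M: module K M by fact
  show ?thesis
    using assms by (simp add: a_minus_def mod_hom_add[OF assms(3)] mod_hom_neg)
qed

lemma mod_hom_comp:
  assumes "f \<in> mod_hom K L M" "g \<in> mod_hom K M N"
  shows "(\<lambda>x. g (f x)) \<in> mod_hom K L N"
  using assms by (auto simp: mod_hom_def Pi_iff)

lemma mod_hom_diff:
  assumes "module K M" "module K N" "f \<in> mod_hom K M N" "g \<in> mod_hom K M N"
  shows "(\<lambda>x. f x \<ominus>\<^bsub>N\<^esub> g x) \<in> mod_hom K M N"
proof (rule mod_homI)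
  interpret M: module K M by fact
  interpret N: module K N by fact
  note c = mod_hom_closed[OF assms(3)] mod_hom_closed[OF assms(4)]
  show "f x \<ominus>\<^bsub>N\<^esub> g x \<in> carrier N" if "x \<in> carrier M" for x
    using c that by simp
  show "f (x \<oplus>\<^bsub>M\<^esub> y) \<ominus>\<^bsub>N\<^esub> g (x \<oplus>\<^bsub>M\<^esub> y) = f x \<ominus>\<^bsub>N\<^esub> g x \<oplus>\<^bsub>N\<^esub> (f y \<ominus>\<^bsub>N\<^esub> g y)"
    if "x \<in> carrier M" "y \<in> carrier M" for x y
    using c that by (simp add: mod_hom_add[OF assms(3)] mod_hom_add[OF assms(4)] a_minus_def
      N.M.minus_add N.M.a_ac)
  show "f (k \<odot>\<^bsub>M\<^esub> x) \<ominus>\<^bsub>N\<^esub> g (k \<odot>\<^bsub>M\<^esub> x) = k \<odot>\<^bsub>N\<^esub> (f x \<ominus>\<^bsub>N\<^esub> g x)"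
    if "k \<in> carrier K" "x \<in> carrier M" for k x
    using c that by (simp add: mod_hom_smult[OF assms(3)] mod_hom_smult[OF assms(4)] a_minus_def
      N.smult_r_distr N.smult_r_minus)
qed

lemma mod_hom_vimage_submodule:
  assumes "module K M" "module K N" "f \<in> mod_hom K M N" "submodule S K N"
  shows "submodule {x \<in> carrier M. f x \<in> S} K M"
proof -
  interpret M: module K M by fact
  interpret N: module K N by fact
  note S = N.submoduleE[OF assms(4)]
  show ?thesis
    using S assms(3)
    by (intro M.submoduleI) (auto simp: mod_hom_add mod_hom_smult mod_hom_neg[OF assms(1-3)]
        mod_hom_zero[OF assms(1-3)] intro: subgroup.one_closed[OF submodule.axioms(1)[OF assms(4)], simplified])
qed

lemma zero_submodule:
  assumes "module K M" shows "submodule {\<zero>\<^bsub>M\<^esub>} K M"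
proof -
  interpret M: module K M by fact
  show ?thesis by (intro M.submoduleI) auto
qed

lemma mod_hom_kernel_submodule:
  assumes "module K M" "module K N" "f \<in> mod_hom K M N"
  shows "submodule {x \<in> carrier M. f x = \<zero>\<^bsub>N\<^esub>} K M"
  using mod_hom_vimage_submodule[OF assms zero_submodule[OF assms(2)]] by simp

lemma add_subgroupD:
  assumes "subgroup N (add_monoid M)"
  shows "\<zero>\<^bsub>M\<^esub> \<in> N" "\<And>x. x \<in> N \<Longrightarrow> x \<in> carrier M"
    "\<And>x y. x \<in> N \<Longrightarrow> y \<in> N \<Longrightarrow> x \<oplus>\<^bsub>M\<^esub> y \<in> N" "\<And>x. x \<in> N \<Longrightarrow> \<ominus>\<^bsub>M\<^esub> x \<in> N"
    "\<And>x y. x \<in> N \<Longrightarrow> y \<in> N \<Longrightarrow> x \<ominus>\<^bsub>M\<^esub> y \<in> N"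
  using subgroup.one_closed[OF assms] subgroup.subset[OF assms] subgroup.m_closed[OF assms]
    subgroup.m_inv_closed[OF assms]
  by (auto simp: a_inv_def a_minus_def)

lemma (in abelian_group) add_subgroupI:
  assumes "N \<subseteq> carrier G" "\<zero> \<in> N" "\<And>x y. x \<in> N \<Longrightarrow> y \<in> N \<Longrightarrow> x \<oplus> y \<in> N"
    "\<And>x. x \<in> N \<Longrightarrow> \<ominus> x \<in> N"
  shows "subgroup N (add_monoid G)"
  using assms by (intro subgroup.intro) (auto simp: a_inv_def)

lemma (in abelian_group) minus_add_cancel:
  assumes "x \<in> carrier G" "y \<in> carrier G"
  shows "x \<ominus> y \<oplus> y = x" "x \<oplus> y \<ominus> y = x" "x \<ominus> (x \<ominus> y) = y"
  using assms by (simp_all add: a_minus_def minus_add a_assoc l_neg r_neg minus_minus r_neg1 r_neg2)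

lemma (in abelian_group) minus_eq_zero_iff:
  assumes "x \<in> carrier G" "y \<in> carrier G"
  shows "x \<ominus> y = \<zero> \<longleftrightarrow> x = y"
  using assms by (metis minus_add_cancel(1) l_zero r_neg minus_eq)

lemma (in abelian_group) minus_trans:
  assumes "a \<in> carrier G" "b \<in> carrier G" "c \<in> carrier G"
  shows "(a \<ominus> b) \<oplus> (b \<ominus> c) = a \<ominus> c"
  using assms by (simp add: a_minus_def a_assoc r_neg1 r_neg2)

lemma abelian_subgroup_of_subgroup:
  assumes "abelian_group M" "subgroup N (add_monoid M)"
  shows "abelian_subgroup N M"
  using assms by (intro abelian_subgroupI3 additive_subgroup.intro)

lemma coset_eq_iff:
  assumes "abelian_group M" "subgroup N (add_monoid M)" "x \<in> carrier M" "y \<in> carrier M"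
  shows "N +>\<^bsub>M\<^esub> x = N +>\<^bsub>M\<^esub> y \<longleftrightarrow> x \<ominus>\<^bsub>M\<^esub> y \<in> N"
proof -
  interpret abelian_group M by fact
  interpret abelian_subgroup N M by (rule abelian_subgroup_of_subgroup) fact+
  have "N +>\<^bsub>M\<^esub> x = N +>\<^bsub>M\<^esub> y \<longleftrightarrow> x \<in> N +>\<^bsub>M\<^esub> y"
    using a_rcos_self[OF assms(3)] a_repr_independence[OF _ assms(4) assms(2), of x] by metis
  also have "\<dots> \<longleftrightarrow> x \<ominus>\<^bsub>M\<^esub> y \<in> N"
    using a_rcos_module[OF assms(4,3)] by (simp add: a_minus_def)
  finally show ?thesis .
qed

lemma mem_coset_iff:
  assumes "abelian_group M" "subgroup N (add_monoid M)" "x \<in> carrier M"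
  shows "y \<in> N +>\<^bsub>M\<^esub> x \<longleftrightarrow> y \<in> carrier M \<and> y \<ominus>\<^bsub>M\<^esub> x \<in> N"
proof -
  interpret abelian_group M by fact
  interpret abelian_subgroup N M by (rule abelian_subgroup_of_subgroup) fact+
  show ?thesis
    using a_rcos_module[OF assms(3), of y] a_elemrcos_carrier[OF assms(3), of y] 
    by (auto simp add: a_minus_def)
qed

lemma coset_eq_subgroup_iff:
  assumes "abelian_group M" "subgroup N (add_monoid M)" "x \<in> carrier M"
  shows "N +>\<^bsub>M\<^esub> x = N \<longleftrightarrow> x \<in> N"
proof -
  interpret abelian_group M by fact
  have "N +>\<^bsub>M\<^esub> \<zero>\<^bsub>M\<^esub> = N"
    by (rule a_coset_add_zero) (use add_subgroupD[OF assms(2)] in auto)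
  then show ?thesis
    using coset_eq_iff[OF assms zero_closed] minus_add_cancel(1)[OF assms(3) zero_closed] assms(3)
    by (simp add: minus_closed)
qed

text \<open>
  Scalar multiplication and actions on cosets are defined as unions over representatives.  Such a
  union takes the value at any one representative if the operation respects the congruence.
\<close>

lemma UN_coset_eq:
  assumes "abelian_group M" "subgroup N (add_monoid M)" "x \<in> carrier M"
    and "\<And>y. y \<in> carrier M \<Longrightarrow> y \<ominus>\<^bsub>M\<^esub> x \<in> N \<Longrightarrow> h y = h x"
  shows "(\<Union>y \<in> N +>\<^bsub>M\<^esub> x. h y) = h x"
proof -
  interpret abelian_group M by fact
  have "x \<in> N +>\<^bsub>M\<^esub> x"
    using assms(2,3) add_subgroupD(1) by (simp add: mem_coset_iff assms(1) a_minus_def r_neg)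
  moreover have "h y = h x" if "y \<in> N +>\<^bsub>M\<^esub> x" for y
    using that assms(4)[of y] by (simp add: mem_coset_iff[OF assms(1-3)])
  ultimately show ?thesis by blast
qed

lemma quot_mod_simps:
  "carrier (quot_mod M N) = (\<lambda>x. N +>\<^bsub>M\<^esub> x) ` carrier M"
  "\<zero>\<^bsub>quot_mod M N\<^esub> = N"
  by (auto simp: quot_mod_def A_RCOSETS_def')

lemma quot_mod_add:
  assumes "abelian_group M" "subgroup N (add_monoid M)" "x \<in> carrier M" "y \<in> carrier M"
  shows "(N +>\<^bsub>M\<^esub> x) \<oplus>\<^bsub>quot_mod M N\<^esub> (N +>\<^bsub>M\<^esub> y) = N +>\<^bsub>M\<^esub> (x \<oplus>\<^bsub>M\<^esub> y)"
  using abelian_subgroup.a_rcos_sum[OF abelian_subgroup_of_subgroup[OF assms(1,2)] assms(3,4)]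
  by (simp add: quot_mod_def)

lemma quot_smult_coset:
  assumes "module K M" "submodule N K M" "k \<in> carrier K" "x \<in> carrier M"
  shows "quot_smult M N k (N +>\<^bsub>M\<^esub> x) = N +>\<^bsub>M\<^esub> (k \<odot>\<^bsub>M\<^esub> x)"
proof -
  interpret M: module K M by fact
  have N: "subgroup N (add_monoid M)"
    using assms(2) by (rule submodule.axioms)
  show ?thesis
    unfolding quot_smult_def
  proof (rule UN_coset_eq[OF M.M.abelian_group_axioms N assms(4)])
    fix y assume y: "y \<in> carrier M" "y \<ominus>\<^bsub>M\<^esub> x \<in> N"
    then have "k \<odot>\<^bsub>M\<^esub> (y \<ominus>\<^bsub>M\<^esub> x) \<in> N"
      using submodule.smult_closed[OF assms(2)] assms(3) by blast
    then show "N +>\<^bsub>M\<^esub> k \<odot>\<^bsub>M\<^esub> y = N +>\<^bsub>M\<^esub> k \<odot>\<^bsub>M\<^esub> x"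
      using y assms by (simp add: coset_eq_iff[OF M.M.abelian_group_axioms N] a_minus_def
        M.smult_r_distr M.smult_r_minus)
  qed
qed

lemma quot_mod_smult:
  assumes "module K M" "submodule N K M" "k \<in> carrier K" "x \<in> carrier M"
  shows "k \<odot>\<^bsub>quot_mod M N\<^esub> (N +>\<^bsub>M\<^esub> x) = N +>\<^bsub>M\<^esub> (k \<odot>\<^bsub>M\<^esub> x)"
  using quot_smult_coset[OF assms] by (simp add: quot_mod_def)

lemma quot_mod_module:
  assumes "module K M" "submodule N K M"
  shows "module K (quot_mod M N)"
proof -
  interpret M: module K M by fact
  have N: "subgroup N (add_monoid M)"
    using assms(2) by (rule submodule.axioms)
  note ag = M.M.abelian_group_axioms
  have zero: "N +>\<^bsub>M\<^esub> \<zero>\<^bsub>M\<^esub> = N"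
    using coset_eq_subgroup_iff[OF ag N M.M.zero_closed] add_subgroupD(1)[OF N] by simp
  have closed: "N +>\<^bsub>M\<^esub> a \<in> carrier (quot_mod M N)" if "a \<in> carrier M" for a
    using that by (simp add: quot_mod_simps)
  have rep: "\<exists>a\<in>carrier M. x = N +>\<^bsub>M\<^esub> a" if "x \<in> carrier (quot_mod M N)" for x
    using that by (simp add: quot_mod_simps image_iff)
  have z: "\<zero>\<^bsub>quot_mod M N\<^esub> = N +>\<^bsub>M\<^esub> \<zero>\<^bsub>M\<^esub>" using zero by (simp add: quot_mod_simps)
  note simps = closed quot_mod_add[OF ag N] quot_mod_smult[OF assms] z
  show ?thesis
  proof (rule moduleI)
    show "cring K" by (rule M.R.is_cring)
    show "abelian_group (quot_mod M N)"
    proof (rule abelian_groupI)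
      fix x assume x: "x \<in> carrier (quot_mod M N)"
      then obtain a where a: "a \<in> carrier M" "x = N +>\<^bsub>M\<^esub> a" using rep by blast
      show "\<exists>y\<in>carrier (quot_mod M N). y \<oplus>\<^bsub>quot_mod M N\<^esub> x = \<zero>\<^bsub>quot_mod M N\<^esub>"
        using a by (intro bexI[of _ "N +>\<^bsub>M\<^esub> (\<ominus>\<^bsub>M\<^esub> a)"]) (simp_all add: simps M.M.l_neg)
    next
      fix x y z
      assume "x \<in> carrier (quot_mod M N)" "y \<in> carrier (quot_mod M N)" "z \<in> carrier (quot_mod M N)"
      then obtain a b c where "a \<in> carrier M" "x = N +>\<^bsub>M\<^esub> a" "b \<in> carrier M" "y = N +>\<^bsub>M\<^esub> b"
        "c \<in> carrier M" "z = N +>\<^bsub>M\<^esub> c"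
        using rep by meson
      then show "x \<oplus>\<^bsub>quot_mod M N\<^esub> y \<oplus>\<^bsub>quot_mod M N\<^esub> z = x \<oplus>\<^bsub>quot_mod M N\<^esub> (y \<oplus>\<^bsub>quot_mod M N\<^esub> z)"
        by (simp add: simps(2) M.M.a_assoc)
    next
      fix x y
      assume "x \<in> carrier (quot_mod M N)" "y \<in> carrier (quot_mod M N)"
      then obtain a b where "a \<in> carrier M" "x = N +>\<^bsub>M\<^esub> a" "b \<in> carrier M" "y = N +>\<^bsub>M\<^esub> b"
        using rep by meson
      then show "x \<oplus>\<^bsub>quot_mod M N\<^esub> y = y \<oplus>\<^bsub>quot_mod M N\<^esub> x"
        by (simp add: simps(2) M.M.a_comm)
    next
      fix x y
      assume "x \<in> carrier (quot_mod M N)" "y \<in> carrier (quot_mod M N)"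
      then show "x \<oplus>\<^bsub>quot_mod M N\<^esub> y \<in> carrier (quot_mod M N)"
        by (metis rep closed simps(2) M.M.add.m_closed)
    next
      fix x
      assume "x \<in> carrier (quot_mod M N)"
      then show "\<zero>\<^bsub>quot_mod M N\<^esub> \<oplus>\<^bsub>quot_mod M N\<^esub> x = x"
        by (metis rep z simps(2) M.M.l_zero M.M.zero_closed)
    qed (simp only: z closed M.M.zero_closed)
  next
    fix k l x y
    assume kl: "k \<in> carrier K" "l \<in> carrier K"
      and "x \<in> carrier (quot_mod M N)" "y \<in> carrier (quot_mod M N)"
    then obtain a b where ab: "a \<in> carrier M" "x = N +>\<^bsub>M\<^esub> a" "b \<in> carrier M" "y = N +>\<^bsub>M\<^esub> b"
      using rep by meson
    show "k \<odot>\<^bsub>quot_mod M N\<^esub> (x \<oplus>\<^bsub>quot_mod M N\<^esub> y) =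
        k \<odot>\<^bsub>quot_mod M N\<^esub> x \<oplus>\<^bsub>quot_mod M N\<^esub> k \<odot>\<^bsub>quot_mod M N\<^esub> y"
      using kl ab by (simp add: simps(2,3) M.smult_r_distr)
  next
    fix k l x
    assume kl: "k \<in> carrier K" "l \<in> carrier K" and "x \<in> carrier (quot_mod M N)"
    then obtain a where a: "a \<in> carrier M" "x = N +>\<^bsub>M\<^esub> a"
      using rep by meson
    show "(k \<oplus>\<^bsub>K\<^esub> l) \<odot>\<^bsub>quot_mod M N\<^esub> x = k \<odot>\<^bsub>quot_mod M N\<^esub> x \<oplus>\<^bsub>quot_mod M N\<^esub> l \<odot>\<^bsub>quot_mod M N\<^esub> x"
      "(k \<otimes>\<^bsub>K\<^esub> l) \<odot>\<^bsub>quot_mod M N\<^esub> x = k \<odot>\<^bsub>quot_mod M N\<^esub> (l \<odot>\<^bsub>quot_mod M N\<^esub> x)"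
      using kl a by (simp_all add: simps(2,3) M.smult_l_distr M.smult_assoc1)
  qed (auto dest: rep simp: closed simps(3) intro: M.R.is_cring)
qed

lemma quot_mod_proj_hom:
  assumes "module K M" "submodule N K M"
  shows "(\<lambda>x. N +>\<^bsub>M\<^esub> x) \<in> mod_hom K M (quot_mod M N)"
proof -
  interpret M: module K M by fact
  show ?thesis
    by (rule mod_homI) (auto simp: quot_mod_simps quot_mod_smult[OF assms]
        quot_mod_add[OF M.M.abelian_group_axioms submodule.axioms(1)[OF assms(2)]])
qed

lemma mod_hom_sum:
  assumes "module K N" "f \<in> mod_hom K M N" "g \<in> mod_hom K M N"
  shows "(\<lambda>x. f x \<oplus>\<^bsub>N\<^esub> g x) \<in> mod_hom K M N"
proof (rule mod_homI)
  interpret N: module K N by fact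
  note c = mod_hom_closed[OF assms(2)] mod_hom_closed[OF assms(3)]
  show "f x \<oplus>\<^bsub>N\<^esub> g x \<in> carrier N" if "x \<in> carrier M" for x
    using c that by simp
  show "f (x \<oplus>\<^bsub>M\<^esub> y) \<oplus>\<^bsub>N\<^esub> g (x \<oplus>\<^bsub>M\<^esub> y) = f x \<oplus>\<^bsub>N\<^esub> g x \<oplus>\<^bsub>N\<^esub> (f y \<oplus>\<^bsub>N\<^esub> g y)"
    if "x \<in> carrier M" "y \<in> carrier M" for x y
    using c that by (simp add: mod_hom_add[OF assms(2)] mod_hom_add[OF assms(3)] N.M.a_ac)
  show "f (k \<odot>\<^bsub>M\<^esub> x) \<oplus>\<^bsub>N\<^esub> g (k \<odot>\<^bsub>M\<^esub> x) = k \<odot>\<^bsub>N\<^esub> (f x \<oplus>\<^bsub>N\<^esub> g x)"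
    if "k \<in> carrier K" "x \<in> carrier M" for k x
    using c that by (simp add: mod_hom_smult[OF assms(2)] mod_hom_smult[OF assms(3)]
      N.smult_r_distr)
qed

lemma mod_hom_scale:
  assumes "module K N" "f \<in> mod_hom K M N" "k \<in> carrier K"
  shows "(\<lambda>x. k \<odot>\<^bsub>N\<^esub> f x) \<in> mod_hom K M N"
proof (rule mod_homI)
  interpret N: module K N by fact
  note c = mod_hom_closed[OF assms(2)]
  show "k \<odot>\<^bsub>N\<^esub> f x \<in> carrier N" if "x \<in> carrier M" for x
    using c that assms(3) by simp
  show "k \<odot>\<^bsub>N\<^esub> f (x \<oplus>\<^bsub>M\<^esub> y) = k \<odot>\<^bsub>N\<^esub> f x \<oplus>\<^bsub>N\<^esub> k \<odot>\<^bsub>N\<^esub> f y"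
    if "x \<in> carrier M" "y \<in> carrier M" for x y
    using c that assms(3) by (simp add: mod_hom_add[OF assms(2)] N.smult_r_distr)
  show "k \<odot>\<^bsub>N\<^esub> f (l \<odot>\<^bsub>M\<^esub> x) = l \<odot>\<^bsub>N\<^esub> (k \<odot>\<^bsub>N\<^esub> f x)"
    if "l \<in> carrier K" "x \<in> carrier M" for l x
    using c that assms(3) by (simp add: mod_hom_smult[OF assms(2)] N.R.m_comm flip: N.smult_assoc1)
qed

lemma mod_hom_id: "(\<lambda>x. x) \<in> mod_hom K M M"
  by (auto simp: mod_hom_def)

lemma module_cong:
  assumes "module K M" "carrier N = carrier M" "zero N = zero M" "add N = add M" "smult N = smult M"
  shows "module K N"
proof -
  interpret M: module K M by fact
  show ?thesis
  proof (rule moduleI)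
    show "abelian_group N"
    proof (rule abelian_groupI)
      fix x assume "x \<in> carrier N"
      then show "\<exists>y\<in>carrier N. y \<oplus>\<^bsub>N\<^esub> x = \<zero>\<^bsub>N\<^esub>"
        using M.M.l_neg M.M.a_inv_closed assms(2-4) by metis
    qed (simp_all add: assms(2-4) M.M.a_ac)
  qed (simp_all add: assms(2-5) M.R.is_cring M.smult_l_distr M.smult_r_distr M.smult_assoc1)
qed

lemma add_subgroup_cong:
  assumes "carrier N = carrier M" "zero N = zero M" "add N = add M"
  shows "subgroup S (add_monoid N) \<longleftrightarrow> subgroup S (add_monoid M)"
  using assms by (simp add: subgroup_def m_inv_def)

lemma mod_span_submodule:
  assumes "module K M" "S \<subseteq> carrier M"
  shows "submodule (mod_span K M S) K M"
proof -
  interpret M: module K M by fact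
  have "carrier M \<in> {N. submodule N K M \<and> S \<subseteq> N}"
    using M.carrier_is_submodule assms(2) by simp
  then have "mod_span K M S \<subseteq> carrier M"
    unfolding mod_span_def by blast
  then show ?thesis
    using M.submoduleE add_subgroupD(1)[OF submodule.axioms(1)]
    by (intro M.submoduleI) (auto simp: mod_span_def)
qed

lemma mod_span_superset: "S \<subseteq> mod_span K M S"
  and mod_span_least: "submodule N K M \<Longrightarrow> S \<subseteq> N \<Longrightarrow> mod_span K M S \<subseteq> N"
  by (auto simp: mod_span_def)


section \<open>Free modules\<close>

lemma free_mod_simps:
  "\<zero>\<^bsub>free_mod K S\<^esub> = (\<lambda>s. \<zero>\<^bsub>K\<^esub>)"
  "c \<oplus>\<^bsub>free_mod K S\<^esub> d = (\<lambda>s. c s \<oplus>\<^bsub>K\<^esub> d s)"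
  "k \<odot>\<^bsub>free_mod K S\<^esub> c = (\<lambda>s. k \<otimes>\<^bsub>K\<^esub> c s)"
  by (auto simp: free_mod_def)

lemma free_mod_carrier:
  assumes "cring K"
  shows "c \<in> carrier (free_mod K S) \<longleftrightarrow>
    finite {s. c s \<noteq> \<zero>\<^bsub>K\<^esub>} \<and> {s. c s \<noteq> \<zero>\<^bsub>K\<^esub>} \<subseteq> S \<and> (\<forall>s. c s \<in> carrier K)"
proof -
  interpret K: cring K by fact
  have "c s \<in> carrier K" if "\<forall>s\<in>S. c s \<in> carrier K" "\<forall>s. s \<notin> S \<longrightarrow> c s = \<zero>\<^bsub>K\<^esub>" for s
    using that by (cases "s \<in> S") auto
  then show ?thesis by (auto simp: free_mod_def)
qed

lemma free_mod_module:
  assumes "cring K"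
  shows "module K (free_mod K S)"
proof -
  interpret K: cring K by fact
  have cl: "c s \<in> carrier K" if "c \<in> carrier (free_mod K S)" for c s
    using that by (simp add: free_mod_carrier[OF assms])
  have add: "c \<oplus>\<^bsub>free_mod K S\<^esub> d \<in> carrier (free_mod K S)"
    if "c \<in> carrier (free_mod K S)" "d \<in> carrier (free_mod K S)" for c d
  proof -
    have "{s. c s \<oplus>\<^bsub>K\<^esub> d s \<noteq> \<zero>\<^bsub>K\<^esub>} \<subseteq> {s. c s \<noteq> \<zero>\<^bsub>K\<^esub>} \<union> {s. d s \<noteq> \<zero>\<^bsub>K\<^esub>}" by auto
    then show ?thesis
      using that finite_subset[of "{s. c s \<oplus>\<^bsub>K\<^esub> d s \<noteq> \<zero>\<^bsub>K\<^esub>}"] unfolding free_mod_carrier[OF assms]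
      by (auto simp: free_mod_simps)
  qed
  have smult: "k \<odot>\<^bsub>free_mod K S\<^esub> c \<in> carrier (free_mod K S)"
    if "k \<in> carrier K" "c \<in> carrier (free_mod K S)" for k c
  proof -
    have "{s. k \<otimes>\<^bsub>K\<^esub> c s \<noteq> \<zero>\<^bsub>K\<^esub>} \<subseteq> {s. c s \<noteq> \<zero>\<^bsub>K\<^esub>}" using that by auto
    then show ?thesis
      using that finite_subset[of "{s. k \<otimes>\<^bsub>K\<^esub> c s \<noteq> \<zero>\<^bsub>K\<^esub>}"] unfolding free_mod_carrier[OF assms]
      by (auto simp: free_mod_simps)
  qed
  show ?thesis
  proof (rule moduleI)
    show "abelian_group (free_mod K S)"
    proof (rule abelian_groupI)
      show "\<zero>\<^bsub>free_mod K S\<^esub> \<in> carrier (free_mod K S)"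
        by (simp add: free_mod_carrier[OF assms] free_mod_simps)
      fix c assume c: "c \<in> carrier (free_mod K S)"
      have "(\<lambda>s. \<ominus>\<^bsub>K\<^esub> c s) \<in> carrier (free_mod K S)"
        using c K.add.inv_eq_1_iff by (auto simp: free_mod_carrier[OF assms] elim!: rev_finite_subset)
      then show "\<exists>y\<in>carrier (free_mod K S). y \<oplus>\<^bsub>free_mod K S\<^esub> c = \<zero>\<^bsub>free_mod K S\<^esub>"
        using c by (intro bexI[of _ "\<lambda>s. \<ominus>\<^bsub>K\<^esub> c s"])
          (auto simp: free_mod_carrier[OF assms] free_mod_simps K.l_neg)
    qed (erule (1) add | simp add: free_mod_simps cl K.a_ac)+
  qed (rule assms | erule (1) smult |
      simp add: free_mod_simps cl K.l_distr K.r_distr K.m_assoc)+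
qed

lemma free_basis_closed:
  assumes "cring K" "s \<in> S"
  shows "free_basis K s \<in> carrier (free_mod K S)"
proof -
  interpret K: cring K by fact
  have "{t. free_basis K s t \<noteq> \<zero>\<^bsub>K\<^esub>} \<subseteq> {s}" by (auto simp: free_basis_def)
  then show ?thesis
    using assms(2) finite_subset[of "{t. free_basis K s t \<noteq> \<zero>\<^bsub>K\<^esub>}" "{s}"]
    by (auto simp: free_mod_carrier[OF assms(1)] free_basis_def)
qed

lemma free_mod_induct [consumes 2, case_names zero basis add]:
  assumes "cring K" "c \<in> carrier (free_mod K S)"
    and zero: "P \<zero>\<^bsub>free_mod K S\<^esub>"
    and basis: "\<And>k s. k \<in> carrier K \<Longrightarrow> s \<in> S \<Longrightarrow> P (k \<odot>\<^bsub>free_mod K S\<^esub> free_basis K s)"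
    and add: "\<And>c d. c \<in> carrier (free_mod K S) \<Longrightarrow> d \<in> carrier (free_mod K S) \<Longrightarrow> P c \<Longrightarrow> P d \<Longrightarrow>
      P (c \<oplus>\<^bsub>free_mod K S\<^esub> d)"
  shows "P c"
proof -
  interpret K: cring K by fact
  interpret F: module K "free_mod K S" by (rule free_mod_module) fact
  have "finite T \<Longrightarrow> c \<in> carrier (free_mod K S) \<Longrightarrow> {s. c s \<noteq> \<zero>\<^bsub>K\<^esub>} \<subseteq> T \<Longrightarrow> P c" for T c
  proof (induction T arbitrary: c rule: finite_induct)
    case empty
    then have "c = \<zero>\<^bsub>free_mod K S\<^esub>" by (auto simp: free_mod_simps)
    then show ?case using zero by simp
  next
    case (insert t T)
    show ?case
    proof (cases "c t = \<zero>\<^bsub>K\<^esub>")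
      case True
      then have "{s. c s \<noteq> \<zero>\<^bsub>K\<^esub>} \<subseteq> T" using insert.prems(2) by auto
      then show ?thesis using insert.IH insert.prems(1) by blast
    next
      case False
      define d where "d = (\<lambda>s. if s = t then \<zero>\<^bsub>K\<^esub> else c s)"
      have tS: "t \<in> S" and ct: "c t \<in> carrier K"
        using False insert.prems(1) by (auto simp: free_mod_carrier[OF assms(1)])
      have "{s. d s \<noteq> \<zero>\<^bsub>K\<^esub>} \<subseteq> {s. c s \<noteq> \<zero>\<^bsub>K\<^esub>}" by (auto simp: d_def)
      then have "finite {s. d s \<noteq> \<zero>\<^bsub>K\<^esub>}" "{s. d s \<noteq> \<zero>\<^bsub>K\<^esub>} \<subseteq> S"
        using insert.prems(1) by (auto simp: free_mod_carrier[OF assms(1)] intro: finite_subset)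
      moreover have "d s \<in> carrier K" for s
        using insert.prems(1) by (simp add: free_mod_carrier[OF assms(1)] d_def)
      ultimately have d: "d \<in> carrier (free_mod K S)"
        by (simp add: free_mod_carrier[OF assms(1)])
      have "P d"
        using insert.prems(2) by (intro insert.IH d) (auto simp: d_def)
      moreover have "c = c t \<odot>\<^bsub>free_mod K S\<^esub> free_basis K t \<oplus>\<^bsub>free_mod K S\<^esub> d"
        using ct insert.prems(1)
        by (auto simp: free_mod_simps free_basis_def d_def fun_eq_iff free_mod_carrier[OF assms(1)])
      ultimately show ?thesis
        using add[OF F.smult_closed[OF ct free_basis_closed[OF assms(1) tS]] d basis[OF ct tS]]
        by simp
    qed
  qed
  then show ?thesis
    using assms(2) free_mod_carrier[OF assms(1)] by blast
qed

lemma lin_ext_superset: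
  assumes "module K M" "c \<in> carrier (free_mod K S)" "\<phi> \<in> S \<rightarrow> carrier M"
    and "finite T" "T \<subseteq> S" "{s. c s \<noteq> \<zero>\<^bsub>K\<^esub>} \<subseteq> T"
  shows "lin_ext K M \<phi> c = (\<Oplus>\<^bsub>M\<^esub>s\<in>T. c s \<odot>\<^bsub>M\<^esub> \<phi> s)"
proof -
  interpret M: module K M by fact
  have c: "c s \<in> carrier K" for s
    using assms(2) by (auto simp: free_mod_carrier[OF M.R.is_cring])
  show ?thesis
    unfolding lin_ext_def
    using assms(3-6) c by (intro M.M.add.finprod_mono_neutral_cong_left) (auto simp: Pi_iff)
qed

lemma lin_ext_hom:
  assumes "module K M" "\<phi> \<in> S \<rightarrow> carrier M"
  shows "lin_ext K M \<phi> \<in> mod_hom K (free_mod K S) M"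
proof -
  interpret M: module K M by fact
  interpret F: module K "free_mod K S" by (rule free_mod_module) (rule M.R.is_cring)
  note fc = free_mod_carrier[OF M.R.is_cring]
  note sup = lin_ext_superset[OF assms(1) _ assms(2)]
  show ?thesis
  proof (rule mod_homI)
    fix c assume c: "c \<in> carrier (free_mod K S)"
    then show "lin_ext K M \<phi> c \<in> carrier M"
      unfolding lin_ext_def using assms(2) by (intro M.M.finsum_closed) (auto simp: fc Pi_iff)
    fix k assume k: "k \<in> carrier K"
    let ?T = "{s. c s \<noteq> \<zero>\<^bsub>K\<^esub>}"
    have T: "finite ?T" "?T \<subseteq> S" using c by (auto simp: fc)
    have "lin_ext K M \<phi> (k \<odot>\<^bsub>free_mod K S\<^esub> c) = (\<Oplus>\<^bsub>M\<^esub>s\<in>?T. (k \<otimes>\<^bsub>K\<^esub> c s) \<odot>\<^bsub>M\<^esub> \<phi> s)"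
      using k by (subst sup[OF F.smult_closed[OF k c] T]) (auto simp: free_mod_simps)
    also have "\<dots> = (\<Oplus>\<^bsub>M\<^esub>s\<in>?T. k \<odot>\<^bsub>M\<^esub> (c s \<odot>\<^bsub>M\<^esub> \<phi> s))"
      using c k assms(2) by (intro M.M.finsum_cong') (auto simp: fc Pi_iff subset_iff M.smult_assoc1)
    also have "\<dots> = k \<odot>\<^bsub>M\<^esub> lin_ext K M \<phi> c"
      unfolding lin_ext_def using c k assms(2) 
      by (intro M.finsum_smult_ldistr[symmetric]) (auto simp: fc Pi_iff subset_iff)
    finally show "lin_ext K M \<phi> (k \<odot>\<^bsub>free_mod K S\<^esub> c) = k \<odot>\<^bsub>M\<^esub> lin_ext K M \<phi> c" .
  next
    fix c d assume cd: "c \<in> carrier (free_mod K S)" "d \<in> carrier (free_mod K S)"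
    let ?T = "{s. c s \<noteq> \<zero>\<^bsub>K\<^esub>} \<union> {s. d s \<noteq> \<zero>\<^bsub>K\<^esub>}"
    have T: "finite ?T" "?T \<subseteq> S" using cd by (auto simp: fc)
    have "lin_ext K M \<phi> (c \<oplus>\<^bsub>free_mod K S\<^esub> d) = (\<Oplus>\<^bsub>M\<^esub>s\<in>?T. (c s \<oplus>\<^bsub>K\<^esub> d s) \<odot>\<^bsub>M\<^esub> \<phi> s)"
      by (subst sup[OF F.M.a_closed[OF cd] T]) (auto simp: free_mod_simps)
    also have "\<dots> = (\<Oplus>\<^bsub>M\<^esub>s\<in>?T. c s \<odot>\<^bsub>M\<^esub> \<phi> s \<oplus>\<^bsub>M\<^esub> d s \<odot>\<^bsub>M\<^esub> \<phi> s)"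
      using cd assms(2) by (intro M.M.finsum_cong') (auto simp: fc Pi_iff subset_iff M.smult_l_distr)
    also have "\<dots> = (\<Oplus>\<^bsub>M\<^esub>s\<in>?T. c s \<odot>\<^bsub>M\<^esub> \<phi> s) \<oplus>\<^bsub>M\<^esub> (\<Oplus>\<^bsub>M\<^esub>s\<in>?T. d s \<odot>\<^bsub>M\<^esub> \<phi> s)"
      using cd assms(2) by (intro M.M.finsum_addf) (auto simp: fc Pi_iff subset_iff)
    also have "\<dots> = lin_ext K M \<phi> c \<oplus>\<^bsub>M\<^esub> lin_ext K M \<phi> d"
      using sup[OF cd(1) T] sup[OF cd(2) T] by simp
    finally show "lin_ext K M \<phi> (c \<oplus>\<^bsub>free_mod K S\<^esub> d) = lin_ext K M \<phi> c \<oplus>\<^bsub>M\<^esub> lin_ext K M \<phi> d" .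
  qed
qed

lemma lin_ext_basis:
  assumes "module K M" "\<phi> \<in> S \<rightarrow> carrier M" "s \<in> S"
  shows "lin_ext K M \<phi> (free_basis K s) = \<phi> s"
proof -
  interpret M: module K M by fact
  have "lin_ext K M \<phi> (free_basis K s) = (\<Oplus>\<^bsub>M\<^esub>t\<in>{s}. free_basis K s t \<odot>\<^bsub>M\<^esub> \<phi> t)"
    using assms
    by (intro lin_ext_superset[OF assms(1) free_basis_closed[OF M.R.is_cring assms(3)] assms(2)])
      (auto simp: free_basis_def)
  also have "\<dots> = \<phi> s"
    using funcset_mem[OF assms(2,3)] by (subst M.M.add.finprod_insert) (auto simp: free_basis_def)
  finally show ?thesis .
qed

text \<open>
  The form in which freeness is used throughout: an identity between linear maps, or membership of
  their values in a submodule, only has to be checked on basis elements.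
\<close>

lemma mod_hom_free_mem:
  assumes "module K M" "f \<in> mod_hom K (free_mod K S) M" "submodule N K M"
    and "\<And>s. s \<in> S \<Longrightarrow> f (free_basis K s) \<in> N" "c \<in> carrier (free_mod K S)"
  shows "f c \<in> N"
proof -
  interpret M: module K M by fact
  note cK = M.R.is_cring
  note N = add_subgroupD[OF submodule.axioms(1)[OF assms(3)]]
  from cK assms(5) show ?thesis
  proof (induction rule: free_mod_induct)
    case zero
    show ?case using N(1) mod_hom_zero[OF free_mod_module[OF cK] assms(1,2)] by simp
  next
    case (basis k s)
    show ?case
      using mod_hom_smult[OF assms(2) basis(1) free_basis_closed[OF cK basis(2)]]
        submodule.smult_closed[OF assms(3) basis(1) assms(4)[OF basis(2)]] by simp
  next
    case (add c d)
    then show ?case using N(3) mod_hom_add[OF assms(2) add(1,2)] by simp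
  qed
qed

lemma mod_hom_free_eqI:
  assumes "module K M" "f \<in> mod_hom K (free_mod K S) M" "g \<in> mod_hom K (free_mod K S) M"
    and "\<And>s. s \<in> S \<Longrightarrow> f (free_basis K s) = g (free_basis K s)"
    and "c \<in> carrier (free_mod K S)"
  shows "f c = g c"
proof -
  interpret M: module K M by fact
  note fm = free_mod_module[OF M.R.is_cring]
  note cl = mod_hom_closed[OF assms(2)] mod_hom_closed[OF assms(3)]
  have "f c \<ominus>\<^bsub>M\<^esub> g c \<in> {\<zero>\<^bsub>M\<^esub>}"
  proof (rule mod_hom_free_mem[where f = "\<lambda>x. f x \<ominus>\<^bsub>M\<^esub> g x",
        OF assms(1) mod_hom_diff[OF fm assms(1-3)] zero_submodule[OF assms(1)] _ assms(5)])
    fix s assume s: "s \<in> S"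
    then show "f (free_basis K s) \<ominus>\<^bsub>M\<^esub> g (free_basis K s) \<in> {\<zero>\<^bsub>M\<^esub>}"
      using cl(2)[OF free_basis_closed[OF M.R.is_cring s]] assms(4)[OF s] by (simp add: M.M.minus_eq_zero_iff)
  qed
  then show ?thesis
    using M.M.minus_eq_zero_iff[OF cl(1)[OF assms(5)] cl(2)[OF assms(5)]] by simp
qed

text \<open>
  The definition of a projective module tests against modules on two particular types.  Splitting
  the module off the free module on its carrier removes this restriction.
\<close>

lemma projective_module_lift:
  assumes "projective_module K P" "module K M" "module K N"
    and "g \<in> mod_hom K M N" "h \<in> mod_hom K P N" "h ` carrier P \<subseteq> g ` carrier M"
  obtains h' where "h' \<in> mod_hom K P M" "\<And>x. x \<in> carrier P \<Longrightarrow> g (h' x) = h x"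
proof -
  interpret P: module K P using assms(1) by (simp add: projective_module_def)
  note cK = P.R.is_cring and mP = P.module_axioms
  let ?F = "free_mod K (carrier P)"
  let ?p = "lin_ext K P (\<lambda>x. x)"
  have p: "?p \<in> mod_hom K ?F P" by (rule lin_ext_hom[OF mP]) simp
  have pb: "?p (free_basis K x) = x" if "x \<in> carrier P" for x
    using lin_ext_basis[OF mP _ that, of "\<lambda>x. x"] by simp
  have surj: "?p ` carrier ?F = carrier P"
  proof
    show "carrier P \<subseteq> ?p ` carrier ?F"
    proof
      fix x assume x: "x \<in> carrier P"
      have "?p (free_basis K x) \<in> ?p ` carrier ?F"
        by (intro imageI free_basis_closed[OF cK x])
      then show "x \<in> ?p ` carrier ?F" using pb[OF x] by simp
    qed
  qed (use mod_hom_closed[OF p] in blast)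
  have id: "(\<lambda>x. x) \<in> mod_hom K P P" by (auto simp: mod_hom_def)
  have "\<exists>i\<in>mod_hom K P ?F. \<forall>x\<in>carrier P. ?p (i x) = x"
    using assms(1) free_mod_module[OF cK] mP p surj id
    unfolding projective_module_def by meson
  then obtain i where i: "i \<in> mod_hom K P ?F" "\<And>x. x \<in> carrier P \<Longrightarrow> ?p (i x) = x"
    by auto
  have "\<exists>m. m \<in> carrier M \<and> g m = h x" if "x \<in> carrier P" for x
  proof -
    have "h x \<in> g ` carrier M" using assms(6) that by blast
    then show ?thesis by auto
  qed
  then obtain l where l: "\<And>x. x \<in> carrier P \<Longrightarrow> l x \<in> carrier M \<and> g (l x) = h x"
    by meson
  let ?l = "lin_ext K M l"
  have l_Pi: "l \<in> carrier P \<rightarrow> carrier M" using l by auto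
  have L: "?l \<in> mod_hom K ?F M" by (rule lin_ext_hom[OF assms(2) l_Pi])
  have eq: "g (?l c) = h (?p c)" if "c \<in> carrier ?F" for c
    using mod_hom_comp[OF L assms(4)] mod_hom_comp[OF p assms(5)] _ that
    by (rule mod_hom_free_eqI[OF assms(3)]) (simp add: lin_ext_basis[OF assms(2) l_Pi] pb l)
  show thesis
    using that[OF mod_hom_comp[OF i(1) L]] eq i mod_hom_closed[OF i(1)] by simp
qed
section \<open>The tensor product\<close>

text \<open>
  Stating linearity in each variable as membership in \<^const>\<open>mod_hom\<close> lets trilinearity of a composite
  follow by composing linear maps.
\<close>

definition trilinear ::
  "('k, 'r) ring_scheme \<Rightarrow> ('k, 'p, 'm) module_scheme \<Rightarrow> ('k, 'v, 'n) module_scheme \<Rightarrow>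
   ('k, 'q, 'o) module_scheme \<Rightarrow> ('k, 'a, 'l) module_scheme \<Rightarrow> ('p \<Rightarrow> 'v \<Rightarrow> 'q \<Rightarrow> 'a) \<Rightarrow> bool"
  where "trilinear K P V Q M \<phi> \<longleftrightarrow>
    (\<forall>v\<in>carrier V. \<forall>q\<in>carrier Q. (\<lambda>p. \<phi> p v q) \<in> mod_hom K P M) \<and>
    (\<forall>p\<in>carrier P. \<forall>q\<in>carrier Q. (\<lambda>v. \<phi> p v q) \<in> mod_hom K V M) \<and>
    (\<forall>p\<in>carrier P. \<forall>v\<in>carrier V. (\<lambda>q. \<phi> p v q) \<in> mod_hom K Q M)"

locale three_modules =
  fixes K :: "('k, 'r) ring_scheme" and P :: "('k, 'p, 'm) module_scheme"
    and V :: "('k, 'v, 'n) module_scheme" and Q :: "('k, 'q, 'o) module_scheme"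
  assumes modules: "module K P" "module K V" "module K Q"
begin

abbreviation Tn where "Tn \<equiv> tensor K P V Q"
abbreviation Fr where "Fr \<equiv> free_mod K (carrier P \<times> carrier V \<times> carrier Q)"
abbreviation pt where "pt \<equiv> pure_tensor K P V Q"

sublocale P: module K P by (rule modules)
sublocale V: module K V by (rule modules)
sublocale Q: module K Q by (rule modules)
sublocale Fr: module K Fr by (rule free_mod_module) (rule P.R.is_cring)

lemma triple_basis_closed:
  "p \<in> carrier P \<Longrightarrow> v \<in> carrier V \<Longrightarrow> q \<in> carrier Q \<Longrightarrow> free_basis K (p, v, q) \<in> carrier Fr"
  by (rule free_basis_closed) (auto intro: P.R.is_cring)

lemma tensor_rels_closed: "tensor_rels K P V Q \<subseteq> carrier Fr"
  unfolding tensor_rels_def Let_def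
  by (rule subsetI, elim UnE CollectE exE conjE; simp add: triple_basis_closed)

lemma tensor_relsI:
  "p \<in> carrier P \<Longrightarrow> p' \<in> carrier P \<Longrightarrow> v \<in> carrier V \<Longrightarrow> q \<in> carrier Q \<Longrightarrow>
    free_basis K (p \<oplus>\<^bsub>P\<^esub> p', v, q) \<ominus>\<^bsub>Fr\<^esub>
      (free_basis K (p, v, q) \<oplus>\<^bsub>Fr\<^esub> free_basis K (p', v, q)) \<in> tensor_rels K P V Q"
  "p \<in> carrier P \<Longrightarrow> v \<in> carrier V \<Longrightarrow> v' \<in> carrier V \<Longrightarrow> q \<in> carrier Q \<Longrightarrow>
    free_basis K (p, v \<oplus>\<^bsub>V\<^esub> v', q) \<ominus>\<^bsub>Fr\<^esub>
      (free_basis K (p, v, q) \<oplus>\<^bsub>Fr\<^esub> free_basis K (p, v', q)) \<in> tensor_rels K P V Q"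
  "p \<in> carrier P \<Longrightarrow> v \<in> carrier V \<Longrightarrow> q \<in> carrier Q \<Longrightarrow> q' \<in> carrier Q \<Longrightarrow>
    free_basis K (p, v, q \<oplus>\<^bsub>Q\<^esub> q') \<ominus>\<^bsub>Fr\<^esub>
      (free_basis K (p, v, q) \<oplus>\<^bsub>Fr\<^esub> free_basis K (p, v, q')) \<in> tensor_rels K P V Q"
  "k \<in> carrier K \<Longrightarrow> p \<in> carrier P \<Longrightarrow> v \<in> carrier V \<Longrightarrow> q \<in> carrier Q \<Longrightarrow>
    free_basis K (k \<odot>\<^bsub>P\<^esub> p, v, q) \<ominus>\<^bsub>Fr\<^esub>
      k \<odot>\<^bsub>Fr\<^esub> free_basis K (p, v, q) \<in> tensor_rels K P V Q"
  "k \<in> carrier K \<Longrightarrow> p \<in> carrier P \<Longrightarrow> v \<in> carrier V \<Longrightarrow> q \<in> carrier Q \<Longrightarrow>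
    free_basis K (p, k \<odot>\<^bsub>V\<^esub> v, q) \<ominus>\<^bsub>Fr\<^esub>
      k \<odot>\<^bsub>Fr\<^esub> free_basis K (p, v, q) \<in> tensor_rels K P V Q"
  "k \<in> carrier K \<Longrightarrow> p \<in> carrier P \<Longrightarrow> v \<in> carrier V \<Longrightarrow> q \<in> carrier Q \<Longrightarrow>
    free_basis K (p, v, k \<odot>\<^bsub>Q\<^esub> q) \<ominus>\<^bsub>Fr\<^esub>
      k \<odot>\<^bsub>Fr\<^esub> free_basis K (p, v, q) \<in> tensor_rels K P V Q"
  unfolding tensor_rels_def Let_def
  subgoal by ((rule UnI1)+, intro CollectI exI conjI, rule refl)
  subgoal by (rule UnI1, rule UnI1, rule UnI1, rule UnI1, rule UnI2, intro CollectI exI conjI, rule refl)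
  subgoal by (rule UnI1, rule UnI1, rule UnI1, rule UnI2, intro CollectI exI conjI, rule refl)
  subgoal by (rule UnI1, rule UnI1, rule UnI2, intro CollectI exI conjI, rule refl)
  subgoal by (rule UnI1, rule UnI2, intro CollectI exI conjI, rule refl)
  subgoal by (rule UnI2, intro CollectI exI conjI, rule refl)
  done

lemma tensor_kernel_submodule: "submodule (tensor_kernel K P V Q) K Fr"
  unfolding tensor_kernel_def
  by (rule mod_span_submodule[OF Fr.module_axioms tensor_rels_closed])

lemmas tensor_kernel_subgroup = submodule.axioms(1)[OF tensor_kernel_submodule]

lemma tensor_module: "module K Tn"
  unfolding tensor_def by (rule quot_mod_module[OF Fr.module_axioms tensor_kernel_submodule])

sublocale Tn: module K Tn by (rule tensor_module)

lemma tensor_proj_hom: "(\<lambda>c. tensor_kernel K P V Q +>\<^bsub>Fr\<^esub> c) \<in> mod_hom K Fr Tn"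
  unfolding tensor_def by (rule quot_mod_proj_hom[OF Fr.module_axioms tensor_kernel_submodule])

lemma pure_tensor_trilinear: "trilinear K P V Q Tn pt"
proof -
  let ?c = "\<lambda>c. tensor_kernel K P V Q +>\<^bsub>Fr\<^esub> c"
  have eq: "?c x = ?c y" if "x \<in> carrier Fr" "y \<in> carrier Fr" "x \<ominus>\<^bsub>Fr\<^esub> y \<in> tensor_rels K P V Q" for x y
    using that mod_span_superset[of "tensor_rels K P V Q" K Fr]
    by (subst coset_eq_iff[OF Fr.M.abelian_group_axioms tensor_kernel_subgroup])
      (auto simp: tensor_kernel_def)
  note b = triple_basis_closed
  note hom = mod_hom_add[OF tensor_proj_hom] mod_hom_smult[OF tensor_proj_hom]
  have cl: "pt p v q \<in> carrier Tn" if "p \<in> carrier P" "v \<in> carrier V" "q \<in> carrier Q" for p v q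
    unfolding pure_tensor_def using that by (intro mod_hom_closed[OF tensor_proj_hom] b)
  show ?thesis
    unfolding trilinear_def
  proof (intro conjI ballI mod_homI cl)
    fix p p' v q assume c: "p \<in> carrier P" "p' \<in> carrier P" "v \<in> carrier V" "q \<in> carrier Q"
    show "pt (p \<oplus>\<^bsub>P\<^esub> p') v q = pt p v q \<oplus>\<^bsub>Tn\<^esub> pt p' v q"
      using eq[OF _ _ tensor_relsI(1)[OF c]] c
      by (simp add: pure_tensor_def b flip: hom)
  next
    fix p v v' q assume c: "p \<in> carrier P" "v \<in> carrier V" "v' \<in> carrier V" "q \<in> carrier Q"
    show "pt p (v \<oplus>\<^bsub>V\<^esub> v') q = pt p v q \<oplus>\<^bsub>Tn\<^esub> pt p v' q"
      using eq[OF _ _ tensor_relsI(2)[OF c]] c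
      by (simp add: pure_tensor_def b flip: hom)
  next
    fix p v q q' assume c: "p \<in> carrier P" "v \<in> carrier V" "q \<in> carrier Q" "q' \<in> carrier Q"
    show "pt p v (q \<oplus>\<^bsub>Q\<^esub> q') = pt p v q \<oplus>\<^bsub>Tn\<^esub> pt p v q'"
      using eq[OF _ _ tensor_relsI(3)[OF c]] c
      by (simp add: pure_tensor_def b flip: hom)
  next
    fix k p v q assume c: "k \<in> carrier K" "p \<in> carrier P" "v \<in> carrier V" "q \<in> carrier Q"
    show "pt (k \<odot>\<^bsub>P\<^esub> p) v q = k \<odot>\<^bsub>Tn\<^esub> pt p v q"
      using eq[OF _ _ tensor_relsI(4)[OF c]] c
      by (simp add: pure_tensor_def b flip: hom)
  next
    fix k p v q assume c: "k \<in> carrier K" "p \<in> carrier P" "v \<in> carrier V" "q \<in> carrier Q"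
    show "pt p (k \<odot>\<^bsub>V\<^esub> v) q = k \<odot>\<^bsub>Tn\<^esub> pt p v q"
      using eq[OF _ _ tensor_relsI(5)[OF c]] c
      by (simp add: pure_tensor_def b flip: hom)
  next
    fix k p v q assume c: "k \<in> carrier K" "p \<in> carrier P" "v \<in> carrier V" "q \<in> carrier Q"
    show "pt p v (k \<odot>\<^bsub>Q\<^esub> q) = k \<odot>\<^bsub>Tn\<^esub> pt p v q"
      using eq[OF _ _ tensor_relsI(6)[OF c]] c
      by (simp add: pure_tensor_def b flip: hom)
  qed
qed

lemma pure_tensor_homs:
  "v \<in> carrier V \<Longrightarrow> q \<in> carrier Q \<Longrightarrow> (\<lambda>p. pt p v q) \<in> mod_hom K P Tn"
  "p \<in> carrier P \<Longrightarrow> q \<in> carrier Q \<Longrightarrow> (\<lambda>v. pt p v q) \<in> mod_hom K V Tn"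
  "p \<in> carrier P \<Longrightarrow> v \<in> carrier V \<Longrightarrow> (\<lambda>q. pt p v q) \<in> mod_hom K Q Tn"
  using pure_tensor_trilinear by (auto simp: trilinear_def)

lemma pure_tensor_closed:
  "p \<in> carrier P \<Longrightarrow> v \<in> carrier V \<Longrightarrow> q \<in> carrier Q \<Longrightarrow> pt p v q \<in> carrier Tn"
  using mod_hom_closed[OF pure_tensor_homs(1)] .

lemma tensor_induct [consumes 1, case_names zero pure add]:
  assumes "t \<in> carrier Tn" "S \<zero>\<^bsub>Tn\<^esub>"
    and "\<And>p v q. p \<in> carrier P \<Longrightarrow> v \<in> carrier V \<Longrightarrow> q \<in> carrier Q \<Longrightarrow> S (pt p v q)"
    and "\<And>t u. t \<in> carrier Tn \<Longrightarrow> u \<in> carrier Tn \<Longrightarrow> S t \<Longrightarrow> S u \<Longrightarrow> S (t \<oplus>\<^bsub>Tn\<^esub> u)"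
  shows "S t"
proof -
  let ?c = "\<lambda>c. tensor_kernel K P V Q +>\<^bsub>Fr\<^esub> c"
  obtain c where c: "c \<in> carrier Fr" "t = ?c c"
    using assms(1) by (auto simp: tensor_def quot_mod_simps)
  from P.R.is_cring c(1) have "S (?c c)"
  proof (induction rule: free_mod_induct)
    case zero
    then show ?case
      using assms(2) mod_hom_zero[OF Fr.module_axioms tensor_module tensor_proj_hom] by simp
  next
    case (basis k s)
    then obtain p v q where s: "s = (p, v, q)" "p \<in> carrier P" "v \<in> carrier V" "q \<in> carrier Q" by auto
    have "?c (k \<odot>\<^bsub>Fr\<^esub> free_basis K s) = pt (k \<odot>\<^bsub>P\<^esub> p) v q"
      using mod_hom_smult[OF tensor_proj_hom basis(1) triple_basis_closed[OF s(2-4)]]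
        mod_hom_smult[OF pure_tensor_homs(1)[OF s(3,4)] basis(1) s(2)] s(1)
      by (simp add: pure_tensor_def)
    then show ?case using assms(3) s basis by simp
  next
    case (add c d)
    then show ?case
      using assms(4) mod_hom_add[OF tensor_proj_hom add(1,2)] mod_hom_closed[OF tensor_proj_hom] by simp
  qed
  then show ?thesis using c by simp
qed

lemma tensor_mem:
  assumes "submodule N K Tn" "t \<in> carrier Tn"
    and "\<And>p v q. p \<in> carrier P \<Longrightarrow> v \<in> carrier V \<Longrightarrow> q \<in> carrier Q \<Longrightarrow> pt p v q \<in> N"
  shows "t \<in> N"
  using assms(2)
  by (induction rule: tensor_induct)
    (use assms(3) add_subgroupD[OF submodule.axioms(1)[OF assms(1)]] in auto)

lemma tensor_hom_eqI:
  assumes "module K M" "f \<in> mod_hom K Tn M" "g \<in> mod_hom K Tn M"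
    and "\<And>p v q. p \<in> carrier P \<Longrightarrow> v \<in> carrier V \<Longrightarrow> q \<in> carrier Q \<Longrightarrow> f (pt p v q) = g (pt p v q)"
    and "t \<in> carrier Tn"
  shows "f t = g t"
  using assms(5)
proof (induction rule: tensor_induct)
  case zero
  show ?case
    by (simp add: mod_hom_zero[OF tensor_module assms(1,2)] mod_hom_zero[OF tensor_module assms(1,3)])
next
  case (pure p v q) then show ?case by (rule assms(4))
next
  case (add t u) then show ?case by (simp add: mod_hom_add[OF assms(2)] mod_hom_add[OF assms(3)])
qed

text \<open>
  The universal property: the linear extension of a trilinear map kills the six families of
  relations, hence the submodule that they span, and so is constant on its cosets.
\<close>

lemma
  assumes "module K M" "trilinear K P V Q M \<phi>"
  shows tensor_lift_hom: "tensor_lift K M \<phi> \<in> mod_hom K Tn M"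
    and tensor_lift_pure: "p \<in> carrier P \<Longrightarrow> v \<in> carrier V \<Longrightarrow> q \<in> carrier Q \<Longrightarrow>
      tensor_lift K M \<phi> (pt p v q) = \<phi> p v q"
proof -
  interpret M: module K M by fact
  let ?\<phi> = "\<lambda>(p, v, q). \<phi> p v q"
  let ?L = "lin_ext K M ?\<phi>"
  let ?N = "tensor_kernel K P V Q"
  note tri = assms(2)[unfolded trilinear_def, THEN conjunct1, rule_format]
    assms(2)[unfolded trilinear_def, THEN conjunct2, THEN conjunct1, rule_format]
    assms(2)[unfolded trilinear_def, THEN conjunct2, THEN conjunct2, rule_format]
  have \<phi>: "\<phi> p v q \<in> carrier M" if "p \<in> carrier P" "v \<in> carrier V" "q \<in> carrier Q" for p v q
    using mod_hom_closed[OF tri(1)] that by blast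
  have Pi: "?\<phi> \<in> carrier P \<times> carrier V \<times> carrier Q \<rightarrow> carrier M"
    using \<phi> by auto
  have L: "?L \<in> mod_hom K Fr M" by (rule lin_ext_hom[OF assms(1) Pi])
  have Lb: "?L (free_basis K (p, v, q)) = \<phi> p v q"
    if "p \<in> carrier P" "v \<in> carrier V" "q \<in> carrier Q" for p v q
    using lin_ext_basis[OF assms(1) Pi, of "(p, v, q)"] that by simp
  note Lm = mod_hom_minus[OF Fr.module_axioms assms(1) L]
  note simps = Lm mod_hom_add[OF L] mod_hom_smult[OF L] Lb triple_basis_closed \<phi>
    mod_hom_add[OF tri(1)] mod_hom_add[OF tri(2)] mod_hom_add[OF tri(3)]
    mod_hom_smult[OF tri(1)] mod_hom_smult[OF tri(2)] mod_hom_smult[OF tri(3)]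
  have "tensor_rels K P V Q \<subseteq> {x \<in> carrier Fr. ?L x = \<zero>\<^bsub>M\<^esub>}"
  proof
    fix x assume x: "x \<in> tensor_rels K P V Q"
    then have "?L x = \<zero>\<^bsub>M\<^esub>"
      unfolding tensor_rels_def Let_def
      by (elim UnE CollectE exE conjE; simp add: simps M.M.r_neg a_minus_def[of M])
    then show "x \<in> {x \<in> carrier Fr. ?L x = \<zero>\<^bsub>M\<^esub>}"
      using x tensor_rels_closed by blast
  qed
  then have N: "?N \<subseteq> {x \<in> carrier Fr. ?L x = \<zero>\<^bsub>M\<^esub>}"
    unfolding tensor_kernel_def
    by (intro mod_span_least mod_hom_kernel_submodule[OF Fr.module_axioms assms(1) L])
  have lift: "tensor_lift K M \<phi> (?N +>\<^bsub>Fr\<^esub> c) = ?L c" if c: "c \<in> carrier Fr" for c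
  proof -
    have "?L d = ?L c" if "d \<in> ?N +>\<^bsub>Fr\<^esub> c" for d
    proof -
      have d: "d \<in> carrier Fr" "d \<ominus>\<^bsub>Fr\<^esub> c \<in> ?N"
        using that mem_coset_iff[OF Fr.M.abelian_group_axioms tensor_kernel_subgroup c] by auto
      then have "?L d \<ominus>\<^bsub>M\<^esub> ?L c = \<zero>\<^bsub>M\<^esub>"
        using N Lm c by auto
      then show ?thesis
        using M.M.minus_eq_zero_iff mod_hom_closed[OF L] c d by blast
    qed
    moreover have "c \<in> ?N +>\<^bsub>Fr\<^esub> c"
      using c add_subgroupD(1)[OF tensor_kernel_subgroup]
      by (simp add: mem_coset_iff[OF Fr.M.abelian_group_axioms tensor_kernel_subgroup]
          Fr.M.minus_eq_zero_iff[THEN iffD2])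
    ultimately have "?L ` (?N +>\<^bsub>Fr\<^esub> c) = {?L c}" by blast
    then show ?thesis by (simp add: tensor_lift_def)
  qed
  show "tensor_lift K M \<phi> (pt p v q) = \<phi> p v q"
    if "p \<in> carrier P" "v \<in> carrier V" "q \<in> carrier Q"
    using that by (simp add: pure_tensor_def lift triple_basis_closed Lb)
  show "tensor_lift K M \<phi> \<in> mod_hom K Tn M"
  proof (rule mod_homI)
    fix t assume "t \<in> carrier Tn"
    then obtain c where c: "c \<in> carrier Fr" "t = ?N +>\<^bsub>Fr\<^esub> c"
      by (auto simp: tensor_def quot_mod_simps)
    then show "tensor_lift K M \<phi> t \<in> carrier M" by (simp add: lift mod_hom_closed[OF L])
    show "tensor_lift K M \<phi> (k \<odot>\<^bsub>Tn\<^esub> t) = k \<odot>\<^bsub>M\<^esub> tensor_lift K M \<phi> t" if "k \<in> carrier K" for k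
      using c that by (simp add: lift mod_hom_smult[OF L] flip: mod_hom_smult[OF tensor_proj_hom])
    fix u assume "u \<in> carrier Tn"
    then obtain d where d: "d \<in> carrier Fr" "u = ?N +>\<^bsub>Fr\<^esub> d"
      by (auto simp: tensor_def quot_mod_simps)
    show "tensor_lift K M \<phi> (t \<oplus>\<^bsub>Tn\<^esub> u) = tensor_lift K M \<phi> t \<oplus>\<^bsub>M\<^esub> tensor_lift K M \<phi> u"
      using c d by (simp add: lift mod_hom_add[OF L] flip: mod_hom_add[OF tensor_proj_hom])
  qed
qed

end
section \<open>Bimodules\<close>

lemma assoc_algebraD:
  assumes "assoc_algebra K A"
  shows "module K A" "ring A" "cring K"
  using assms by (auto simp: assoc_algebra_def module_def)

lemma mult_left_hom:
  assumes "assoc_algebra K A" "a \<in> carrier A"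
  shows "(\<lambda>x. a \<otimes>\<^bsub>A\<^esub> x) \<in> mod_hom K A A"
proof -
  interpret ring A using assoc_algebraD[OF assms(1)] by simp
  show ?thesis
    using assms by (intro mod_homI) (auto simp: r_distr assoc_algebra.smult_mult_right)
qed

lemma mult_right_hom:
  assumes "assoc_algebra K A" "a \<in> carrier A"
  shows "(\<lambda>x. x \<otimes>\<^bsub>A\<^esub> a) \<in> mod_hom K A A"
proof -
  interpret ring A using assoc_algebraD[OF assms(1)] by simp
  show ?thesis
    using assms by (intro mod_homI) (auto simp: l_distr assoc_algebra.smult_mult_left)
qed

lemma bimoduleD:
  assumes "bimodule K A M"
  shows "assoc_algebra K A" "module K M"
  using assms by (auto simp: bimodule_def)

text \<open>
  In a bimodule \<open>K\<close> acts through the central elements \<open>k1\<close> of the algebra, so that the actions of the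
  algebra commute with it.
\<close>

lemma lact_hom:
  assumes "bimodule K A M" "a \<in> carrier A"
  shows "lact M a \<in> mod_hom K M M"
proof -
  interpret B: bimodule K A M by fact
  interpret A: ring A using assoc_algebraD[OF bimoduleD(1)] assms(1) by blast
  interpret AA: module K A using assoc_algebraD[OF bimoduleD(1)] assms(1) by blast
  show ?thesis
  proof (rule mod_homI)
    fix k x assume kx: "k \<in> carrier K" "x \<in> carrier M"
    then have k: "k \<odot>\<^bsub>A\<^esub> \<one>\<^bsub>A\<^esub> \<in> carrier A" by simp
    have "lact M a (k \<odot>\<^bsub>M\<^esub> x) = lact M (a \<otimes>\<^bsub>A\<^esub> (k \<odot>\<^bsub>A\<^esub> \<one>\<^bsub>A\<^esub>)) x"
      using kx k assms(2) by (simp add: B.lact_mult B.smult_lact)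
    also have "a \<otimes>\<^bsub>A\<^esub> (k \<odot>\<^bsub>A\<^esub> \<one>\<^bsub>A\<^esub>) = (k \<odot>\<^bsub>A\<^esub> \<one>\<^bsub>A\<^esub>) \<otimes>\<^bsub>A\<^esub> a"
      using kx assms(2) by (simp add: B.smult_mult_left B.smult_mult_right)
    also have "lact M \<dots> x = k \<odot>\<^bsub>M\<^esub> lact M a x"
      using kx k assms(2) by (simp add: B.lact_mult B.smult_lact B.lact_closed)
    finally show "lact M a (k \<odot>\<^bsub>M\<^esub> x) = k \<odot>\<^bsub>M\<^esub> lact M a x" .
  qed (use assms(2) B.lact_closed B.lact_add in auto)
qed

lemma ract_hom:
  assumes "bimodule K A M" "a \<in> carrier A"
  shows "(\<lambda>x. ract M x a) \<in> mod_hom K M M"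
proof -
  interpret B: bimodule K A M by fact
  interpret A: ring A using assoc_algebraD[OF bimoduleD(1)] assms(1) by blast
  interpret AA: module K A using assoc_algebraD[OF bimoduleD(1)] assms(1) by blast
  show ?thesis
  proof (rule mod_homI)
    fix k x assume kx: "k \<in> carrier K" "x \<in> carrier M"
    then have k: "k \<odot>\<^bsub>A\<^esub> \<one>\<^bsub>A\<^esub> \<in> carrier A" by simp
    have "ract M (k \<odot>\<^bsub>M\<^esub> x) a = ract M x ((k \<odot>\<^bsub>A\<^esub> \<one>\<^bsub>A\<^esub>) \<otimes>\<^bsub>A\<^esub> a)"
      using kx k assms(2) by (simp add: B.ract_mult B.smult_ract)
    also have "(k \<odot>\<^bsub>A\<^esub> \<one>\<^bsub>A\<^esub>) \<otimes>\<^bsub>A\<^esub> a = a \<otimes>\<^bsub>A\<^esub> (k \<odot>\<^bsub>A\<^esub> \<one>\<^bsub>A\<^esub>)"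
      using kx assms(2) by (simp add: B.smult_mult_left B.smult_mult_right)
    also have "ract M x \<dots> = k \<odot>\<^bsub>M\<^esub> ract M x a"
      using kx k assms(2) by (simp add: B.ract_mult B.smult_ract B.ract_closed)
    finally show "ract M (k \<odot>\<^bsub>M\<^esub> x) a = k \<odot>\<^bsub>M\<^esub> ract M x a" .
  qed (use assms(2) B.ract_closed B.ract_add in auto)
qed

lemma act_hom:
  assumes "bimodule K A M" "x \<in> carrier M"
  shows "(\<lambda>a. lact M a x) \<in> mod_hom K A M" "(\<lambda>a. ract M x a) \<in> mod_hom K A M"
proof -
  interpret B: bimodule K A M by fact
  interpret A: ring A using assoc_algebraD[OF bimoduleD(1)] assms(1) by blast
  interpret AA: module K A using assoc_algebraD[OF bimoduleD(1)] assms(1) by blast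
  have k: "k \<odot>\<^bsub>A\<^esub> a = (k \<odot>\<^bsub>A\<^esub> \<one>\<^bsub>A\<^esub>) \<otimes>\<^bsub>A\<^esub> a" "k \<odot>\<^bsub>A\<^esub> a = a \<otimes>\<^bsub>A\<^esub> (k \<odot>\<^bsub>A\<^esub> \<one>\<^bsub>A\<^esub>)"
    if "k \<in> carrier K" "a \<in> carrier A" for k a
    using that by (simp_all add: B.smult_mult_left B.smult_mult_right)
  show "(\<lambda>a. lact M a x) \<in> mod_hom K A M"
  proof (rule mod_homI)
    fix l a assume "l \<in> carrier K" "a \<in> carrier A"
    then show "lact M (l \<odot>\<^bsub>A\<^esub> a) x = l \<odot>\<^bsub>M\<^esub> lact M a x"
      using assms(2) by (simp only: k(1)) (simp add: B.lact_mult B.smult_lact B.lact_closed)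
  qed (use assms(2) B.lact_closed B.add_lact in auto)
  show "(\<lambda>a. ract M x a) \<in> mod_hom K A M"
  proof (rule mod_homI)
    fix l a assume "l \<in> carrier K" "a \<in> carrier A"
    then show "ract M x (l \<odot>\<^bsub>A\<^esub> a) = l \<odot>\<^bsub>M\<^esub> ract M x a"
      using assms(2) by (simp only: k(2)) (simp add: B.ract_mult B.smult_ract B.ract_closed)
  qed (use assms(2) B.ract_closed B.add_ract in auto)
qed

lemma bimodule_minus:
  assumes "bimodule K A M"
  shows "a \<in> carrier A \<Longrightarrow> x \<in> carrier M \<Longrightarrow> y \<in> carrier M \<Longrightarrow>
      lact M a (x \<ominus>\<^bsub>M\<^esub> y) = lact M a x \<ominus>\<^bsub>M\<^esub> lact M a y"
    and "a \<in> carrier A \<Longrightarrow> x \<in> carrier M \<Longrightarrow> y \<in> carrier M \<Longrightarrow>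
      ract M (x \<ominus>\<^bsub>M\<^esub> y) a = ract M x a \<ominus>\<^bsub>M\<^esub> ract M y a"
    and "a \<in> carrier A \<Longrightarrow> b \<in> carrier A \<Longrightarrow> x \<in> carrier M \<Longrightarrow>
      lact M (a \<ominus>\<^bsub>A\<^esub> b) x = lact M a x \<ominus>\<^bsub>M\<^esub> lact M b x"
    and "a \<in> carrier A \<Longrightarrow> b \<in> carrier A \<Longrightarrow> x \<in> carrier M \<Longrightarrow>
      ract M x (a \<ominus>\<^bsub>A\<^esub> b) = ract M x a \<ominus>\<^bsub>M\<^esub> ract M x b"
  using mod_hom_minus[OF _ _ lact_hom[OF assms]] mod_hom_minus[OF _ _ ract_hom[OF assms]]
    mod_hom_minus[OF _ _ act_hom(1)[OF assms]] mod_hom_minus[OF _ _ act_hom(2)[OF assms]]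
    bimoduleD(2)[OF assms] assoc_algebraD(1)[OF bimoduleD(1)[OF assms]]
  by simp_all

lemma bimod_homD:
  assumes "f \<in> bimod_hom K A M N"
  shows "f \<in> mod_hom K M N"
    "\<And>a x. a \<in> carrier A \<Longrightarrow> x \<in> carrier M \<Longrightarrow> f (lact M a x) = lact N a (f x)"
    "\<And>a x. a \<in> carrier A \<Longrightarrow> x \<in> carrier M \<Longrightarrow> f (ract M x a) = ract N (f x) a"
  using assms by (auto simp: bimod_hom_def)

lemma subbimoduleD:
  assumes "subbimodule A N M"
  shows "subgroup N (add_monoid M)" "\<And>a x. a \<in> carrier A \<Longrightarrow> x \<in> N \<Longrightarrow> lact M a x \<in> N"
    "\<And>a x. a \<in> carrier A \<Longrightarrow> x \<in> N \<Longrightarrow> ract M x a \<in> N"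
  using assms by (auto simp: subbimodule_def)

lemma subbimodule_submodule:
  assumes "bimodule K A M" "subbimodule A N M"
  shows "submodule N K M"
proof -
  interpret B: bimodule K A M by fact
  interpret A: ring A using assoc_algebraD[OF bimoduleD(1)] assms(1) by blast
  interpret AA: module K A using assoc_algebraD[OF bimoduleD(1)] assms(1) by blast
  have "k \<odot>\<^bsub>M\<^esub> x \<in> N" if "k \<in> carrier K" "x \<in> N" for k x
  proof -
    have "lact M (k \<odot>\<^bsub>A\<^esub> \<one>\<^bsub>A\<^esub>) x \<in> N"
      using that by (intro subbimoduleD[OF assms(2)]) auto
    then show ?thesis
      using that add_subgroupD(2)[OF subbimoduleD(1)[OF assms(2)]] by (simp add: B.smult_lact)
  qed
  then show ?thesis
    using subbimoduleD(1)[OF assms(2)] by (simp add: submodule_def submodule_axioms_def)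
qed

lemma restrict_bimod_simps [simp]:
  "carrier (restrict_bimod M N) = N" "zero (restrict_bimod M N) = zero M"
  "add (restrict_bimod M N) = add M" "smult (restrict_bimod M N) = smult M"
  "lact (restrict_bimod M N) = lact M" "ract (restrict_bimod M N) = ract M"
  "a_r_coset (restrict_bimod M N) = a_r_coset M"
  by (auto simp: restrict_bimod_def a_r_coset_def' fun_eq_iff)

lemma restrict_bimod_bimodule:
  assumes "bimodule K A M" "subbimodule A N M"
  shows "bimodule K A (restrict_bimod M N)"
proof -
  interpret B: bimodule K A M by fact
  note sub = add_subgroupD(2)[OF subbimoduleD(1)[OF assms(2)]] subbimoduleD(2,3)[OF assms(2)]
  have "module K (restrict_bimod M N)"
    unfolding restrict_bimod_def
    by (rule submodule.submodule_is_module[OF subbimodule_submodule[OF assms] bimoduleD(2)[OF assms(1)]])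
  then show ?thesis
    using sub bimoduleD(1)[OF assms(1)]
    by (simp add: bimodule_def bimodule_axioms_def B.lact_add B.ract_add B.add_lact B.add_ract B.lact_mult
        B.ract_mult B.lact_one B.ract_one B.lact_ract B.smult_lact B.smult_ract)
qed

text \<open>
  The inverse in an additive monoid is described through its carrier, so that passing to a smaller
  carrier has to be justified by uniqueness of inverses.
\<close>

lemma restrict_bimod_subgroup_iff:
  assumes "abelian_group M" "subgroup H (add_monoid M)"
  shows "subgroup S (add_monoid (restrict_bimod M H)) \<longleftrightarrow> S \<subseteq> H \<and> subgroup S (add_monoid M)"
proof -
  interpret G: group "add_monoid M"
    using assms(1) by (simp add: abelian_group.a_group)
  have r: "add_monoid (restrict_bimod M H) = (add_monoid M)\<lparr>carrier := H\<rparr>"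
    by (simp add: restrict_bimod_def)
  show ?thesis
    unfolding r
  proof (intro iffI conjI)
    assume S: "subgroup S ((add_monoid M)\<lparr>carrier := H\<rparr>)"
    show "S \<subseteq> H" using subgroup.subset[OF S] by simp
    show "subgroup S (add_monoid M)" by (rule G.incl_subgroup[OF assms(2) S])
  next
    assume "S \<subseteq> H \<and> subgroup S (add_monoid M)"
    then show "subgroup S ((add_monoid M)\<lparr>carrier := H\<rparr>)"
      using G.subgroup_incl[OF _ assms(2)] by blast
  qed
qed

lemma bimod_span_subbimodule:
  assumes "bimodule K A M" "S \<subseteq> carrier M"
  shows "subbimodule A (bimod_span A M S) M"
proof -
  interpret M: module K M by (rule bimoduleD[OF assms(1)])
  interpret B: bimodule K A M by fact
  have c: "subbimodule A (carrier M) M"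
    using submodule.axioms(1)[OF M.carrier_is_submodule] B.lact_closed B.ract_closed
    by (simp add: subbimodule_def)
  then have "bimod_span A M S \<subseteq> carrier M"
    using assms(2) by (auto simp: bimod_span_def)
  moreover have "x \<oplus>\<^bsub>M\<^esub> y \<in> bimod_span A M S" "\<ominus>\<^bsub>M\<^esub> x \<in> bimod_span A M S" "\<zero>\<^bsub>M\<^esub> \<in> bimod_span A M S"
    if "x \<in> bimod_span A M S" "y \<in> bimod_span A M S" for x y
    using that by (auto simp: bimod_span_def intro: add_subgroupD(1,3,4)[OF subbimoduleD(1)])
  moreover have "\<zero>\<^bsub>M\<^esub> \<in> bimod_span A M S"
    by (auto simp: bimod_span_def intro: add_subgroupD(1)[OF subbimoduleD(1)])
  ultimately have "subgroup (bimod_span A M S) (add_monoid M)"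
    by (intro M.M.add_subgroupI) auto
  then show ?thesis
    by (auto simp: subbimodule_def bimod_span_def)
qed

lemma bimod_span_superset: "S \<subseteq> bimod_span A M S"
  and bimod_span_least: "subbimodule A N M \<Longrightarrow> S \<subseteq> N \<Longrightarrow> bimod_span A M S \<subseteq> N"
  by (auto simp: bimod_span_def)

lemma regular_bimod_simps [simp]:
  "carrier (regular_bimod A) = carrier A" "zero (regular_bimod A) = zero A"
  "add (regular_bimod A) = add A" "smult (regular_bimod A) = smult A"
  "lact (regular_bimod A) = mult A" "ract (regular_bimod A) = mult A"
  by (auto simp: regular_bimod_def module.defs bimod.defs)

lemma regular_bimod_bimodule:
  assumes "assoc_algebra K A"
  shows "bimodule K A (regular_bimod A)"
proof -
  interpret A: assoc_algebra K A by fact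
  have "module K (regular_bimod A)"
    by (rule module_cong[OF assoc_algebraD(1)[OF assms]]) auto
  then show ?thesis
    using assms by (simp add: bimodule_def bimodule_axioms_def A.l_distr A.r_distr A.m_assoc
        A.smult_mult_left A.smult_mult_right)
qed

lemma ideal_subgroup: "ideal I A \<Longrightarrow> subgroup I (add_monoid A)"
  by (simp add: additive_subgroup.a_subgroup ideal.axioms(1))

lemma ideal_subbimodule:
  assumes "ideal I A"
  shows "subbimodule A I (regular_bimod A)"
  using add_subgroup_cong[of "regular_bimod A" A I] ideal_subgroup[OF assms]
  by (simp add: subbimodule_def ideal.I_l_closed[OF assms] ideal.I_r_closed[OF assms])

lemma ideal_submodule:
  fixes A :: "('k, 'a) module"
  assumes "assoc_algebra K A" "ideal I A"
  shows "submodule I K A"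
  using submodule.smult_closed[OF subbimodule_submodule[OF regular_bimod_bimodule[OF assms(1)]
      ideal_subbimodule[OF assms(2)]]] ideal_subgroup[OF assms(2)]
  by (simp add: submodule_def submodule_axioms_def)


section \<open>Quotients of algebras and bimodules\<close>

lemma quot_algebra_simps:
  "carrier (quot_algebra A I) = (\<lambda>a. I +>\<^bsub>A\<^esub> a) ` carrier A"
  "zero (quot_algebra A I) = I" "add (quot_algebra A I) = set_add A"
  "smult (quot_algebra A I) = quot_smult A I" "mult (quot_algebra A I) = rcoset_mult A I"
  "one (quot_algebra A I) = I +>\<^bsub>A\<^esub> \<one>\<^bsub>A\<^esub>"
  by (auto simp: quot_algebra_def FactRing_def ring.defs module.defs A_RCOSETS_def')

locale quotient_algebra =
  fixes K :: "('k, 'r) ring_scheme" and A :: "('k, 'a) module" and I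
  assumes algebra: "assoc_algebra K A" and ideal: "ideal I A"
begin

abbreviation cl where "cl a \<equiv> I +>\<^bsub>A\<^esub> a"

sublocale A: assoc_algebra K A by (rule algebra)
sublocale I: ideal I A by (rule ideal)

lemma class_eq_iff: "a \<in> carrier A \<Longrightarrow> b \<in> carrier A \<Longrightarrow> cl a = cl b \<longleftrightarrow> a \<ominus>\<^bsub>A\<^esub> b \<in> I"
  by (rule coset_eq_iff[OF A.M.abelian_group_axioms ideal_subgroup[OF ideal]])

lemma class_eq_zero_iff: "a \<in> carrier A \<Longrightarrow> cl a = I \<longleftrightarrow> a \<in> I"
  by (rule coset_eq_subgroup_iff[OF A.M.abelian_group_axioms ideal_subgroup[OF ideal]])

lemma class_ops:
  "a \<in> carrier A \<Longrightarrow> cl a \<in> carrier (quot_algebra A I)"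
  "a \<in> carrier A \<Longrightarrow> b \<in> carrier A \<Longrightarrow> cl a \<oplus>\<^bsub>quot_algebra A I\<^esub> cl b = cl (a \<oplus>\<^bsub>A\<^esub> b)"
  "a \<in> carrier A \<Longrightarrow> b \<in> carrier A \<Longrightarrow> cl a \<otimes>\<^bsub>quot_algebra A I\<^esub> cl b = cl (a \<otimes>\<^bsub>A\<^esub> b)"
  "k \<in> carrier K \<Longrightarrow> a \<in> carrier A \<Longrightarrow> k \<odot>\<^bsub>quot_algebra A I\<^esub> cl a = cl (k \<odot>\<^bsub>A\<^esub> a)"
  "\<one>\<^bsub>quot_algebra A I\<^esub> = cl \<one>\<^bsub>A\<^esub>"
  using quot_smult_coset[OF assoc_algebraD(1)[OF algebra] ideal_submodule[OF algebra ideal]]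
  by (auto simp: quot_algebra_simps I.a_rcos_sum I.rcoset_mult_add)

lemma class_rep:
  assumes "c \<in> carrier (quot_algebra A I)"
  obtains a where "a \<in> carrier A" "c = cl a"
  using assms by (auto simp: quot_algebra_simps)

lemma quot_algebra_module: "module K (quot_algebra A I)"
  by (rule module_cong[OF quot_mod_module[OF assoc_algebraD(1)[OF algebra] ideal_submodule[OF algebra ideal]]])
    (auto simp: quot_algebra_simps quot_mod_simps, auto simp: quot_mod_def)

lemma quot_algebra_assoc_algebra: "assoc_algebra K (quot_algebra A I)"
proof -
  interpret Q: module K "quot_algebra A I" by (rule quot_algebra_module)
  have "Group.monoid (quot_algebra A I)"
    by (rule monoidI; (elim class_rep)?; simp add: class_ops A.m_assoc)
  then have "ring (quot_algebra A I)"
    by (rule ringI[OF Q.M.abelian_group_axioms]; elim class_rep; simp add: class_ops A.l_distr A.r_distr)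
  moreover have "(k \<odot>\<^bsub>quot_algebra A I\<^esub> x) \<otimes>\<^bsub>quot_algebra A I\<^esub> y = k \<odot>\<^bsub>quot_algebra A I\<^esub> (x \<otimes>\<^bsub>quot_algebra A I\<^esub> y)"
    "x \<otimes>\<^bsub>quot_algebra A I\<^esub> (k \<odot>\<^bsub>quot_algebra A I\<^esub> y) = k \<odot>\<^bsub>quot_algebra A I\<^esub> (x \<otimes>\<^bsub>quot_algebra A I\<^esub> y)"
    if k: "k \<in> carrier K" and xy: "x \<in> carrier (quot_algebra A I)" "y \<in> carrier (quot_algebra A I)" for k x y
  proof -
    obtain a where a: "a \<in> carrier A" "x = cl a" using class_rep[OF xy(1)] .
    obtain b where b: "b \<in> carrier A" "y = cl b" using class_rep[OF xy(2)] .
    from a b show "(k \<odot>\<^bsub>quot_algebra A I\<^esub> x) \<otimes>\<^bsub>quot_algebra A I\<^esub> y = k \<odot>\<^bsub>quot_algebra A I\<^esub> (x \<otimes>\<^bsub>quot_algebra A I\<^esub> y)"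
    "x \<otimes>\<^bsub>quot_algebra A I\<^esub> (k \<odot>\<^bsub>quot_algebra A I\<^esub> y) = k \<odot>\<^bsub>quot_algebra A I\<^esub> (x \<otimes>\<^bsub>quot_algebra A I\<^esub> y)"
      using k by (simp_all add: class_ops A.smult_mult_left A.smult_mult_right)
  qed
  ultimately show ?thesis
    by (simp add: assoc_algebra_def assoc_algebra_axioms_def quot_algebra_module)
qed

lemma class_hom: "cl \<in> mod_hom K A (quot_algebra A I)"
  by (rule mod_homI) (auto simp: class_ops)

end

locale quotient_bimodule = quotient_algebra K A I
  for K :: "('k, 'r) ring_scheme" and A :: "('k, 'a) module" and I +
  fixes M :: "('k, 'a, 'm, 'y) bimod_scheme" and N
  assumes bimodule: "bimodule K A M" and subbimodule: "subbimodule A N M"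
    and ideal_acts_into: "\<And>i x. i \<in> I \<Longrightarrow> x \<in> carrier M \<Longrightarrow> lact M i x \<in> N"
      "\<And>i x. i \<in> I \<Longrightarrow> x \<in> carrier M \<Longrightarrow> ract M x i \<in> N"
begin

abbreviation mcl where "mcl x \<equiv> N +>\<^bsub>M\<^esub> x"

sublocale B: bimodule K A M by (rule bimodule)
lemmas M_module = bimoduleD(2)[OF bimodule]
lemmas M_ag = module.axioms(2)[OF M_module]

lemma sub: "submodule N K M"
  by (rule subbimodule_submodule[OF bimodule subbimodule])

lemmas subgr = subbimoduleD(1)[OF subbimodule]

lemma mclass_eq_iff: "x \<in> carrier M \<Longrightarrow> y \<in> carrier M \<Longrightarrow> mcl x = mcl y \<longleftrightarrow> x \<ominus>\<^bsub>M\<^esub> y \<in> N"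
  by (rule coset_eq_iff[OF M_ag subgr])

lemma quot_bimod_simps:
  "carrier (quot_bimod M N) = mcl ` carrier M" "zero (quot_bimod M N) = N"
  "add (quot_bimod M N) = add (quot_mod M N)" "smult (quot_bimod M N) = smult (quot_mod M N)"
  by (auto simp: quot_bimod_def module.defs quot_mod_simps)

lemma mclass_ops:
  "x \<in> carrier M \<Longrightarrow> mcl x \<in> carrier (quot_bimod M N)"
  "x \<in> carrier M \<Longrightarrow> y \<in> carrier M \<Longrightarrow> mcl x \<oplus>\<^bsub>quot_bimod M N\<^esub> mcl y = mcl (x \<oplus>\<^bsub>M\<^esub> y)"
  "k \<in> carrier K \<Longrightarrow> x \<in> carrier M \<Longrightarrow> k \<odot>\<^bsub>quot_bimod M N\<^esub> mcl x = mcl (k \<odot>\<^bsub>M\<^esub> x)"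
  "\<zero>\<^bsub>quot_bimod M N\<^esub> = N"
  by (auto simp: quot_bimod_simps quot_mod_add[OF M_ag subgr]
      quot_mod_smult[OF M_module sub])

text \<open>
  The action of a class of \<open>A / I\<close> on a class of \<open>M / N\<close> is a double union over representatives.
  Changing the representative in \<open>M\<close> is harmless as \<open>N\<close> is a subbimodule, changing the one in \<open>A\<close> is
  harmless as \<open>I\<close> acts from \<open>M\<close> into \<open>N\<close>.
\<close>

lemma mclass_lact:
  assumes a: "a \<in> carrier A" and x: "x \<in> carrier M"
  shows "lact (quot_bimod M N) (cl a) (mcl x) = mcl (lact M a x)"
proof -
  have inner: "(\<Union>y\<in>mcl x. mcl (lact M b y)) = mcl (lact M b x)" if b: "b \<in> carrier A" for b
  proof (rule UN_coset_eq[OF M_ag subgr x])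
    fix y assume "y \<in> carrier M" "y \<ominus>\<^bsub>M\<^esub> x \<in> N"
    then show "mcl (lact M b y) = mcl (lact M b x)"
      using b x subbimoduleD(2)[OF subbimodule b]
      by (simp add: mclass_eq_iff B.lact_closed flip: bimodule_minus(1)[OF bimodule])
  qed
  have "(\<Union>b\<in>cl a. \<Union>y\<in>mcl x. mcl (lact M b y)) = (\<Union>y\<in>mcl x. mcl (lact M a y))"
  proof (rule UN_coset_eq[OF A.M.abelian_group_axioms ideal_subgroup[OF ideal] a])
    fix b assume "b \<in> carrier A" "b \<ominus>\<^bsub>A\<^esub> a \<in> I"
    then show "(\<Union>y\<in>mcl x. mcl (lact M b y)) = (\<Union>y\<in>mcl x. mcl (lact M a y))"
      using a x ideal_acts_into
      by (simp add: inner mclass_eq_iff B.lact_closed flip: bimodule_minus(3)[OF bimodule])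
  qed
  then show ?thesis
    by (simp add: quot_bimod_def module.defs bimod.defs inner[OF a])
qed

lemma mclass_ract:
  assumes a: "a \<in> carrier A" and x: "x \<in> carrier M"
  shows "ract (quot_bimod M N) (mcl x) (cl a) = mcl (ract M x a)"
proof -
  have inner: "(\<Union>b\<in>cl a. mcl (ract M y b)) = mcl (ract M y a)" if y: "y \<in> carrier M" for y
  proof (rule UN_coset_eq[OF A.M.abelian_group_axioms ideal_subgroup[OF ideal] a])
    fix b assume "b \<in> carrier A" "b \<ominus>\<^bsub>A\<^esub> a \<in> I"
    then show "mcl (ract M y b) = mcl (ract M y a)"
      using a y ideal_acts_into
      by (simp add: mclass_eq_iff B.ract_closed flip: bimodule_minus(4)[OF bimodule])
  qed
  have "(\<Union>y\<in>mcl x. \<Union>b\<in>cl a. mcl (ract M y b)) = (\<Union>b\<in>cl a. mcl (ract M x b))"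
  proof (rule UN_coset_eq[OF M_ag subgr x])
    fix y assume "y \<in> carrier M" "y \<ominus>\<^bsub>M\<^esub> x \<in> N"
    then show "(\<Union>b\<in>cl a. mcl (ract M y b)) = (\<Union>b\<in>cl a. mcl (ract M x b))"
      using a x subbimoduleD(3)[OF subbimodule a]
      by (simp add: inner mclass_eq_iff B.ract_closed flip: bimodule_minus(2)[OF bimodule])
  qed
  then show ?thesis
    by (simp add: quot_bimod_def module.defs bimod.defs inner[OF x])
qed

lemma mclass_rep:
  assumes "c \<in> carrier (quot_bimod M N)"
  obtains x where "x \<in> carrier M" "c = mcl x"
  using assms by (auto simp: quot_bimod_simps)

lemma quot_bimod_bimodule: "bimodule K (quot_algebra A I) (quot_bimod M N)"
proof -
  have m: "module K (quot_bimod M N)"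
    by (rule module_cong[OF quot_mod_module[OF M_module sub]])
      (auto simp: quot_bimod_simps quot_mod_simps)
  note simps = class_ops mclass_ops mclass_lact mclass_ract B.lact_closed B.ract_closed
    B.lact_add B.ract_add B.add_lact B.add_ract B.lact_mult
    B.ract_mult B.lact_one B.ract_one B.lact_ract B.smult_lact B.smult_ract
  have "bimodule_axioms K (quot_algebra A I) (quot_bimod M N)"
    by (unfold_locales; elim class_rep mclass_rep; simp add: simps)
  then show ?thesis
    using m quot_algebra_assoc_algebra by (simp add: bimodule_def)
qed

end

section \<open>The bimodule structure on the tensor product\<close>

lemma tensor_bimod_simps [simp]:
  "carrier (tensor_bimod K A V) = carrier (tensor K A V A)" "zero (tensor_bimod K A V) = zero (tensor K A V A)"
  "add (tensor_bimod K A V) = add (tensor K A V A)" "smult (tensor_bimod K A V) = smult (tensor K A V A)"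
  by (simp_all add: tensor_bimod_def module.defs)

lemma tensor_bimod_acts:
  "lact (tensor_bimod K A V) a = tensor_lift K (tensor K A V A) (\<lambda>p v q. pure_tensor K A V A (a \<otimes>\<^bsub>A\<^esub> p) v q)"
  "ract (tensor_bimod K A V) t b = tensor_lift K (tensor K A V A) (\<lambda>p v q. pure_tensor K A V A p v (q \<otimes>\<^bsub>A\<^esub> b)) t"
  by (simp_all add: tensor_bimod_def module.defs bimod.defs)

locale algebra_tensor =
  fixes K :: "('k, 'r) ring_scheme" and A :: "('k, 'a) module" and V :: "('k, 'v) module"
  assumes algebra: "assoc_algebra K A" and module_V: "module K V"
begin

sublocale three_modules K A V A
  by (intro three_modules.intro assoc_algebraD(1)[OF algebra] module_V)

sublocale A: assoc_algebra K A by (rule algebra)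

abbreviation TB where "TB \<equiv> tensor_bimod K A V"

lemma left_trilinear:
  assumes "a \<in> carrier A"
  shows "trilinear K A V A Tn (\<lambda>p v q. pt (a \<otimes>\<^bsub>A\<^esub> p) v q)"
  using assms pure_tensor_homs mod_hom_comp[OF mult_left_hom[OF algebra assms] pure_tensor_homs(1)]
  by (simp add: trilinear_def)

lemma right_trilinear:
  assumes "a \<in> carrier A"
  shows "trilinear K A V A Tn (\<lambda>p v q. pt p v (q \<otimes>\<^bsub>A\<^esub> a))"
  using assms pure_tensor_homs mod_hom_comp[OF mult_right_hom[OF algebra assms] pure_tensor_homs(3)]
  by (simp add: trilinear_def)

lemma tensor_lact_hom: "a \<in> carrier A \<Longrightarrow> lact TB a \<in> mod_hom K Tn Tn"
  unfolding tensor_bimod_acts by (rule tensor_lift_hom[OF tensor_module left_trilinear])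

lemma tensor_ract_hom: "a \<in> carrier A \<Longrightarrow> (\<lambda>t. ract TB t a) \<in> mod_hom K Tn Tn"
  unfolding tensor_bimod_acts using tensor_lift_hom[OF tensor_module right_trilinear] by simp

lemma tensor_lact_pure:
  "a \<in> carrier A \<Longrightarrow> p \<in> carrier A \<Longrightarrow> v \<in> carrier V \<Longrightarrow> q \<in> carrier A \<Longrightarrow>
    lact TB a (pt p v q) = pt (a \<otimes>\<^bsub>A\<^esub> p) v q"
  unfolding tensor_bimod_acts by (rule tensor_lift_pure[OF tensor_module left_trilinear])

lemma tensor_ract_pure:
  "a \<in> carrier A \<Longrightarrow> p \<in> carrier A \<Longrightarrow> v \<in> carrier V \<Longrightarrow> q \<in> carrier A \<Longrightarrow>
    ract TB (pt p v q) a = pt p v (q \<otimes>\<^bsub>A\<^esub> a)"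
  unfolding tensor_bimod_acts by (rule tensor_lift_pure[OF tensor_module right_trilinear])

text \<open>
  Each axiom is an identity between linear maps out of the tensor product, so that it only has to be
  compared on pure tensors, where it is an axiom of the algebra.
\<close>

lemma tensor_bimod_bimodule: "bimodule K A TB"
proof -
  note l = tensor_lact_hom and r = tensor_ract_hom
  note eqI = tensor_hom_eqI[OF tensor_module]
  note pure = tensor_lact_pure tensor_ract_pure pure_tensor_closed
    mod_hom_add[OF pure_tensor_homs(1)] mod_hom_add[OF pure_tensor_homs(3)]
    mod_hom_smult[OF pure_tensor_homs(1)] mod_hom_smult[OF pure_tensor_homs(3)]
    A.l_distr A.r_distr A.m_assoc A.smult_mult_left A.smult_mult_right
  have "bimodule_axioms K A TB"
    unfolding bimodule_axioms_def tensor_bimod_simps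
  proof (intro conjI allI impI)
    fix a x assume a: "a \<in> carrier A" and x: "x \<in> carrier Tn"
    show "lact TB a x \<in> carrier Tn" "ract TB x a \<in> carrier Tn"
      using mod_hom_closed[OF l[OF a] x] mod_hom_closed[OF r[OF a] x] by auto
    fix y assume y: "y \<in> carrier Tn"
    show "lact TB a (x \<oplus>\<^bsub>Tn\<^esub> y) = lact TB a x \<oplus>\<^bsub>Tn\<^esub> lact TB a y"
      "ract TB (x \<oplus>\<^bsub>Tn\<^esub> y) a = ract TB x a \<oplus>\<^bsub>Tn\<^esub> ract TB y a"
      using mod_hom_add[OF l[OF a] x y] mod_hom_add[OF r[OF a] x y] by auto
  next
    fix a b x assume ab: "a \<in> carrier A" "b \<in> carrier A" and x: "x \<in> carrier Tn"
    have ab': "a \<oplus>\<^bsub>A\<^esub> b \<in> carrier A" "a \<otimes>\<^bsub>A\<^esub> b \<in> carrier A" using ab by auto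
    show "lact TB (a \<oplus>\<^bsub>A\<^esub> b) x = lact TB a x \<oplus>\<^bsub>Tn\<^esub> lact TB b x"
      by (rule eqI[OF l[OF ab'(1)] mod_hom_sum[OF tensor_module l[OF ab(1)] l[OF ab(2)]] _ x])
        (use ab in \<open>simp add: pure\<close>)
    show "ract TB x (a \<oplus>\<^bsub>A\<^esub> b) = ract TB x a \<oplus>\<^bsub>Tn\<^esub> ract TB x b"
      by (rule eqI[OF r[OF ab'(1)] mod_hom_sum[OF tensor_module r[OF ab(1)] r[OF ab(2)]] _ x])
        (use ab in \<open>simp add: pure\<close>)
    show "lact TB (a \<otimes>\<^bsub>A\<^esub> b) x = lact TB a (lact TB b x)"
      by (rule eqI[OF l[OF ab'(2)] mod_hom_comp[OF l[OF ab(2)] l[OF ab(1)]] _ x])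
        (use ab in \<open>simp add: pure\<close>)
    show "ract TB x (a \<otimes>\<^bsub>A\<^esub> b) = ract TB (ract TB x a) b"
      by (rule eqI[OF r[OF ab'(2)] mod_hom_comp[OF r[OF ab(1)] r[OF ab(2)]] _ x])
        (use ab in \<open>simp add: pure\<close>)
    show "ract TB (lact TB a x) b = lact TB a (ract TB x b)"
      by (rule eqI[OF mod_hom_comp[OF l[OF ab(1)] r[OF ab(2)]] mod_hom_comp[OF r[OF ab(2)] l[OF ab(1)]] _ x])
        (use ab in \<open>simp add: pure\<close>)
  next
    fix x assume x: "x \<in> carrier Tn"
    show "lact TB \<one>\<^bsub>A\<^esub> x = x"
      by (rule eqI[OF l mod_hom_id _ x]) (simp_all add: pure)
    show "ract TB x \<one>\<^bsub>A\<^esub> = x"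
      by (rule eqI[OF r mod_hom_id _ x]) (simp_all add: pure)
    fix k assume k: "k \<in> carrier K"
    have k1: "k \<odot>\<^bsub>A\<^esub> \<one>\<^bsub>A\<^esub> \<in> carrier A" using k by simp
    show "lact TB (k \<odot>\<^bsub>A\<^esub> \<one>\<^bsub>A\<^esub>) x = k \<odot>\<^bsub>Tn\<^esub> x"
      by (rule eqI[OF l[OF k1] mod_hom_scale[OF tensor_module mod_hom_id k] _ x])
        (use k in \<open>simp add: pure\<close>)
    show "ract TB x (k \<odot>\<^bsub>A\<^esub> \<one>\<^bsub>A\<^esub>) = k \<odot>\<^bsub>Tn\<^esub> x"
      by (rule eqI[OF r[OF k1] mod_hom_scale[OF tensor_module mod_hom_id k] _ x])
        (use k in \<open>simp add: pure\<close>)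
  qed
  moreover have "module K TB"
    by (rule module_cong[OF tensor_module]) simp_all
  ultimately show ?thesis
    using algebra by (simp add: bimodule_def)
qed

end


section \<open>The free algebra\<close>

lemma free_alg_simps [simp]:
  "carrier (free_alg K X) = carrier (free_mod K (lists X))"
  "zero (free_alg K X) = zero (free_mod K (lists X))" "add (free_alg K X) = add (free_mod K (lists X))"
  "smult (free_alg K X) = smult (free_mod K (lists X))" "one (free_alg K X) = free_basis K []"
  by (simp_all add: free_alg_def)

lemma mod_hom_free_alg:
  "mod_hom K (free_alg K X) M = mod_hom K (free_mod K (lists X)) M"
  "mod_hom K M (free_alg K X) = mod_hom K M (free_mod K (lists X))"
  by (simp_all add: mod_hom_def)

lemma free_alg_mult:
  "(f \<otimes>\<^bsub>free_alg K X\<^esub> g) w = (finsum K (\<lambda>(u, v). f u \<otimes>\<^bsub>K\<^esub> g v) {(u, v). u @ v = w})"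
  by (simp add: free_alg_def)

lemma finite_splits: "finite {(u, v). u @ v = w}"
proof -
  have "{(u, v). u @ v = w} \<subseteq> (\<lambda>n. (take n w, drop n w)) ` {..length w}"
  proof
    fix p assume "p \<in> {(u, v). u @ v = w}"
    then obtain u v where "p = (u, v)" "w = u @ v" by auto
    then show "p \<in> (\<lambda>n. (take n w, drop n w)) ` {..length w}"
      by (intro image_eqI[of _ _ "length u"]) auto
  qed
  then show ?thesis by (rule finite_subset) simp
qed

context
  fixes K :: "('k, 'r) ring_scheme" and X :: "'x set"
  assumes K: "cring K"
begin

interpretation K: cring K by (rule K)

lemma free_alg_module: "module K (free_alg K X)"
  by (rule module_cong[OF free_mod_module[OF K, of "lists X"]]) simp_all

lemma free_alg_coeff: "f \<in> carrier (free_alg K X) \<Longrightarrow> f w \<in> carrier K"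
  by (simp add: free_mod_carrier[OF K])

lemma free_alg_mult_closed:
  assumes "f \<in> carrier (free_alg K X)" "g \<in> carrier (free_alg K X)"
  shows "f \<otimes>\<^bsub>free_alg K X\<^esub> g \<in> carrier (free_alg K X)"
proof -
  let ?s = "\<lambda>f. {w. f w \<noteq> \<zero>\<^bsub>K\<^esub>}"
  have fg: "finite (?s f)" "finite (?s g)" "?s f \<subseteq> lists X" "?s g \<subseteq> lists X"
    using assms by (auto simp: free_mod_carrier[OF K])
  have "?s (f \<otimes>\<^bsub>free_alg K X\<^esub> g) \<subseteq> (\<lambda>(u, v). u @ v) ` (?s f \<times> ?s g)"
  proof
    fix w assume w: "w \<in> ?s (f \<otimes>\<^bsub>free_alg K X\<^esub> g)"
    show "w \<in> (\<lambda>(u, v). u @ v) ` (?s f \<times> ?s g)"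
    proof (rule ccontr)
      assume *: "w \<notin> (\<lambda>(u, v). u @ v) ` (?s f \<times> ?s g)"
      have "(case p of (u, v) \<Rightarrow> f u \<otimes>\<^bsub>K\<^esub> g v) = \<zero>\<^bsub>K\<^esub>" if "p \<in> {(u, v). u @ v = w}" for p
      proof -
        obtain u v where p: "p = (u, v)" by (cases p)
        then have "f u = \<zero>\<^bsub>K\<^esub> \<or> g v = \<zero>\<^bsub>K\<^esub>" using * that by auto
        then show ?thesis
          using free_alg_coeff[OF assms(1), of u] free_alg_coeff[OF assms(2), of v] p by auto
      qed
      then have "(f \<otimes>\<^bsub>free_alg K X\<^esub> g) w = \<zero>\<^bsub>K\<^esub>"
        unfolding free_alg_mult by (rule K.add.finprod_one_eqI)
      then show False using w by simp
    qed
  qed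
  moreover have "finite ((\<lambda>(u, v). u @ v) ` (?s f \<times> ?s g))" using fg by simp
  moreover have "(\<lambda>(u, v). u @ v) ` (?s f \<times> ?s g) \<subseteq> lists X"
    using fg(3,4) by (auto simp: lists_eq_set subset_iff)
  moreover have "(f \<otimes>\<^bsub>free_alg K X\<^esub> g) w \<in> carrier K" for w
    unfolding free_alg_mult using free_alg_coeff assms by (intro K.finsum_closed) auto
  ultimately show ?thesis
    using finite_subset by (simp add: free_mod_carrier[OF K]) blast
qed

lemma free_alg_left_hom:
  assumes "f \<in> carrier (free_alg K X)"
  shows "(\<lambda>g. f \<otimes>\<^bsub>free_alg K X\<^esub> g) \<in> mod_hom K (free_alg K X) (free_alg K X)"
proof (rule mod_homI)
  note c = free_alg_coeff[OF assms] free_alg_coeff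
  fix g assume g: "g \<in> carrier (free_alg K X)"
  show "f \<otimes>\<^bsub>free_alg K X\<^esub> g \<in> carrier (free_alg K X)" by (rule free_alg_mult_closed[OF assms g])
  show "f \<otimes>\<^bsub>free_alg K X\<^esub> (k \<odot>\<^bsub>free_alg K X\<^esub> g) = k \<odot>\<^bsub>free_alg K X\<^esub> (f \<otimes>\<^bsub>free_alg K X\<^esub> g)"
    if k: "k \<in> carrier K" for k
  proof
    fix w
    have "(finsum K (\<lambda>(u, v). f u \<otimes>\<^bsub>K\<^esub> (k \<otimes>\<^bsub>K\<^esub> g v)) {(u, v). u @ v = w}) =
        (\<Oplus>\<^bsub>K\<^esub>p\<in>{(u, v). u @ v = w}. k \<otimes>\<^bsub>K\<^esub> (case p of (u, v) \<Rightarrow> f u \<otimes>\<^bsub>K\<^esub> g v))"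
      using c(1) c(2)[OF g] k by (intro K.finsum_cong') (auto simp: K.m_lcomm)
    also have "\<dots> = k \<otimes>\<^bsub>K\<^esub> (finsum K (\<lambda>(u, v). f u \<otimes>\<^bsub>K\<^esub> g v) {(u, v). u @ v = w})"
      using c(1) c(2)[OF g] k by (intro K.finsum_rdistr[symmetric] finite_splits) auto
    finally show "(f \<otimes>\<^bsub>free_alg K X\<^esub> (k \<odot>\<^bsub>free_alg K X\<^esub> g)) w = (k \<odot>\<^bsub>free_alg K X\<^esub> (f \<otimes>\<^bsub>free_alg K X\<^esub> g)) w"
      by (simp add: free_alg_mult free_mod_simps)
  qed
  fix h assume h: "h \<in> carrier (free_alg K X)"
  show "f \<otimes>\<^bsub>free_alg K X\<^esub> (g \<oplus>\<^bsub>free_alg K X\<^esub> h) = f \<otimes>\<^bsub>free_alg K X\<^esub> g \<oplus>\<^bsub>free_alg K X\<^esub> f \<otimes>\<^bsub>free_alg K X\<^esub> h"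
  proof
    fix w
    have "(finsum K (\<lambda>(u, v). f u \<otimes>\<^bsub>K\<^esub> (g v \<oplus>\<^bsub>K\<^esub> h v)) {(u, v). u @ v = w}) =
        (\<Oplus>\<^bsub>K\<^esub>p\<in>{(u, v). u @ v = w}. (case p of (u, v) \<Rightarrow> f u \<otimes>\<^bsub>K\<^esub> g v) \<oplus>\<^bsub>K\<^esub> (case p of (u, v) \<Rightarrow> f u \<otimes>\<^bsub>K\<^esub> h v))"
      using c(1) c(2)[OF g] c(2)[OF h] by (intro K.finsum_cong') (auto simp: K.r_distr)
    also have "\<dots> = (finsum K (\<lambda>(u, v). f u \<otimes>\<^bsub>K\<^esub> g v) {(u, v). u @ v = w}) \<oplus>\<^bsub>K\<^esub> (finsum K (\<lambda>(u, v). f u \<otimes>\<^bsub>K\<^esub> h v) {(u, v). u @ v = w})"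
      using c(1) c(2)[OF g] c(2)[OF h] by (intro K.finsum_addf) auto
    finally show "(f \<otimes>\<^bsub>free_alg K X\<^esub> (g \<oplus>\<^bsub>free_alg K X\<^esub> h)) w = (f \<otimes>\<^bsub>free_alg K X\<^esub> g \<oplus>\<^bsub>free_alg K X\<^esub> f \<otimes>\<^bsub>free_alg K X\<^esub> h) w"
      by (simp add: free_alg_mult free_mod_simps)
  qed
qed

lemma free_alg_right_hom:
  assumes "f \<in> carrier (free_alg K X)"
  shows "(\<lambda>g. g \<otimes>\<^bsub>free_alg K X\<^esub> f) \<in> mod_hom K (free_alg K X) (free_alg K X)"
proof (rule mod_homI)
  note c = free_alg_coeff[OF assms] free_alg_coeff
  fix g assume g: "g \<in> carrier (free_alg K X)"
  show "g \<otimes>\<^bsub>free_alg K X\<^esub> f \<in> carrier (free_alg K X)" by (rule free_alg_mult_closed[OF g assms])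
  show "(k \<odot>\<^bsub>free_alg K X\<^esub> g) \<otimes>\<^bsub>free_alg K X\<^esub> f = k \<odot>\<^bsub>free_alg K X\<^esub> (g \<otimes>\<^bsub>free_alg K X\<^esub> f)"
    if k: "k \<in> carrier K" for k
  proof
    fix w
    have "(finsum K (\<lambda>(u, v). (k \<otimes>\<^bsub>K\<^esub> g u) \<otimes>\<^bsub>K\<^esub> f v) {(u, v). u @ v = w}) =
        (\<Oplus>\<^bsub>K\<^esub>p\<in>{(u, v). u @ v = w}. k \<otimes>\<^bsub>K\<^esub> (case p of (u, v) \<Rightarrow> g u \<otimes>\<^bsub>K\<^esub> f v))"
      using c(1) c(2)[OF g] k by (intro K.finsum_cong') (auto simp: K.m_assoc)
    also have "\<dots> = k \<otimes>\<^bsub>K\<^esub> (finsum K (\<lambda>(u, v). g u \<otimes>\<^bsub>K\<^esub> f v) {(u, v). u @ v = w})"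
      using c(1) c(2)[OF g] k by (intro K.finsum_rdistr[symmetric] finite_splits) auto
    finally show "((k \<odot>\<^bsub>free_alg K X\<^esub> g) \<otimes>\<^bsub>free_alg K X\<^esub> f) w = (k \<odot>\<^bsub>free_alg K X\<^esub> (g \<otimes>\<^bsub>free_alg K X\<^esub> f)) w"
      by (simp add: free_alg_mult free_mod_simps)
  qed
  fix h assume h: "h \<in> carrier (free_alg K X)"
  show "(g \<oplus>\<^bsub>free_alg K X\<^esub> h) \<otimes>\<^bsub>free_alg K X\<^esub> f = g \<otimes>\<^bsub>free_alg K X\<^esub> f \<oplus>\<^bsub>free_alg K X\<^esub> h \<otimes>\<^bsub>free_alg K X\<^esub> f"
  proof
    fix w
    have "(finsum K (\<lambda>(u, v). (g u \<oplus>\<^bsub>K\<^esub> h u) \<otimes>\<^bsub>K\<^esub> f v) {(u, v). u @ v = w}) =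
        (\<Oplus>\<^bsub>K\<^esub>p\<in>{(u, v). u @ v = w}. (case p of (u, v) \<Rightarrow> g u \<otimes>\<^bsub>K\<^esub> f v) \<oplus>\<^bsub>K\<^esub> (case p of (u, v) \<Rightarrow> h u \<otimes>\<^bsub>K\<^esub> f v))"
      using c(1) c(2)[OF g] c(2)[OF h] by (intro K.finsum_cong') (auto simp: K.l_distr)
    also have "\<dots> = (finsum K (\<lambda>(u, v). g u \<otimes>\<^bsub>K\<^esub> f v) {(u, v). u @ v = w}) \<oplus>\<^bsub>K\<^esub> (finsum K (\<lambda>(u, v). h u \<otimes>\<^bsub>K\<^esub> f v) {(u, v). u @ v = w})"
      using c(1) c(2)[OF g] c(2)[OF h] by (intro K.finsum_addf) auto
    finally show "((g \<oplus>\<^bsub>free_alg K X\<^esub> h) \<otimes>\<^bsub>free_alg K X\<^esub> f) w = (g \<otimes>\<^bsub>free_alg K X\<^esub> f \<oplus>\<^bsub>free_alg K X\<^esub> h \<otimes>\<^bsub>free_alg K X\<^esub> f) w"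
      by (simp add: free_alg_mult free_mod_simps)
  qed
qed

text \<open>
  The coefficient of the product at \<open>w\<close> sums over all splittings of \<open>w\<close>, of which only \<open>(u, v)\<close> can
  contribute.
\<close>

lemma free_alg_basis_mult:
  "free_basis K u \<otimes>\<^bsub>free_alg K X\<^esub> free_basis K v = free_basis K (u @ v)"
proof
  fix w
  have "(finsum K (\<lambda>(u', v'). free_basis K u u' \<otimes>\<^bsub>K\<^esub> free_basis K v v') {(u, v). u @ v = w}) =
      (\<Oplus>\<^bsub>K\<^esub>p\<in>{(u, v). u @ v = w}. if (u, v) = p then \<one>\<^bsub>K\<^esub> else \<zero>\<^bsub>K\<^esub>)"
    by (intro K.finsum_cong') (auto simp: free_basis_def split: if_split_asm)
  also have "\<dots> = free_basis K (u @ v) w"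
  proof (cases "u @ v = w")
    case True
    then show ?thesis
      using K.add.finprod_singleton[of "(u, v)" "{(u, v). u @ v = w}" "\<lambda>_. \<one>\<^bsub>K\<^esub>"] finite_splits[of w]
      by (simp add: free_basis_def)
  next
    case False
    then have "(\<Oplus>\<^bsub>K\<^esub>p\<in>{(u, v). u @ v = w}. if (u, v) = p then \<one>\<^bsub>K\<^esub> else \<zero>\<^bsub>K\<^esub>) = \<zero>\<^bsub>K\<^esub>"
      by (intro K.add.finprod_one_eqI) auto
    then show ?thesis using False by (simp add: free_basis_def)
  qed
  finally show "(free_basis K u \<otimes>\<^bsub>free_alg K X\<^esub> free_basis K v) w = free_basis K (u @ v) w"
    by (simp add: free_alg_mult)
qed

lemma free_alg_basis_closed: "w \<in> lists X \<Longrightarrow> free_basis K w \<in> carrier (free_alg K X)"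
  using free_basis_closed[OF K] by simp

lemma free_alg_hom_eqI:
  assumes "module K M" "f \<in> mod_hom K (free_alg K X) M" "g \<in> mod_hom K (free_alg K X) M"
    and "\<And>w. w \<in> lists X \<Longrightarrow> f (free_basis K w) = g (free_basis K w)" "c \<in> carrier (free_alg K X)"
  shows "f c = g c"
  using mod_hom_free_eqI[of K M f "lists X" g c] assms by (simp add: mod_hom_free_alg)

text \<open>
  As the product is bilinear, associativity reduces one variable at a time to words, where it is
  associativity of concatenation.
\<close>

lemma free_alg_assoc_algebra: "assoc_algebra K (free_alg K X)"
proof -
  let ?F = "free_alg K X"
  interpret F: module K ?F by (rule free_alg_module)
  note eqI = free_alg_hom_eqI[OF free_alg_module]
  note l = free_alg_left_hom and r = free_alg_right_hom
  note cl = free_alg_mult_closed and b = free_alg_basis_closed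
  \<comment> \<open>The three steps free the right, the middle and the left variable.\<close>
  have assoc3: "(free_basis K u \<otimes>\<^bsub>?F\<^esub> free_basis K v) \<otimes>\<^bsub>?F\<^esub> h = free_basis K u \<otimes>\<^bsub>?F\<^esub> (free_basis K v \<otimes>\<^bsub>?F\<^esub> h)"
    if "u \<in> lists X" "v \<in> lists X" "h \<in> carrier ?F" for u v h
    by (rule eqI[OF l[OF cl[OF b[OF that(1)] b[OF that(2)]]]
          mod_hom_comp[OF l[OF b[OF that(2)]] l[OF b[OF that(1)]]] _ that(3)])
      (simp add: free_alg_basis_mult)
  have assoc2: "(free_basis K u \<otimes>\<^bsub>?F\<^esub> g) \<otimes>\<^bsub>?F\<^esub> h = free_basis K u \<otimes>\<^bsub>?F\<^esub> (g \<otimes>\<^bsub>?F\<^esub> h)"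
    if "u \<in> lists X" "g \<in> carrier ?F" "h \<in> carrier ?F" for u g h
    by (rule eqI[OF mod_hom_comp[OF l[OF b[OF that(1)]] r[OF that(3)]]
          mod_hom_comp[OF r[OF that(3)] l[OF b[OF that(1)]]] _ that(2)])
      (use that in \<open>simp add: assoc3\<close>)
  have assoc: "(f \<otimes>\<^bsub>?F\<^esub> g) \<otimes>\<^bsub>?F\<^esub> h = f \<otimes>\<^bsub>?F\<^esub> (g \<otimes>\<^bsub>?F\<^esub> h)"
    if "f \<in> carrier ?F" "g \<in> carrier ?F" "h \<in> carrier ?F" for f g h
    by (rule eqI[OF mod_hom_comp[OF r[OF that(2)] r[OF that(3)]] r[OF cl[OF that(2,3)]] _ that(1)])
      (use that in \<open>simp add: assoc2\<close>)
  have e: "free_basis K [] \<in> carrier ?F" by (rule b) simp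
  have one: "free_basis K [] \<otimes>\<^bsub>?F\<^esub> f = f" "f \<otimes>\<^bsub>?F\<^esub> free_basis K [] = f" if "f \<in> carrier ?F" for f
    by (rule eqI[OF l[OF e] mod_hom_id _ that], simp add: free_alg_basis_mult)
      (rule eqI[OF r[OF e] mod_hom_id _ that], simp add: free_alg_basis_mult)
  have "Group.monoid ?F"
    by (rule monoidI) (use cl assoc one e in \<open>simp_all del: free_alg_simps(1)\<close>)
  then have "ring ?F"
    using mod_hom_add[OF l] mod_hom_add[OF r]
    by (intro ringI F.M.abelian_group_axioms) (simp_all del: free_alg_simps)
  then show ?thesis
    using mod_hom_smult[OF l] mod_hom_smult[OF r] free_alg_module
    by (simp add: assoc_algebra_def assoc_algebra_axioms_def del: free_alg_simps)
qed

end

section \<open>Exactness from the Peiffer identity and a one-sided section\<close>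

text \<open>
  The data on which exactness rests, with \<open>\<psi>\<close> in the role of the base change from \<open>F\<close> to \<open>F / J\<close>.  The
  condition on its kernel says that the kernel lies in \<open>J T + T J\<close>, phrased through the submodules
  that contain \<open>J T\<close> and \<open>T J\<close>.  The map \<open>\<sigma>\<close> is a section of \<open>\<alpha>\<close> that respects the right
  action on \<open>J\<close>; outside \<open>J\<close> it is merely \<open>K\<close>-linear.
\<close>

locale peiffer_bimodule =
  fixes K :: "('k, 'r) ring_scheme" and F :: "('k, 'f) module" and J :: "'f set"
    and T :: "('k, 'f, 't) bimod" and \<alpha> :: "'t \<Rightarrow> 'f" and D :: "'t set"
    and B :: "('k, 'f set, 'b) bimod" and \<psi> :: "'t \<Rightarrow> 'b" and \<sigma> :: "'f \<Rightarrow> 't"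
  assumes algebra: "assoc_algebra K F" and ideal: "ideal J F"
    and bimodule_T: "bimodule K F T" and bimodule_B: "bimodule K (quot_algebra F J) B"
    and \<alpha>_hom: "\<alpha> \<in> bimod_hom K F T (regular_bimod F)" and \<alpha>_image: "\<alpha> ` carrier T = J"
    and D_sub: "subbimodule F D (restrict_bimod T {t \<in> carrier T. \<alpha> t = \<zero>\<^bsub>F\<^esub>})"
    and peiffer: "\<And>t u. t \<in> carrier T \<Longrightarrow> u \<in> carrier T \<Longrightarrow>
      ract T t (\<alpha> u) \<ominus>\<^bsub>T\<^esub> lact T (\<alpha> t) u \<in> D"
    and \<psi>_hom: "\<psi> \<in> mod_hom K T B" and \<psi>_image: "\<psi> ` carrier T = carrier B"
    and \<psi>_lact: "\<And>a t. a \<in> carrier F \<Longrightarrow> t \<in> carrier T \<Longrightarrow>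
      \<psi> (lact T a t) = lact B (J +>\<^bsub>F\<^esub> a) (\<psi> t)"
    and \<psi>_ract: "\<And>a t. a \<in> carrier F \<Longrightarrow> t \<in> carrier T \<Longrightarrow>
      \<psi> (ract T t a) = ract B (\<psi> t) (J +>\<^bsub>F\<^esub> a)"
    and \<psi>_D: "\<And>t. t \<in> D \<Longrightarrow> \<psi> t = \<zero>\<^bsub>B\<^esub>"
    and \<psi>_kernel: "\<And>N t. submodule N K T \<Longrightarrow>
      (\<And>j u. j \<in> J \<Longrightarrow> u \<in> carrier T \<Longrightarrow> lact T j u \<in> N) \<Longrightarrow>
      (\<And>j u. j \<in> J \<Longrightarrow> u \<in> carrier T \<Longrightarrow> ract T u j \<in> N) \<Longrightarrow>
      t \<in> carrier T \<Longrightarrow> \<psi> t = \<zero>\<^bsub>B\<^esub> \<Longrightarrow> t \<in> N"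
    and \<sigma>_hom: "\<sigma> \<in> mod_hom K F T"
    and \<sigma>_section: "\<And>j. j \<in> J \<Longrightarrow> \<alpha> (\<sigma> j) = j"
    and \<sigma>_ract: "\<And>j a. j \<in> J \<Longrightarrow> a \<in> carrier F \<Longrightarrow> \<sigma> (j \<otimes>\<^bsub>F\<^esub> a) = ract T (\<sigma> j) a"
begin

abbreviation H where "H \<equiv> {t \<in> carrier T. \<alpha> t = \<zero>\<^bsub>F\<^esub>}"
abbreviation JJ where "JJ \<equiv> ideal_prod F J J"

sublocale F: assoc_algebra K F by (rule algebra)
sublocale J: ideal J F by (rule ideal)

lemmas T_module = bimoduleD(2)[OF bimodule_T]
lemmas B_module = bimoduleD(2)[OF bimodule_B]
lemmas F_module = assoc_algebraD(1)[OF algebra]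
lemmas T_ag = module.axioms(2)[OF T_module]
interpretation T: module K T by (rule T_module)
interpretation B: module K B by (rule B_module)
interpretation TB: bimodule K F T by (rule bimodule_T)
interpretation BB: bimodule K "quot_algebra F J" B by (rule bimodule_B)

lemma \<alpha>_linear: "\<alpha> \<in> mod_hom K T F"
  using bimod_homD(1)[OF \<alpha>_hom] by (simp add: mod_hom_def)

lemma \<alpha>_lact: "a \<in> carrier F \<Longrightarrow> t \<in> carrier T \<Longrightarrow> \<alpha> (lact T a t) = a \<otimes>\<^bsub>F\<^esub> \<alpha> t"
  and \<alpha>_ract: "a \<in> carrier F \<Longrightarrow> t \<in> carrier T \<Longrightarrow> \<alpha> (ract T t a) = \<alpha> t \<otimes>\<^bsub>F\<^esub> a"
  using bimod_homD(2,3)[OF \<alpha>_hom] by simp_all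

lemma \<alpha>_in_J: "t \<in> carrier T \<Longrightarrow> \<alpha> t \<in> J"
  using \<alpha>_image by blast

lemma \<alpha>_closed: "t \<in> carrier T \<Longrightarrow> \<alpha> t \<in> carrier F"
  by (rule mod_hom_closed[OF \<alpha>_linear])

lemma J_rep:
  assumes "j \<in> J" obtains t where "t \<in> carrier T" "\<alpha> t = j"
  using assms \<alpha>_image by blast

lemma H_sub: "subbimodule F H T"
proof -
  have "subgroup H (add_monoid T)"
    by (rule submodule.axioms(1)[OF mod_hom_kernel_submodule[OF T_module F_module \<alpha>_linear]])
  then show ?thesis
    by (auto simp: subbimodule_def \<alpha>_lact \<alpha>_ract TB.lact_closed TB.ract_closed)
qed

lemma D_sub_T: "subbimodule F D T" and D_H: "D \<subseteq> H"
  using D_sub restrict_bimod_subgroup_iff[OF T_ag subbimoduleD(1)[OF H_sub], of D]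
  by (auto simp: subbimodule_def)

text \<open>
  For \<open>\<alpha>(h) = 0\<close> one of the two terms of the Peiffer identity vanishes.
\<close>

lemma ideal_acts_H_into_D:
  assumes "j \<in> J" "h \<in> H"
  shows "lact T j h \<in> D" "ract T h j \<in> D"
proof -
  note D = add_subgroupD[OF subbimoduleD(1)[OF D_sub_T]]
  obtain t where t: "t \<in> carrier T" "\<alpha> t = j" using J_rep[OF assms(1)] .
  have h: "h \<in> carrier T" "\<alpha> h = \<zero>\<^bsub>F\<^esub>" using assms(2) by auto
  have z: "lact T \<zero>\<^bsub>F\<^esub> t = \<zero>\<^bsub>T\<^esub>" "ract T t \<zero>\<^bsub>F\<^esub> = \<zero>\<^bsub>T\<^esub>"
    using mod_hom_zero[OF F_module T_module act_hom(1)[OF bimodule_T t(1)]]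
      mod_hom_zero[OF F_module T_module act_hom(2)[OF bimodule_T t(1)]] by auto
  have c: "lact T j h \<in> carrier T" "ract T h j \<in> carrier T"
    using h t \<alpha>_closed TB.lact_closed TB.ract_closed by auto
  have "ract T t (\<alpha> h) \<ominus>\<^bsub>T\<^esub> lact T (\<alpha> t) h \<in> D" "ract T h (\<alpha> t) \<ominus>\<^bsub>T\<^esub> lact T (\<alpha> h) t \<in> D"
    using peiffer t(1) h(1) by blast+
  then have "\<zero>\<^bsub>T\<^esub> \<ominus>\<^bsub>T\<^esub> lact T j h \<in> D" "ract T h j \<ominus>\<^bsub>T\<^esub> \<zero>\<^bsub>T\<^esub> \<in> D"
    using t h z by auto
  moreover have "\<ominus>\<^bsub>T\<^esub> (\<zero>\<^bsub>T\<^esub> \<ominus>\<^bsub>T\<^esub> lact T j h) = lact T j h" "ract T h j \<ominus>\<^bsub>T\<^esub> \<zero>\<^bsub>T\<^esub> = ract T h j"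
    using c T.M.minus_add_cancel(1)[OF c(2) T.M.zero_closed] by (simp_all add: a_minus_def)
  ultimately show "lact T j h \<in> D" "ract T h j \<in> D"
    using D(4) by metis+
qed

text \<open>
  The heart of the matter, \<open>H \<inter> (J T + T J) \<subseteq> D\<close>.  The endomorphism \<open>\<rho> = 1 - \<sigma>\<alpha>\<close> is a projection of \<open>T\<close>
  onto \<open>H\<close> that is linear for the right action.  It therefore carries \<open>T J\<close> into \<open>H J \<subseteq> D\<close>; by the
  Peiffer identity \<open>J T\<close> lies in \<open>T J + D\<close>, so that \<open>\<rho>\<close> carries it into \<open>D\<close> as well.  An element of
  \<open>H\<close> is fixed by \<open>\<rho>\<close>.
\<close>

lemma kernel_of_base_change_in_D:
  assumes h: "h \<in> H" and "\<psi> h = \<zero>\<^bsub>B\<^esub>"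
  shows "h \<in> D"
proof -
  define \<rho> where "\<rho> t = t \<ominus>\<^bsub>T\<^esub> \<sigma> (\<alpha> t)" for t
  have \<rho>: "\<rho> \<in> mod_hom K T T"
    unfolding \<rho>_def by (rule mod_hom_diff[OF T_module T_module mod_hom_id mod_hom_comp[OF \<alpha>_linear \<sigma>_hom]])
  have \<rho>_H: "\<rho> t \<in> H" if t: "t \<in> carrier T" for t
  proof -
    have s: "\<sigma> (\<alpha> t) \<in> carrier T" by (rule mod_hom_closed[OF \<sigma>_hom \<alpha>_closed[OF t]])
    have "\<alpha> (\<rho> t) = \<alpha> t \<ominus>\<^bsub>F\<^esub> \<alpha> t"
      unfolding \<rho>_def using mod_hom_minus[OF T_module F_module \<alpha>_linear t s] \<sigma>_section[OF \<alpha>_in_J[OF t]] by simp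
    then show ?thesis
      using mod_hom_closed[OF \<rho> t] \<alpha>_closed[OF t] F.M.minus_eq_zero_iff by simp
  qed
  have \<rho>_id: "\<rho> t = t" if t: "t \<in> H" for t
    using t mod_hom_zero[OF F_module T_module \<sigma>_hom] T.M.minus_add_cancel(1)[of t "\<zero>\<^bsub>T\<^esub>"]
    unfolding \<rho>_def by simp
  \<comment> \<open>It remains to see that this submodule contains \<open>J T\<close> and \<open>T J\<close>.\<close>
  define N where "N = {t \<in> carrier T. \<rho> t \<in> D}"
  have N: "submodule N K T"
    unfolding N_def
    by (rule mod_hom_vimage_submodule[OF T_module T_module \<rho> subbimodule_submodule[OF bimodule_T D_sub_T]])
  have TJ: "ract T u j \<in> N" if j: "j \<in> J" and u: "u \<in> carrier T" for j u
  proof -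
    have jF: "j \<in> carrier F" using j J.Icarr by blast
    have s: "\<sigma> (\<alpha> u) \<in> carrier T" by (rule mod_hom_closed[OF \<sigma>_hom \<alpha>_closed[OF u]])
    have "\<rho> (ract T u j) = ract T (\<rho> u) j"
      unfolding \<rho>_def \<alpha>_ract[OF jF u] \<sigma>_ract[OF \<alpha>_in_J[OF u] jF]
      by (rule bimodule_minus(2)[OF bimodule_T jF u s, symmetric])
    also have "\<dots> \<in> D" by (rule ideal_acts_H_into_D(2)[OF j \<rho>_H[OF u]])
    finally show ?thesis using TB.ract_closed[OF jF u] by (simp add: N_def)
  qed
  have JT: "lact T j u \<in> N" if j: "j \<in> J" and u: "u \<in> carrier T" for j u
  proof -
    obtain t where t: "t \<in> carrier T" "\<alpha> t = j" using J_rep[OF j] .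
    let ?x = "lact T j u" and ?y = "ract T t (\<alpha> u)"
    have c: "?x \<in> carrier T" "?y \<in> carrier T"
      using TB.lact_closed[OF J.Icarr[OF j] u] TB.ract_closed[OF \<alpha>_closed[OF u] t(1)] by auto
    have d: "?y \<ominus>\<^bsub>T\<^esub> ?x \<in> D" using peiffer[OF t(1) u] t(2) by simp
    then have "?y \<ominus>\<^bsub>T\<^esub> ?x \<in> N"
      using D_H \<rho>_id[of "?y \<ominus>\<^bsub>T\<^esub> ?x"] by (auto simp: N_def)
    moreover have "?y \<in> N" by (rule TJ[OF \<alpha>_in_J[OF u] t(1)])
    ultimately have "?y \<ominus>\<^bsub>T\<^esub> (?y \<ominus>\<^bsub>T\<^esub> ?x) \<in> N"
      using add_subgroupD(5)[OF submodule.axioms(1)[OF N]] by blast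
    then show ?thesis
      using T.M.minus_add_cancel(3)[OF c(2,1)] by simp
  qed
  have "h \<in> N"
    using \<psi>_kernel[OF N JT TJ] assms by blast
  then show "h \<in> D"
    using \<rho>_id[OF h] by (simp add: N_def)
qed

lemma JJ_ideal: "ideal JJ F"
  by (rule F.ideal_prod_is_ideal[OF ideal ideal])

lemma JJ_J: "JJ \<subseteq> J"
  using F.ideal_prod_inter[OF ideal ideal] by simp

text \<open>
  Since \<open>\<alpha>(J T)\<close> and \<open>\<alpha>(T J)\<close> lie in \<open>J\<^sup>2\<close>, the composite of \<open>\<alpha>\<close> with the projection to \<open>J / J\<^sup>2\<close> factors
  through \<open>\<psi>\<close>.
\<close>

lemma \<alpha>_kernel_\<psi>:
  assumes "t \<in> carrier T" "\<psi> t = \<zero>\<^bsub>B\<^esub>"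
  shows "\<alpha> t \<in> JJ"
proof -
  have "t \<in> {t \<in> carrier T. \<alpha> t \<in> JJ}"
  proof (rule \<psi>_kernel[OF mod_hom_vimage_submodule[OF T_module F_module \<alpha>_linear ideal_submodule[OF algebra JJ_ideal]] _ _ assms])
    fix j u assume j: "j \<in> J" and u: "u \<in> carrier T"
    have jF: "j \<in> carrier F" using j J.Icarr by blast
    show "lact T j u \<in> {t \<in> carrier T. \<alpha> t \<in> JJ}"
      using ideal_prod.prod[OF j \<alpha>_in_J[OF u], of F] TB.lact_closed[OF jF u] by (simp add: \<alpha>_lact[OF jF u])
    show "ract T u j \<in> {t \<in> carrier T. \<alpha> t \<in> JJ}"
      using ideal_prod.prod[OF \<alpha>_in_J[OF u] j, of F] TB.ract_closed[OF jF u] by (simp add: \<alpha>_ract[OF jF u])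
  qed
  then show ?thesis by simp
qed

text \<open>Every product \<open>jj'\<close> is \<open>\<alpha>(tj')\<close> with \<open>\<alpha>(t) = j\<close>, and \<open>tj'\<close> lies in the kernel of \<open>\<psi>\<close>.\<close>

lemma JJ_lift:
  assumes "z \<in> JJ"
  obtains t where "t \<in> carrier T" "\<alpha> t = z" "\<psi> t = \<zero>\<^bsub>B\<^esub>"
proof -
  from assms have "\<exists>t\<in>carrier T. \<alpha> t = z \<and> \<psi> t = \<zero>\<^bsub>B\<^esub>"
  proof (induction rule: ideal_prod.induct)
    case (prod i j)
    obtain t where t: "t \<in> carrier T" "\<alpha> t = i" using J_rep[OF prod(1)] .
    have jF: "j \<in> carrier F" using prod(2) J.Icarr by blast
    have "J +>\<^bsub>F\<^esub> j = \<zero>\<^bsub>quot_algebra F J\<^esub>"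
      using coset_eq_subgroup_iff[OF F.M.abelian_group_axioms ideal_subgroup[OF ideal] jF] prod(2)
      by (simp add: quot_algebra_simps)
    moreover have "ract B (\<psi> t) \<zero>\<^bsub>quot_algebra F J\<^esub> = \<zero>\<^bsub>B\<^esub>"
      by (rule mod_hom_zero[OF _ B_module act_hom(2)[OF bimodule_B mod_hom_closed[OF \<psi>_hom t(1)]]])
        (rule assoc_algebraD(1)[OF bimoduleD(1)[OF bimodule_B]])
    ultimately have "\<psi> (ract T t j) = \<zero>\<^bsub>B\<^esub>" by (simp add: \<psi>_ract[OF jF t(1)])
    moreover have "\<alpha> (ract T t j) = i \<otimes>\<^bsub>F\<^esub> j" using \<alpha>_ract[OF jF t(1)] t(2) by simp
    ultimately show ?case using TB.ract_closed[OF jF t(1)] by blast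
  next
    case (sum y z)
    then obtain t u where "t \<in> carrier T" "\<alpha> t = y" "\<psi> t = \<zero>\<^bsub>B\<^esub>" "u \<in> carrier T" "\<alpha> u = z" "\<psi> u = \<zero>\<^bsub>B\<^esub>"
      by auto
    then show ?case
      using mod_hom_add[OF \<alpha>_linear, of t u] mod_hom_add[OF \<psi>_hom, of t u]
      by (intro bexI[of _ "t \<oplus>\<^bsub>T\<^esub> u"]) auto
  qed
  then show thesis using that by blast
qed

sublocale P: quotient_bimodule K F J "restrict_bimod T H" D
proof (intro quotient_bimodule.intro quotient_algebra.intro quotient_bimodule_axioms.intro)
  show "bimodule K F (restrict_bimod T H)" by (rule restrict_bimod_bimodule[OF bimodule_T H_sub])
  show "subbimodule F D (restrict_bimod T H)" by (rule D_sub)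
qed (use ideal_acts_H_into_D in \<open>auto intro: algebra ideal\<close>)

sublocale Q: quotient_bimodule K F J "restrict_bimod (regular_bimod F) J" JJ
proof (intro quotient_bimodule.intro quotient_algebra.intro quotient_bimodule_axioms.intro)
  note reg = regular_bimod_bimodule[OF algebra] ideal_subbimodule[OF ideal] ideal_subbimodule[OF JJ_ideal]
  show "bimodule K F (restrict_bimod (regular_bimod F) J)" by (rule restrict_bimod_bimodule[OF reg(1,2)])
  show "subbimodule F JJ (restrict_bimod (regular_bimod F) J)"
    using restrict_bimod_subgroup_iff[OF module.axioms(2)[OF bimoduleD(2)[OF reg(1)]] subbimoduleD(1)[OF reg(2)], of JJ]
      reg(3) JJ_J by (simp add: subbimodule_def)
qed (auto intro: algebra ideal ideal_prod.prod)

abbreviation quotP where "quotP \<equiv> quot_bimod (restrict_bimod T H) D"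
abbreviation quotQ where "quotQ \<equiv> quot_bimod (restrict_bimod (regular_bimod F) J) JJ"

text \<open>
  As \<open>\<psi>\<close> vanishes on \<open>D\<close>, its image of a class in \<open>H / D\<close> is a singleton.
\<close>

definition inclusion :: "'t set \<Rightarrow> 'b"
  where "inclusion c = the_elem (\<psi> ` c)"

definition projection :: "'b \<Rightarrow> 'f set"
  where "projection b = JJ +>\<^bsub>F\<^esub> \<alpha> (SOME t. t \<in> carrier T \<and> \<psi> t = b)"

lemma regular_coset: "a_r_coset (regular_bimod F) = a_r_coset F"
  by (auto simp: a_r_coset_def' fun_eq_iff)

lemma inclusion_coset:
  assumes "h \<in> H"
  shows "inclusion (D +>\<^bsub>T\<^esub> h) = \<psi> h"
proof -
  note Dg = subbimoduleD(1)[OF D_sub_T]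
  have h: "h \<in> carrier T" using assms by simp
  have "\<psi> x = \<psi> h" if "x \<in> D +>\<^bsub>T\<^esub> h" for x
  proof -
    have x: "x \<in> carrier T" "x \<ominus>\<^bsub>T\<^esub> h \<in> D" using that mem_coset_iff[OF T_ag Dg h] by auto
    then have "\<psi> x \<ominus>\<^bsub>B\<^esub> \<psi> h = \<zero>\<^bsub>B\<^esub>"
      using \<psi>_D[OF x(2)] mod_hom_minus[OF T_module B_module \<psi>_hom x(1) h] by simp
    then show ?thesis
      using B.M.minus_eq_zero_iff[OF mod_hom_closed[OF \<psi>_hom x(1)] mod_hom_closed[OF \<psi>_hom h]] by simp
  qed
  moreover have "h \<in> D +>\<^bsub>T\<^esub> h"
    using mem_coset_iff[OF T_ag Dg h, of h] h add_subgroupD(1)[OF Dg]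
      T.M.minus_eq_zero_iff[OF h h] by simp
  ultimately have "\<psi> ` (D +>\<^bsub>T\<^esub> h) = {\<psi> h}" by blast
  then show ?thesis by (simp add: inclusion_def)
qed

lemma projection_\<psi>:
  assumes "t \<in> carrier T"
  shows "projection (\<psi> t) = JJ +>\<^bsub>F\<^esub> \<alpha> t"
proof -
  let ?u = "SOME u. u \<in> carrier T \<and> \<psi> u = \<psi> t"
  have u: "?u \<in> carrier T \<and> \<psi> ?u = \<psi> t"
    by (rule someI[of _ t]) (simp add: assms)
  then have "\<psi> (?u \<ominus>\<^bsub>T\<^esub> t) = \<zero>\<^bsub>B\<^esub>"
    using mod_hom_minus[OF T_module B_module \<psi>_hom _ assms, of ?u]
      B.M.minus_eq_zero_iff[OF mod_hom_closed[OF \<psi>_hom assms] mod_hom_closed[OF \<psi>_hom assms]] by simp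
  then have "\<alpha> (?u \<ominus>\<^bsub>T\<^esub> t) \<in> JJ"
    using \<alpha>_kernel_\<psi>[of "?u \<ominus>\<^bsub>T\<^esub> t"] u assms by simp
  then have "\<alpha> ?u \<ominus>\<^bsub>F\<^esub> \<alpha> t \<in> JJ"
    using mod_hom_minus[OF T_module F_module \<alpha>_linear _ assms, of ?u] u by simp
  then show ?thesis
    unfolding projection_def
    using coset_eq_iff[OF F.M.abelian_group_axioms ideal_subgroup[OF JJ_ideal] \<alpha>_closed \<alpha>_closed] u assms by simp
qed

lemma B_rep:
  assumes "b \<in> carrier B" obtains t where "t \<in> carrier T" "b = \<psi> t"
  using assms \<psi>_image by blast

lemma P_rep:
  assumes "c \<in> carrier quotP" obtains h where "h \<in> H" "c = D +>\<^bsub>T\<^esub> h"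
  using P.mclass_rep[OF assms] by auto

lemma inclusion_hom: "inclusion \<in> bimod_hom K (quot_algebra F J) quotP B"
  unfolding bimod_hom_def
proof (intro CollectI conjI ballI mod_homI)
  note ops = P.mclass_ops[simplified] P.mclass_lact[simplified] P.mclass_ract[simplified]
  note Hs = add_subgroupD[OF subbimoduleD(1)[OF H_sub]] subbimoduleD(2,3)[OF H_sub]
  fix x assume "x \<in> carrier quotP"
  then obtain h where h: "h \<in> H" "x = D +>\<^bsub>T\<^esub> h" by (rule P_rep)
  then show "inclusion x \<in> carrier B" by (simp add: inclusion_coset mod_hom_closed[OF \<psi>_hom])
  show "inclusion (k \<odot>\<^bsub>quotP\<^esub> x) = k \<odot>\<^bsub>B\<^esub> inclusion x" if "k \<in> carrier K" for k
  proof -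
    have kh: "k \<odot>\<^bsub>T\<^esub> h \<in> H"
      using submodule.smult_closed[OF subbimodule_submodule[OF bimodule_T H_sub] that h(1)] .
    show ?thesis
      using h that inclusion_coset[OF kh] inclusion_coset[OF h(1)] ops(3)[of k h] mod_hom_smult[OF \<psi>_hom that, of h] by simp
  qed
  show "inclusion (x \<oplus>\<^bsub>quotP\<^esub> y) = inclusion x \<oplus>\<^bsub>B\<^esub> inclusion y" if "y \<in> carrier quotP" for y
  proof -
    obtain h' where h': "h' \<in> H" "y = D +>\<^bsub>T\<^esub> h'" using \<open>y \<in> carrier quotP\<close> by (rule P_rep)
    show ?thesis
      using h h' inclusion_coset[OF Hs(3)[OF h(1) h'(1)]] inclusion_coset[OF h(1)] inclusion_coset[OF h'(1)]
        ops(2)[of h h'] mod_hom_add[OF \<psi>_hom, of h h'] by simp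
  qed
  fix c assume "c \<in> carrier (quot_algebra F J)"
  then obtain a where a: "a \<in> carrier F" "c = J +>\<^bsub>F\<^esub> a" by (rule P.class_rep)
  show "inclusion (lact quotP c x) = lact B c (inclusion x)"
    using h a inclusion_coset[OF Hs(6)[OF a(1) h(1)]] inclusion_coset[OF h(1)] P.mclass_lact[OF a(1), of h]
      \<psi>_lact[OF a(1), of h] by simp
  show "inclusion (ract quotP x c) = ract B (inclusion x) c"
    using h a inclusion_coset[OF Hs(7)[OF a(1) h(1)]] inclusion_coset[OF h(1)] P.mclass_ract[OF a(1), of h]
      \<psi>_ract[OF a(1), of h] by simp
qed

lemma projection_hom: "projection \<in> bimod_hom K (quot_algebra F J) B quotQ"
  unfolding bimod_hom_def
proof (intro CollectI conjI ballI mod_homI)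
  note ops = Q.mclass_ops[simplified regular_coset restrict_bimod_simps regular_bimod_simps]
    Q.mclass_lact[simplified regular_coset restrict_bimod_simps regular_bimod_simps]
    Q.mclass_ract[simplified regular_coset restrict_bimod_simps regular_bimod_simps]
  fix x assume "x \<in> carrier B"
  then obtain t where t: "t \<in> carrier T" "x = \<psi> t" by (rule B_rep)
  then show "projection x \<in> carrier quotQ" using ops(1)[OF \<alpha>_in_J] by (simp add: projection_\<psi>)
  show "projection (k \<odot>\<^bsub>B\<^esub> x) = k \<odot>\<^bsub>quotQ\<^esub> projection x" if k: "k \<in> carrier K" for k
    using t k projection_\<psi>[of t] projection_\<psi>[of "k \<odot>\<^bsub>T\<^esub> t"] mod_hom_smult[OF \<psi>_hom k t(1)]
      mod_hom_smult[OF \<alpha>_linear k t(1)] ops(3)[OF k \<alpha>_in_J[OF t(1)]] by simp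
  show "projection (x \<oplus>\<^bsub>B\<^esub> y) = projection x \<oplus>\<^bsub>quotQ\<^esub> projection y" if "y \<in> carrier B" for y
  proof -
    obtain u where u: "u \<in> carrier T" "y = \<psi> u" using \<open>y \<in> carrier B\<close> by (rule B_rep)
    show ?thesis
      using t u projection_\<psi>[of t] projection_\<psi>[of u] projection_\<psi>[of "t \<oplus>\<^bsub>T\<^esub> u"] mod_hom_add[OF \<psi>_hom t(1) u(1)]
        mod_hom_add[OF \<alpha>_linear t(1) u(1)] ops(2)[OF \<alpha>_in_J[OF t(1)] \<alpha>_in_J[OF u(1)]] by simp
  qed
  fix c assume "c \<in> carrier (quot_algebra F J)"
  then obtain a where a: "a \<in> carrier F" "c = J +>\<^bsub>F\<^esub> a" by (rule P.class_rep)
  show "projection (lact B c x) = lact quotQ c (projection x)"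
    using t a projection_\<psi>[of t] projection_\<psi>[OF TB.lact_closed[OF a(1) t(1)]] \<psi>_lact[OF a(1) t(1)]
      \<alpha>_lact[OF a(1) t(1)] ops(5)[OF a(1) \<alpha>_in_J[OF t(1)]] by simp
  show "projection (ract B x c) = ract quotQ (projection x) c"
    using t a projection_\<psi>[of t] projection_\<psi>[OF TB.ract_closed[OF a(1) t(1)]] \<psi>_ract[OF a(1) t(1)]
      \<alpha>_ract[OF a(1) t(1)] ops(6)[OF a(1) \<alpha>_in_J[OF t(1)]] by simp
qed

text \<open>
  An element \<open>\<psi> t\<close> goes to zero in \<open>J / J\<^sup>2\<close> iff \<open>\<alpha> t \<in> J\<^sup>2\<close>.  Then \<open>\<alpha> t = \<alpha> u\<close> for some \<open>u\<close> in the kernel of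
  \<open>\<psi>\<close>, and \<open>t - u\<close> is an element of \<open>H\<close> with the same image as \<open>t\<close>.
\<close>

theorem exact:
  "short_exact K (quot_algebra F J) quotP inclusion B projection quotQ"
  unfolding short_exact_def
proof (intro conjI)
  show "bimodule K (quot_algebra F J) quotP" by (rule P.quot_bimod_bimodule)
  show "bimodule K (quot_algebra F J) quotQ" by (rule Q.quot_bimod_bimodule)
  note Hs = add_subgroupD[OF subbimoduleD(1)[OF H_sub]]
  note Dg = subbimoduleD(1)[OF D_sub_T]
  show "inj_on inclusion (carrier quotP)"
  proof (rule inj_onI)
    fix x y assume "x \<in> carrier quotP" "y \<in> carrier quotP" and eq: "inclusion x = inclusion y"
    obtain h where h: "h \<in> H" "x = D +>\<^bsub>T\<^esub> h" using \<open>x \<in> carrier quotP\<close> by (rule P_rep)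
    obtain h' where h': "h' \<in> H" "y = D +>\<^bsub>T\<^esub> h'" using \<open>y \<in> carrier quotP\<close> by (rule P_rep)
    have c: "h \<in> carrier T" "h' \<in> carrier T" using h h' by auto
    have "\<psi> (h \<ominus>\<^bsub>T\<^esub> h') = \<zero>\<^bsub>B\<^esub>"
      using eq h h' mod_hom_minus[OF T_module B_module \<psi>_hom c]
        B.M.minus_eq_zero_iff[OF mod_hom_closed[OF \<psi>_hom c(1)] mod_hom_closed[OF \<psi>_hom c(2)]]
      by (simp add: inclusion_coset)
    then have "h \<ominus>\<^bsub>T\<^esub> h' \<in> D"
      by (rule kernel_of_base_change_in_D[OF Hs(5)[OF h(1) h'(1)]])
    then show "x = y"
      using coset_eq_iff[OF T_ag Dg c] h h' by simp
  qed
  have zero: "JJ +>\<^bsub>F\<^esub> \<alpha> t = JJ \<longleftrightarrow> \<alpha> t \<in> JJ" if "t \<in> carrier T" for t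
    by (rule coset_eq_subgroup_iff[OF F.M.abelian_group_axioms ideal_subgroup[OF JJ_ideal] \<alpha>_closed[OF that]])
  show "inclusion ` carrier quotP = {x \<in> carrier B. projection x = \<zero>\<^bsub>quotQ\<^esub>}"
  proof (intro equalityI subsetI)
    fix x assume "x \<in> inclusion ` carrier quotP"
    then obtain c where c: "c \<in> carrier quotP" "x = inclusion c" by auto
    obtain h where h: "h \<in> H" "c = D +>\<^bsub>T\<^esub> h" using c(1) by (rule P_rep)
    then have hT: "h \<in> carrier T" by simp
    have x: "x = \<psi> h" using c h inclusion_coset by simp
    have "\<alpha> h \<in> JJ"
      using h(1) add_subgroupD(1)[OF ideal_subgroup[OF JJ_ideal]] by simp
    then show "x \<in> {x \<in> carrier B. projection x = \<zero>\<^bsub>quotQ\<^esub>}"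
      using x hT zero[OF hT] projection_\<psi>[OF hT] mod_hom_closed[OF \<psi>_hom hT] Q.mclass_ops(4) by simp
  next
    fix x assume x: "x \<in> {x \<in> carrier B. projection x = \<zero>\<^bsub>quotQ\<^esub>}"
    then obtain t where t: "t \<in> carrier T" "x = \<psi> t" using B_rep by blast
    have "\<alpha> t \<in> JJ"
      using x t projection_\<psi>[OF t(1)] zero[OF t(1)] Q.mclass_ops(4) by simp
    then obtain u where u: "u \<in> carrier T" "\<alpha> u = \<alpha> t" "\<psi> u = \<zero>\<^bsub>B\<^esub>" by (rule JJ_lift)
    have h: "t \<ominus>\<^bsub>T\<^esub> u \<in> H"
      using t u mod_hom_minus[OF T_module F_module \<alpha>_linear t(1) u(1)]
        F.M.minus_eq_zero_iff[OF \<alpha>_closed[OF t(1)] \<alpha>_closed[OF t(1)]] by simp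
    have "\<psi> (t \<ominus>\<^bsub>T\<^esub> u) = \<psi> t"
      using mod_hom_minus[OF T_module B_module \<psi>_hom t(1) u(1)] u(3)
        B.M.minus_add_cancel(1)[OF mod_hom_closed[OF \<psi>_hom t(1)] B.M.zero_closed]
        mod_hom_closed[OF \<psi>_hom t(1)] by simp
    then have "x = inclusion (D +>\<^bsub>T\<^esub> (t \<ominus>\<^bsub>T\<^esub> u))" using t inclusion_coset[OF h] by simp
    moreover have "D +>\<^bsub>T\<^esub> (t \<ominus>\<^bsub>T\<^esub> u) \<in> carrier quotP"
      using P.mclass_ops(1)[of "t \<ominus>\<^bsub>T\<^esub> u"] h by simp
    ultimately show "x \<in> inclusion ` carrier quotP" by blast
  qed
  show "projection ` carrier B = carrier quotQ"
  proof (intro equalityI subsetI)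
    fix x assume "x \<in> projection ` carrier B"
    then show "x \<in> carrier quotQ"
      using mod_hom_closed[OF bimod_homD(1)[OF projection_hom]] by blast
  next
    fix x assume "x \<in> carrier quotQ"
    then obtain j where j: "j \<in> J" "x = JJ +>\<^bsub>F\<^esub> j"
      using Q.mclass_rep[of x] by (auto simp: regular_coset)
    obtain t where "t \<in> carrier T" "\<alpha> t = j" using J_rep[OF j(1)] .
    then show "x \<in> projection ` carrier B"
      using j(2) projection_\<psi>[of t] mod_hom_closed[OF \<psi>_hom, of t] by (metis imageI)
  qed
qed (rule bimodule_B inclusion_hom projection_hom)+

end

section \<open>The free bimodule of a presentation\<close>

locale presentation =
  fixes K :: "('k, 'r) ring_scheme" and X :: "'x set" and R :: "('x list \<Rightarrow> 'k) set"
  assumes cring_K: "cring K" and relators: "R \<subseteq> carrier (free_alg K X)"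
begin

abbreviation F where "F \<equiv> free_alg K X"
abbreviation J where "J \<equiv> rel_ideal K X R"
abbreviation A where "A \<equiv> presented_alg K X R"
abbreviation V where "V \<equiv> free_mod K R"
abbreviation T where "T \<equiv> pres_bimod K X R"
abbreviation B where "B \<equiv> tensor_bimod K A V"
abbreviation \<alpha> where "\<alpha> \<equiv> pres_map K X"
abbreviation H where "H \<equiv> {t \<in> carrier T. \<alpha> t = \<zero>\<^bsub>F\<^esub>}"
abbreviation D where "D \<equiv> peiffer_span K X R"
abbreviation \<epsilon> where "\<epsilon> \<equiv> lin_ext K F (\<lambda>r. r)"

lemma F_algebra: "assoc_algebra K F" by (rule free_alg_assoc_algebra[OF cring_K])

sublocale F: assoc_algebra K F by (rule F_algebra)

lemmas F_module = assoc_algebraD(1)[OF F_algebra]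

lemma J_ideal: "ideal J F"
  unfolding rel_ideal_def by (rule F.genideal_ideal[OF relators])

lemma R_J: "R \<subseteq> J"
  unfolding rel_ideal_def by (rule F.genideal_self[OF relators])

sublocale A: quotient_algebra K F J
  by (intro quotient_algebra.intro F_algebra J_ideal)

lemma A_eq: "A = quot_algebra F J"
  by (simp add: presented_alg_def)

lemma A_algebra: "assoc_algebra K A"
  unfolding A_eq by (rule A.quot_algebra_assoc_algebra)

lemmas A_module = assoc_algebraD(1)[OF A_algebra]

lemma V_module: "module K V" by (rule free_mod_module[OF cring_K])

sublocale TF: algebra_tensor K F V
  by (intro algebra_tensor.intro F_algebra V_module)

sublocale TA: algebra_tensor K A V
  by (intro algebra_tensor.intro A_algebra V_module)

lemma T_eq: "T = TF.TB" by (simp add: pres_bimod_def)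

lemma T_simps [simp]:
  "carrier T = carrier TF.Tn" "zero T = zero TF.Tn" "add T = add TF.Tn" "smult T = smult TF.Tn"
  by (simp_all add: T_eq)

lemma mod_hom_T:
  "mod_hom K T M = mod_hom K TF.Tn M" "mod_hom K M T = mod_hom K M TF.Tn"
  "mod_hom K B N = mod_hom K TA.Tn N" "mod_hom K N B = mod_hom K N TA.Tn"
  by (simp_all add: mod_hom_def)

lemma T_bimodule: "bimodule K F T" unfolding T_eq by (rule TF.tensor_bimod_bimodule)
lemma B_bimodule: "bimodule K A B" by (rule TA.tensor_bimod_bimodule)

sublocale T: bimodule K F T by (rule T_bimodule)

lemmas T_module = bimoduleD(2)[OF T_bimodule]
lemmas B_module = bimoduleD(2)[OF B_bimodule]
lemmas T_ag = module.axioms(2)[OF T_module]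
lemmas T_add = add_subgroupD[OF submodule.axioms(1)[OF module.carrier_is_submodule[OF T_module]]]
lemmas T_lact_pure = TF.tensor_lact_pure[folded T_eq]
lemmas T_ract_pure = TF.tensor_ract_pure[folded T_eq]
lemmas pt_homs = TF.pure_tensor_homs[folded mod_hom_T(2)]

lemma pt_closed: "u \<in> carrier F \<Longrightarrow> v \<in> carrier V \<Longrightarrow> w \<in> carrier F \<Longrightarrow> TF.pt u v w \<in> carrier T"
  using TF.pure_tensor_closed by simp

lemma submodule_T: "submodule N K T \<longleftrightarrow> submodule N K TF.Tn"
  by (simp add: submodule_def submodule_axioms_def subgroup_def m_inv_def)

lemma T_hom_eqI:
  assumes "module K M" "f \<in> mod_hom K T M" "g \<in> mod_hom K T M"
    and "\<And>p v q. p \<in> carrier F \<Longrightarrow> v \<in> carrier V \<Longrightarrow> q \<in> carrier F \<Longrightarrow> f (TF.pt p v q) = g (TF.pt p v q)"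
    and "t \<in> carrier T"
  shows "f t = g t"
  using TF.tensor_hom_eqI[of M f g t] assms by (simp add: mod_hom_T)


section \<open>The map onto the ideal of relations\<close>

lemma \<epsilon>_hom: "\<epsilon> \<in> mod_hom K V F"
  by (rule lin_ext_hom[OF F_module]) (use relators in auto)

lemma \<epsilon>_basis: "r \<in> R \<Longrightarrow> \<epsilon> (free_basis K r) = r"
  by (rule lin_ext_basis[OF F_module]) (use relators in auto)

lemma \<alpha>_trilinear:
  "trilinear K F V F F (\<lambda>u \<rho> v. u \<otimes>\<^bsub>F\<^esub> \<epsilon> \<rho> \<otimes>\<^bsub>F\<^esub> v)"
  unfolding trilinear_def
proof (intro conjI ballI)
  note l = mult_left_hom[OF F_algebra] and r = mult_right_hom[OF F_algebra]
  fix v q assume vq: "v \<in> carrier V" "q \<in> carrier F"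
  show "(\<lambda>p. p \<otimes>\<^bsub>F\<^esub> \<epsilon> v \<otimes>\<^bsub>F\<^esub> q) \<in> mod_hom K F F"
    by (rule mod_hom_comp[OF r[OF mod_hom_closed[OF \<epsilon>_hom vq(1)]] r[OF vq(2)]])
next
  note l = mult_left_hom[OF F_algebra] and r = mult_right_hom[OF F_algebra]
  fix p q assume pq: "p \<in> carrier F" "q \<in> carrier F"
  show "(\<lambda>v. p \<otimes>\<^bsub>F\<^esub> \<epsilon> v \<otimes>\<^bsub>F\<^esub> q) \<in> mod_hom K V F"
    by (rule mod_hom_comp[OF mod_hom_comp[OF \<epsilon>_hom l[OF pq(1)]] r[OF pq(2)]])
next
  note l = mult_left_hom[OF F_algebra] and r = mult_right_hom[OF F_algebra]
  fix p v assume pv: "p \<in> carrier F" "v \<in> carrier V"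
  show "(\<lambda>q. p \<otimes>\<^bsub>F\<^esub> \<epsilon> v \<otimes>\<^bsub>F\<^esub> q) \<in> mod_hom K F F"
    by (rule l[OF F.m_closed[OF pv(1) mod_hom_closed[OF \<epsilon>_hom pv(2)]]])
qed

lemma \<alpha>_eq: "\<alpha> = tensor_lift K F (\<lambda>u \<rho> v. u \<otimes>\<^bsub>F\<^esub> \<epsilon> \<rho> \<otimes>\<^bsub>F\<^esub> v)"
  by (simp add: pres_map_def Let_def)

lemma \<alpha>_hom: "\<alpha> \<in> mod_hom K T F"
  unfolding \<alpha>_eq mod_hom_T by (rule TF.tensor_lift_hom[OF F_module \<alpha>_trilinear])

lemma \<alpha>_pure: "u \<in> carrier F \<Longrightarrow> v \<in> carrier V \<Longrightarrow> w \<in> carrier F \<Longrightarrow>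
    \<alpha> (TF.pt u v w) = u \<otimes>\<^bsub>F\<^esub> \<epsilon> v \<otimes>\<^bsub>F\<^esub> w"
  unfolding \<alpha>_eq by (rule TF.tensor_lift_pure[OF F_module \<alpha>_trilinear])

lemma \<alpha>_lact:
  assumes a: "a \<in> carrier F" and t: "t \<in> carrier T"
  shows "\<alpha> (lact T a t) = a \<otimes>\<^bsub>F\<^esub> \<alpha> t"
proof (rule T_hom_eqI[OF F_module mod_hom_comp[OF lact_hom[OF T_bimodule a] \<alpha>_hom]
      mod_hom_comp[OF \<alpha>_hom mult_left_hom[OF F_algebra a]] _ t])
  fix p v q assume c: "p \<in> carrier F" "v \<in> carrier V" "q \<in> carrier F"
  show "\<alpha> (lact T a (TF.pt p v q)) = a \<otimes>\<^bsub>F\<^esub> \<alpha> (TF.pt p v q)"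
    unfolding T_lact_pure[OF a c] \<alpha>_pure[OF F.m_closed[OF a c(1)] c(2,3)] \<alpha>_pure[OF c]
    using a c mod_hom_closed[OF \<epsilon>_hom c(2)] by (simp only: F.m_assoc F.m_closed)
qed

lemma \<alpha>_ract:
  assumes a: "a \<in> carrier F" and t: "t \<in> carrier T"
  shows "\<alpha> (ract T t a) = \<alpha> t \<otimes>\<^bsub>F\<^esub> a"
proof (rule T_hom_eqI[OF F_module mod_hom_comp[OF ract_hom[OF T_bimodule a] \<alpha>_hom]
      mod_hom_comp[OF \<alpha>_hom mult_right_hom[OF F_algebra a]] _ t])
  fix p v q assume c: "p \<in> carrier F" "v \<in> carrier V" "q \<in> carrier F"
  show "\<alpha> (ract T (TF.pt p v q) a) = \<alpha> (TF.pt p v q) \<otimes>\<^bsub>F\<^esub> a"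
    unfolding T_ract_pure[OF a c] \<alpha>_pure[OF c(1,2) F.m_closed[OF c(3) a]] \<alpha>_pure[OF c]
    using a c mod_hom_closed[OF \<epsilon>_hom c(2)] by (simp only: F.m_assoc F.m_closed)
qed

lemma \<alpha>_bimod_hom: "\<alpha> \<in> bimod_hom K F T (regular_bimod F)"
  using \<alpha>_hom \<alpha>_lact \<alpha>_ract by (simp add: bimod_hom_def mod_hom_def)

text \<open>
  The elements \<open>1 \<otimes> r \<otimes> 1\<close>, with a bar on \<open>r\<close>, which generate the bimodule \<open>T\<close> freely.
\<close>

definition gen where "gen r = TF.pt \<one>\<^bsub>F\<^esub> (free_basis K r) \<one>\<^bsub>F\<^esub>"

lemma gen_closed: "r \<in> R \<Longrightarrow> gen r \<in> carrier T"
  unfolding gen_def by (intro pt_closed F.one_closed free_basis_closed[OF cring_K])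

lemma gen_sandwich:
  assumes "r \<in> R" "f \<in> carrier F" "g \<in> carrier F"
  shows "lact T f (ract T (gen r) g) = TF.pt f (free_basis K r) g"
proof -
  note b = free_basis_closed[OF cring_K assms(1)]
  show ?thesis
    unfolding gen_def T_ract_pure[OF assms(3) F.one_closed b F.one_closed]
      T_lact_pure[OF assms(2) F.one_closed b F.m_closed[OF F.one_closed assms(3)]]
    using assms(2,3) by (simp only: F.l_one F.r_one)
qed

lemma \<alpha>_gen: "r \<in> R \<Longrightarrow> \<alpha> (gen r) = r"
  unfolding gen_def
  using \<alpha>_pure[OF F.one_closed free_basis_closed[OF cring_K] F.one_closed] relators
  by (simp only: \<epsilon>_basis F.l_one F.r_one subset_iff)

lemma T_generated:
  assumes N: "submodule N K T" and t: "t \<in> carrier T"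
    and gen: "\<And>f r g. f \<in> carrier F \<Longrightarrow> r \<in> R \<Longrightarrow> g \<in> carrier F \<Longrightarrow> lact T f (ract T (gen r) g) \<in> N"
  shows "t \<in> N"
proof (rule TF.tensor_mem[OF N[unfolded submodule_T]])
  show "t \<in> carrier TF.Tn" using t by simp
  fix p v q assume c: "p \<in> carrier F" "v \<in> carrier V" "q \<in> carrier F"
  show "TF.pt p v q \<in> N"
    by (rule mod_hom_free_mem[OF T_module pt_homs(2)[OF c(1,3)] N _ c(2)])
      (use gen[OF c(1) _ c(3)] gen_sandwich[OF _ c(1,3)] in simp)
qed

text \<open>
  The image of \<open>\<alpha>\<close> is an ideal that contains \<open>R\<close>.
\<close>

lemma \<alpha>_image: "\<alpha> ` carrier T = J"
proof
  have "t \<in> {t \<in> carrier T. \<alpha> t \<in> J}" if t: "t \<in> carrier T" for t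
  proof (rule T_generated[OF mod_hom_vimage_submodule[OF T_module F_module \<alpha>_hom ideal_submodule[OF F_algebra J_ideal]] t])
    fix f r g assume f: "f \<in> carrier F" and r: "r \<in> R" and g: "g \<in> carrier F"
    note c = gen_closed[OF r] T.ract_closed[OF g gen_closed[OF r]]
    have "r \<in> J" using r R_J by blast
    then have "f \<otimes>\<^bsub>F\<^esub> (r \<otimes>\<^bsub>F\<^esub> g) \<in> J"
      using A.I.I_l_closed[OF A.I.I_r_closed] f g by blast
    then show "lact T f (ract T (gen r) g) \<in> {t \<in> carrier T. \<alpha> t \<in> J}"
      using T.lact_closed[OF f c(2)] \<alpha>_lact[OF f c(2)] \<alpha>_ract[OF g c(1)] \<alpha>_gen[OF r] by simp
  qed
  then show "\<alpha> ` carrier T \<subseteq> J" by blast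
  have "ideal (\<alpha> ` carrier T) F"
  proof (rule idealI[OF F.ring_axioms])
    show "subgroup (\<alpha> ` carrier T) (add_monoid F)"
    proof (rule F.M.add_subgroupI)
      show "\<alpha> ` carrier T \<subseteq> carrier F" using mod_hom_closed[OF \<alpha>_hom] by blast
      show "\<zero>\<^bsub>F\<^esub> \<in> \<alpha> ` carrier T"
        unfolding mod_hom_zero[OF T_module F_module \<alpha>_hom, symmetric] by (rule imageI[OF T_add(1)])
    next
      fix x y assume "x \<in> \<alpha> ` carrier T" "y \<in> \<alpha> ` carrier T"
      then obtain t u where tu: "t \<in> carrier T" "u \<in> carrier T" "x = \<alpha> t" "y = \<alpha> u" by blast
      show "x \<oplus>\<^bsub>F\<^esub> y \<in> \<alpha> ` carrier T"
        unfolding tu(3,4) mod_hom_add[OF \<alpha>_hom tu(1,2), symmetric]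
        by (rule imageI[OF T_add(3)[OF tu(1,2)]])
      show "\<ominus>\<^bsub>F\<^esub> x \<in> \<alpha> ` carrier T"
        unfolding tu(3) mod_hom_neg[OF T_module F_module \<alpha>_hom tu(1), symmetric]
        by (rule imageI[OF T_add(4)[OF tu(1)]])
    qed
    fix x a assume a: "a \<in> carrier F" and "x \<in> \<alpha> ` carrier T"
    then obtain t where t: "t \<in> carrier T" "x = \<alpha> t" by blast
    show "a \<otimes>\<^bsub>F\<^esub> x \<in> \<alpha> ` carrier T"
      unfolding t(2) \<alpha>_lact[OF a t(1), symmetric] by (rule imageI[OF T.lact_closed[OF a t(1)]])
    show "x \<otimes>\<^bsub>F\<^esub> a \<in> \<alpha> ` carrier T"
      unfolding t(2) \<alpha>_ract[OF a t(1), symmetric] by (rule imageI[OF T.ract_closed[OF a t(1)]])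
  qed
  moreover have "R \<subseteq> \<alpha> ` carrier T"
  proof
    fix r assume r: "r \<in> R"
    show "r \<in> \<alpha> ` carrier T" using imageI[OF gen_closed[OF r], of \<alpha>] \<alpha>_gen[OF r] by simp
  qed
  ultimately show "J \<subseteq> \<alpha> ` carrier T"
    unfolding rel_ideal_def by (rule F.genideal_minimal)
qed


section \<open>The Peiffer identity\<close>

lemma kernel_eq: "pres_kernel K X R = restrict_bimod T H"
  by (simp add: pres_kernel_def)

lemma H_subbimodule: "subbimodule F H T"
proof -
  have "subgroup H (add_monoid T)"
    by (rule submodule.axioms(1)[OF mod_hom_kernel_submodule[OF T_module F_module \<alpha>_hom]])
  moreover have "a \<otimes>\<^bsub>F\<^esub> \<zero>\<^bsub>F\<^esub> = \<zero>\<^bsub>F\<^esub>" "\<zero>\<^bsub>F\<^esub> \<otimes>\<^bsub>F\<^esub> a = \<zero>\<^bsub>F\<^esub>" if "a \<in> carrier F" for a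
    using that F.r_null F.l_null by blast+
  ultimately show ?thesis
    unfolding subbimodule_def using \<alpha>_lact \<alpha>_ract T.lact_closed T.ract_closed by force
qed

text \<open>
  The defining elements of \<open>D\<close> with the word between the two relators replaced by an arbitrary
  element of the free algebra, on which they depend linearly.
\<close>

definition peiffer_map where
  "peiffer_map r s f = ract T (gen r) (f \<otimes>\<^bsub>F\<^esub> s) \<ominus>\<^bsub>T\<^esub> lact T (r \<otimes>\<^bsub>F\<^esub> f) (gen s)"

lemma peiffer_eq:
  assumes r: "r \<in> R" and s: "s \<in> R" and u: "u \<in> lists X"
  shows "peiffer K X R r u s = peiffer_map r s (free_basis K u)"
proof -
  have b: "free_basis K u \<in> carrier F" by (rule free_alg_basis_closed[OF cring_K u])
  have rs: "r \<in> carrier F" "s \<in> carrier F" using r s relators by auto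
  note c = F.m_closed[OF b rs(2)] F.m_closed[OF rs(1) b]
  have "ract T (gen r) (free_basis K u \<otimes>\<^bsub>F\<^esub> s) = TF.pt \<one>\<^bsub>F\<^esub> (free_basis K r) (free_basis K u \<otimes>\<^bsub>F\<^esub> s)"
    using gen_sandwich[OF r F.one_closed c(1)] T.lact_one[OF T.ract_closed[OF c(1) gen_closed[OF r]]] by simp
  moreover have "lact T (r \<otimes>\<^bsub>F\<^esub> free_basis K u) (gen s) = TF.pt (r \<otimes>\<^bsub>F\<^esub> free_basis K u) (free_basis K s) \<one>\<^bsub>F\<^esub>"
    using gen_sandwich[OF s c(2) F.one_closed] T.ract_one[OF gen_closed[OF s]] by simp
  ultimately show ?thesis
    by (simp add: peiffer_def peiffer_map_def Let_def)
qed

lemma peiffer_map_hom: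
  assumes r: "r \<in> R" and s: "s \<in> R"
  shows "peiffer_map r s \<in> mod_hom K F T"
proof -
  have rs: "r \<in> carrier F" "s \<in> carrier F" using r s relators by auto
  show ?thesis
    unfolding peiffer_map_def
    by (rule mod_hom_diff[OF F_module T_module
          mod_hom_comp[OF mult_right_hom[OF F_algebra rs(2)] act_hom(2)[OF T_bimodule gen_closed[OF r]]]
          mod_hom_comp[OF mult_left_hom[OF F_algebra rs(1)] act_hom(1)[OF T_bimodule gen_closed[OF s]]]])
qed

lemma peiffer_map_H:
  assumes r: "r \<in> R" and s: "s \<in> R" and f: "f \<in> carrier F"
  shows "peiffer_map r s f \<in> H"
proof -
  have rs: "r \<in> carrier F" "s \<in> carrier F" using r s relators by auto
  note c = F.m_closed[OF f rs(2)] F.m_closed[OF rs(1) f]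
  note d = T.ract_closed[OF c(1) gen_closed[OF r]] T.lact_closed[OF c(2) gen_closed[OF s]]
  have "\<alpha> (peiffer_map r s f) = r \<otimes>\<^bsub>F\<^esub> (f \<otimes>\<^bsub>F\<^esub> s) \<ominus>\<^bsub>F\<^esub> (r \<otimes>\<^bsub>F\<^esub> f) \<otimes>\<^bsub>F\<^esub> s"
    unfolding peiffer_map_def mod_hom_minus[OF T_module F_module \<alpha>_hom d]
      \<alpha>_ract[OF c(1) gen_closed[OF r]] \<alpha>_lact[OF c(2) gen_closed[OF s]] \<alpha>_gen[OF r] \<alpha>_gen[OF s] ..
  also have "\<dots> = \<zero>\<^bsub>F\<^esub>"
    unfolding F.m_assoc[OF rs(1) f rs(2)]
    using F.M.minus_eq_zero_iff F.m_closed[OF rs(1) c(1)] by blast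
  finally show ?thesis using mod_hom_closed[OF peiffer_map_hom[OF r s] f] by blast
qed

lemma D_subbimodule: "subbimodule F D (restrict_bimod T H)"
  unfolding peiffer_span_def kernel_eq
proof (rule bimod_span_subbimodule[OF restrict_bimod_bimodule[OF T_bimodule H_subbimodule]])
  show "{peiffer K X R r u s |r u s. r \<in> R \<and> u \<in> lists X \<and> s \<in> R} \<subseteq> carrier (restrict_bimod T H)"
  proof (rule subsetI, elim CollectE exE conjE, hypsubst)
    fix r u s assume r: "r \<in> R" and u: "u \<in> lists X" and s: "s \<in> R"
    show "peiffer K X R r u s \<in> carrier (restrict_bimod T H)"
      using peiffer_map_H[OF r s free_alg_basis_closed[OF cring_K u]] peiffer_eq[OF r s u] by simp
  qed
qed

lemma D_subbimodule_T: "subbimodule F D T" and D_H: "D \<subseteq> H"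
  using D_subbimodule restrict_bimod_subgroup_iff[OF T_ag subbimoduleD(1)[OF H_subbimodule], of D]
  by (auto simp: subbimodule_def)

lemmas D_submodule = subbimodule_submodule[OF T_bimodule D_subbimodule_T]

lemma peiffer_map_D:
  assumes "r \<in> R" "s \<in> R" "f \<in> carrier F"
  shows "peiffer_map r s f \<in> D"
proof (rule mod_hom_free_mem[where f = "peiffer_map r s", OF T_module _ D_submodule])
  show "peiffer_map r s \<in> mod_hom K (free_mod K (lists X)) T"
    using peiffer_map_hom[OF assms(1,2)] by (simp add: mod_hom_free_alg)
  show "f \<in> carrier (free_mod K (lists X))" using assms(3) by simp
  fix w assume w: "w \<in> lists X"
  have "peiffer K X R r w s \<in> D"
    unfolding peiffer_span_def using w assms bimod_span_superset by fast
  then show "peiffer_map r s (free_basis K w) \<in> D" by (simp add: peiffer_eq[OF assms(1,2) w])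
qed

text \<open>
  The difference is linear in \<open>t\<close> and in \<open>u\<close>.  For \<open>t = f r g\<close> and \<open>u = f' s g'\<close>, with bars on \<open>r\<close> and \<open>s\<close>,
  it equals \<open>f\<close> times the Peiffer element of \<open>r\<close>, \<open>gf'\<close> and \<open>s\<close> times \<open>g'\<close>.
\<close>

lemma peiffer_identity:
  assumes t: "t \<in> carrier T" and u: "u \<in> carrier T"
  shows "ract T t (\<alpha> u) \<ominus>\<^bsub>T\<^esub> lact T (\<alpha> t) u \<in> D"
proof -
  note cl = mod_hom_closed[OF \<alpha>_hom]
  let ?Q = "\<lambda>t u. ract T t (\<alpha> u) \<ominus>\<^bsub>T\<^esub> lact T (\<alpha> t) u"
  have hom_t: "(\<lambda>t. ?Q t u) \<in> mod_hom K T T" if "u \<in> carrier T" for u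
    by (rule mod_hom_diff[OF T_module T_module ract_hom[OF T_bimodule cl[OF that]]
          mod_hom_comp[OF \<alpha>_hom act_hom(1)[OF T_bimodule that]]])
  have hom_u: "(\<lambda>u. ?Q t u) \<in> mod_hom K T T" if "t \<in> carrier T" for t
    by (rule mod_hom_diff[OF T_module T_module mod_hom_comp[OF \<alpha>_hom act_hom(2)[OF T_bimodule that]]
          lact_hom[OF T_bimodule cl[OF that]]])
  have gens: "?Q (lact T f (ract T (gen r) g)) (lact T f' (ract T (gen s) g')) \<in> D"
    if c: "f \<in> carrier F" "r \<in> R" "g \<in> carrier F" "f' \<in> carrier F" "s \<in> R" "g' \<in> carrier F" for f r g f' s g'
  proof -
    have rs: "r \<in> carrier F" "s \<in> carrier F" using c relators by auto
    note e = gen_closed[OF c(2)] gen_closed[OF c(5)]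
    note m = F.m_closed
    let ?h = "g \<otimes>\<^bsub>F\<^esub> f'"
    have h: "?h \<in> carrier F" by (rule m[OF c(3,4)])
    have at: "\<alpha> (lact T f (ract T (gen r) g)) = f \<otimes>\<^bsub>F\<^esub> (r \<otimes>\<^bsub>F\<^esub> g)"
      by (simp only: \<alpha>_lact[OF c(1) T.ract_closed[OF c(3) e(1)]] \<alpha>_ract[OF c(3) e(1)] \<alpha>_gen[OF c(2)])
    have au: "\<alpha> (lact T f' (ract T (gen s) g')) = f' \<otimes>\<^bsub>F\<^esub> (s \<otimes>\<^bsub>F\<^esub> g')"
      by (simp only: \<alpha>_lact[OF c(4) T.ract_closed[OF c(6) e(2)]] \<alpha>_ract[OF c(6) e(2)] \<alpha>_gen[OF c(5)])
    note cls = c(1,3,4,6) rs e h m T.lact_closed T.ract_closed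
    have left: "ract T (lact T f (ract T (gen r) g)) (f' \<otimes>\<^bsub>F\<^esub> (s \<otimes>\<^bsub>F\<^esub> g')) =
        lact T f (ract T (ract T (gen r) (?h \<otimes>\<^bsub>F\<^esub> s)) g')"
      by (simp only: cls T.lact_ract T.ract_mult)
    have right: "lact T (f \<otimes>\<^bsub>F\<^esub> (r \<otimes>\<^bsub>F\<^esub> g)) (lact T f' (ract T (gen s) g')) =
        lact T f (ract T (lact T (r \<otimes>\<^bsub>F\<^esub> ?h) (gen s)) g')"
      by (simp only: cls T.lact_ract T.lact_mult)
    have "?Q (lact T f (ract T (gen r) g)) (lact T f' (ract T (gen s) g')) =
        lact T f (ract T (peiffer_map r s ?h) g')"
      unfolding at au left right peiffer_map_def
      by (simp only: cls bimodule_minus(1,2)[OF T_bimodule])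
    also have "\<dots> \<in> D"
      by (intro subbimoduleD(2,3)[OF D_subbimodule_T] c peiffer_map_D h)
    finally show ?thesis .
  qed
  have c: "lact T f (ract T (gen r) g) \<in> carrier T" if "f \<in> carrier F" "r \<in> R" "g \<in> carrier F" for f r g
    by (intro T.lact_closed T.ract_closed gen_closed that)
  have half: "?Q (lact T f (ract T (gen r) g)) u \<in> D" if "f \<in> carrier F" "r \<in> R" "g \<in> carrier F" for f r g
  proof -
    have "u \<in> {u \<in> carrier T. ?Q (lact T f (ract T (gen r) g)) u \<in> D}"
      by (rule T_generated[OF mod_hom_vimage_submodule[OF T_module T_module hom_u[OF c[OF that]] D_submodule] u])
        (intro CollectI conjI c gens that)
    then show ?thesis by blast
  qed
  have "t \<in> {t \<in> carrier T. ?Q t u \<in> D}"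
    by (rule T_generated[OF mod_hom_vimage_submodule[OF T_module T_module hom_t[OF u] D_submodule] t])
      (intro CollectI conjI c half)
  then show ?thesis by blast
qed

section \<open>Base change to the presented algebra\<close>

abbreviation cl where "cl f \<equiv> J +>\<^bsub>F\<^esub> f"

lemma cl_hom: "cl \<in> mod_hom K F A"
  unfolding A_eq by (rule A.class_hom)

lemma cl_closed: "f \<in> carrier F \<Longrightarrow> cl f \<in> carrier A"
  by (rule mod_hom_closed[OF cl_hom])

lemma cl_mult: "f \<in> carrier F \<Longrightarrow> g \<in> carrier F \<Longrightarrow> cl f \<otimes>\<^bsub>A\<^esub> cl g = cl (f \<otimes>\<^bsub>F\<^esub> g)"
  unfolding A_eq by (rule A.class_ops)

lemma cl_rep:
  assumes "a \<in> carrier A" obtains f where "f \<in> carrier F" "a = cl f"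
  using assms unfolding A_eq by (rule A.class_rep) (rule that)

definition \<psi> where
  "\<psi> = tensor_lift K B (\<lambda>u v w. TA.pt (cl u) v (cl w))"

lemma \<psi>_trilinear: "trilinear K F V F B (\<lambda>u v w. TA.pt (cl u) v (cl w))"
  unfolding trilinear_def mod_hom_T
  by (intro conjI ballI mod_hom_comp[OF cl_hom TA.pure_tensor_homs(1)] TA.pure_tensor_homs(2)
      mod_hom_comp[OF cl_hom TA.pure_tensor_homs(3)] cl_closed)

lemma \<psi>_hom: "\<psi> \<in> mod_hom K T B"
  unfolding \<psi>_def mod_hom_T(1) by (rule TF.tensor_lift_hom[OF B_module \<psi>_trilinear])

lemma \<psi>_pure: "u \<in> carrier F \<Longrightarrow> v \<in> carrier V \<Longrightarrow> w \<in> carrier F \<Longrightarrow>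
    \<psi> (TF.pt u v w) = TA.pt (cl u) v (cl w)"
  unfolding \<psi>_def by (rule TF.tensor_lift_pure[OF B_module \<psi>_trilinear])

lemma \<psi>_lact:
  assumes a: "a \<in> carrier F" and t: "t \<in> carrier T"
  shows "\<psi> (lact T a t) = lact B (cl a) (\<psi> t)"
proof (rule T_hom_eqI[OF B_module mod_hom_comp[OF lact_hom[OF T_bimodule a] \<psi>_hom]
      mod_hom_comp[OF \<psi>_hom lact_hom[OF B_bimodule cl_closed[OF a]]] _ t])
  fix p v q assume c: "p \<in> carrier F" "v \<in> carrier V" "q \<in> carrier F"
  show "\<psi> (lact T a (TF.pt p v q)) = lact B (cl a) (\<psi> (TF.pt p v q))"
    unfolding T_lact_pure[OF a c] \<psi>_pure[OF F.m_closed[OF a c(1)] c(2,3)] \<psi>_pure[OF c]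
      TA.tensor_lact_pure[OF cl_closed[OF a] cl_closed[OF c(1)] c(2) cl_closed[OF c(3)]] cl_mult[OF a c(1)] ..
qed

lemma \<psi>_ract:
  assumes a: "a \<in> carrier F" and t: "t \<in> carrier T"
  shows "\<psi> (ract T t a) = ract B (\<psi> t) (cl a)"
proof (rule T_hom_eqI[OF B_module mod_hom_comp[OF ract_hom[OF T_bimodule a] \<psi>_hom]
      mod_hom_comp[OF \<psi>_hom ract_hom[OF B_bimodule cl_closed[OF a]]] _ t])
  fix p v q assume c: "p \<in> carrier F" "v \<in> carrier V" "q \<in> carrier F"
  show "\<psi> (ract T (TF.pt p v q) a) = ract B (\<psi> (TF.pt p v q)) (cl a)"
    unfolding T_ract_pure[OF a c] \<psi>_pure[OF c(1,2) F.m_closed[OF c(3) a]] \<psi>_pure[OF c]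
      TA.tensor_ract_pure[OF cl_closed[OF a] cl_closed[OF c(1)] c(2) cl_closed[OF c(3)]] cl_mult[OF c(3) a] ..
qed

lemma \<psi>_image: "\<psi> ` carrier T = carrier B"
proof
  show "\<psi> ` carrier T \<subseteq> carrier B" using mod_hom_closed[OF \<psi>_hom] by blast
  have "b \<in> \<psi> ` carrier T" if "b \<in> carrier TA.Tn" for b
    using that
  proof (induction rule: TA.tensor_induct)
    case zero
    have "\<psi> \<zero>\<^bsub>T\<^esub> \<in> \<psi> ` carrier T" by (rule imageI[OF T_add(1)])
    then show ?case unfolding mod_hom_zero[OF T_module B_module \<psi>_hom] by simp
  next
    case (pure p v q)
    obtain f where f: "f \<in> carrier F" "p = cl f" using pure(1) by (rule cl_rep)
    obtain g where g: "g \<in> carrier F" "q = cl g" using pure(3) by (rule cl_rep)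
    show ?case
      using imageI[OF pt_closed[OF f(1) pure(2) g(1)], of \<psi>] \<psi>_pure[OF f(1) pure(2) g(1)] f g by simp
  next
    case (add b c)
    then obtain t u where tu: "t \<in> carrier T" "u \<in> carrier T" "b = \<psi> t" "c = \<psi> u" by blast
    show ?case
      using imageI[OF T_add(3)[OF tu(1,2)], of \<psi>] mod_hom_add[OF \<psi>_hom tu(1,2)] tu by simp
  qed
  then show "carrier B \<subseteq> \<psi> ` carrier T" by auto
qed

lemma cl_J: "j \<in> J \<Longrightarrow> cl j = \<zero>\<^bsub>A\<^esub>"
  using A.class_eq_zero_iff[of j] A.I.Icarr[of j] by (simp add: A_eq quot_algebra_simps)

lemma \<psi>_J:
  assumes j: "j \<in> J" and t: "t \<in> carrier T"
  shows "\<psi> (lact T j t) = \<zero>\<^bsub>B\<^esub>" "\<psi> (ract T t j) = \<zero>\<^bsub>B\<^esub>"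
proof -
  have jF: "j \<in> carrier F" using j by (rule A.I.Icarr)
  note c = mod_hom_closed[OF \<psi>_hom t]
  show "\<psi> (lact T j t) = \<zero>\<^bsub>B\<^esub>"
    unfolding \<psi>_lact[OF jF t] cl_J[OF j]
    by (rule mod_hom_zero[OF A_module B_module act_hom(1)[OF B_bimodule c]])
  show "\<psi> (ract T t j) = \<zero>\<^bsub>B\<^esub>"
    unfolding \<psi>_ract[OF jF t] cl_J[OF j]
    by (rule mod_hom_zero[OF A_module B_module act_hom(2)[OF B_bimodule c]])
qed

lemma \<psi>_kernel_subbimodule: "subbimodule F {t \<in> carrier T. \<psi> t = \<zero>\<^bsub>B\<^esub>} T"
proof -
  have z: "lact B (cl a) \<zero>\<^bsub>B\<^esub> = \<zero>\<^bsub>B\<^esub>" "ract B \<zero>\<^bsub>B\<^esub> (cl a) = \<zero>\<^bsub>B\<^esub>" if a: "a \<in> carrier F" for a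
    using mod_hom_zero[OF B_module B_module lact_hom[OF B_bimodule cl_closed[OF a]]]
      mod_hom_zero[OF B_module B_module ract_hom[OF B_bimodule cl_closed[OF a]]] by auto
  show ?thesis
    unfolding subbimodule_def
  proof (intro conjI ballI)
    show "subgroup {t \<in> carrier T. \<psi> t = \<zero>\<^bsub>B\<^esub>} (add_monoid T)"
      by (rule submodule.axioms(1)[OF mod_hom_kernel_submodule[OF T_module B_module \<psi>_hom]])
    fix a t assume a: "a \<in> carrier F" and "t \<in> {t \<in> carrier T. \<psi> t = \<zero>\<^bsub>B\<^esub>}"
    then have t: "t \<in> carrier T" "\<psi> t = \<zero>\<^bsub>B\<^esub>" by auto
    show "lact T a t \<in> {t \<in> carrier T. \<psi> t = \<zero>\<^bsub>B\<^esub>}" "ract T t a \<in> {t \<in> carrier T. \<psi> t = \<zero>\<^bsub>B\<^esub>}"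
      using \<psi>_lact[OF a t(1)] \<psi>_ract[OF a t(1)] t(2) z[OF a] T.lact_closed[OF a t(1)] T.ract_closed[OF a t(1)]
      by auto
  qed
qed

text \<open>
  Both terms of a Peiffer element carry a relator on one side, which vanishes in \<open>A\<close>.
\<close>

lemma \<psi>_peiffer_map:
  assumes r: "r \<in> R" and s: "s \<in> R" and f: "f \<in> carrier F"
  shows "\<psi> (peiffer_map r s f) = \<zero>\<^bsub>B\<^esub>"
proof -
  interpret B': module K B by (rule B_module)
  have rs: "r \<in> J" "s \<in> J" using r s R_J by auto
  have J: "f \<otimes>\<^bsub>F\<^esub> s \<in> J" "r \<otimes>\<^bsub>F\<^esub> f \<in> J"
    using A.I.I_l_closed[OF rs(2) f] A.I.I_r_closed[OF rs(1) f] by auto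
  note c = T.ract_closed[OF A.I.Icarr[OF J(1)] gen_closed[OF r]] T.lact_closed[OF A.I.Icarr[OF J(2)] gen_closed[OF s]]
  show ?thesis
    unfolding peiffer_map_def mod_hom_minus[OF T_module B_module \<psi>_hom c] \<psi>_J(2)[OF J(1) gen_closed[OF r]]
      \<psi>_J(1)[OF J(2) gen_closed[OF s]]
    by (rule B'.M.minus_eq_zero_iff[OF B'.M.zero_closed B'.M.zero_closed, THEN iffD2, OF refl])
qed

lemma \<psi>_D:
  assumes "t \<in> D" shows "\<psi> t = \<zero>\<^bsub>B\<^esub>"
proof -
  let ?N = "{t \<in> carrier T. \<psi> t = \<zero>\<^bsub>B\<^esub>}"
  have "subgroup (H \<inter> ?N) (add_monoid T)"
    by (rule group.subgroups_Inter_pair[OF abelian_group.a_group[OF T_ag] subbimoduleD(1)[OF H_subbimodule]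
        subbimoduleD(1)[OF \<psi>_kernel_subbimodule]])
  then have "subbimodule F (H \<inter> ?N) (restrict_bimod T H)"
    using restrict_bimod_subgroup_iff[OF T_ag subbimoduleD(1)[OF H_subbimodule], of "H \<inter> ?N"]
      subbimoduleD(2,3)[OF H_subbimodule] subbimoduleD(2,3)[OF \<psi>_kernel_subbimodule]
    by (simp add: subbimodule_def)
  moreover have "{peiffer K X R r u s |r u s. r \<in> R \<and> u \<in> lists X \<and> s \<in> R} \<subseteq> H \<inter> ?N"
  proof (rule subsetI, elim CollectE exE conjE, hypsubst)
    fix r u s assume r: "r \<in> R" and u: "u \<in> lists X" and s: "s \<in> R"
    show "peiffer K X R r u s \<in> H \<inter> ?N"
      using peiffer_map_H[OF r s free_alg_basis_closed[OF cring_K u]]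
        \<psi>_peiffer_map[OF r s free_alg_basis_closed[OF cring_K u]] peiffer_eq[OF r s u] by simp
  qed
  ultimately have "D \<subseteq> H \<inter> ?N"
    unfolding peiffer_span_def kernel_eq by (rule bimod_span_least)
  then show ?thesis using assms by blast
qed

end

section \<open>Sections of the presentation over a projective algebra\<close>

locale projective_presentation = presentation +
  assumes projective: "projective_module K A"
begin

lemma linear_section:
  obtains s where "s \<in> mod_hom K A F" "\<And>c. c \<in> carrier A \<Longrightarrow> cl (s c) = c"
proof -
  have "(\<lambda>x. x) ` carrier A \<subseteq> cl ` carrier F"
  proof (rule image_subsetI)
    fix c assume "c \<in> carrier A"
    then show "c \<in> cl ` carrier F" by (rule cl_rep) (rule image_eqI)
  qed
  then obtain s where "s \<in> mod_hom K A F" "\<And>c. c \<in> carrier A \<Longrightarrow> cl (s c) = c"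
    by (rule projective_module_lift[OF projective F_module A_module cl_hom mod_hom_id]) blast
  then show thesis by (rule that)
qed

text \<open>
  With a linear section \<open>s\<close> of \<open>F \<rightarrow> A\<close> the assignment \<open>p \<otimes> v \<otimes> q \<mapsto> s(p) \<otimes> v \<otimes> s(q)\<close> is well defined on
  \<open>A \<otimes> KR \<otimes> A\<close>.  Calling it \<open>\<beta>\<close>, the element \<open>\<beta>(\<psi> t) - t\<close> lies in \<open>J T + T J\<close>: for a pure
  tensor \<open>t\<close> replace first the left and then the right factor, each by a congruent one.
\<close>

lemma \<psi>_kernel:
  assumes N: "submodule N K T"
    and JT: "\<And>j u. j \<in> J \<Longrightarrow> u \<in> carrier T \<Longrightarrow> lact T j u \<in> N"
    and TJ: "\<And>j u. j \<in> J \<Longrightarrow> u \<in> carrier T \<Longrightarrow> ract T u j \<in> N"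
    and t: "t \<in> carrier T" and zero: "\<psi> t = \<zero>\<^bsub>B\<^esub>"
  shows "t \<in> N"
proof -
  obtain s where s: "s \<in> mod_hom K A F" "\<And>c. c \<in> carrier A \<Longrightarrow> cl (s c) = c"
    by (rule linear_section) blast
  note sc = mod_hom_closed[OF s(1)]
  define \<beta> where "\<beta> = tensor_lift K T (\<lambda>p v q. TF.pt (s p) v (s q))"
  have tri: "trilinear K A V A T (\<lambda>p v q. TF.pt (s p) v (s q))"
    unfolding trilinear_def
    by (intro conjI ballI mod_hom_comp[OF s(1) pt_homs(1)] pt_homs(2) mod_hom_comp[OF s(1) pt_homs(3)] sc)
  have \<beta>: "\<beta> \<in> mod_hom K B T"
    unfolding \<beta>_def mod_hom_T(3) by (rule TA.tensor_lift_hom[OF T_module tri])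
  have \<beta>_pure: "\<beta> (TA.pt p v q) = TF.pt (s p) v (s q)" if "p \<in> carrier A" "v \<in> carrier V" "q \<in> carrier A" for p v q
    unfolding \<beta>_def by (rule TA.tensor_lift_pure[OF T_module tri that])
  have hom: "(\<lambda>t. \<beta> (\<psi> t) \<ominus>\<^bsub>T\<^esub> t) \<in> mod_hom K T T"
    by (rule mod_hom_diff[OF T_module T_module mod_hom_comp[OF \<psi>_hom \<beta>] mod_hom_id])
  have diff: "s (cl f) \<ominus>\<^bsub>F\<^esub> f \<in> J" if f: "f \<in> carrier F" for f
    using A.class_eq_iff[OF sc[OF cl_closed[OF f]] f] s(2)[OF cl_closed[OF f]] by simp
  have "t \<in> {t \<in> carrier T. \<beta> (\<psi> t) \<ominus>\<^bsub>T\<^esub> t \<in> N}"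
  proof (rule TF.tensor_mem[OF mod_hom_vimage_submodule[OF T_module T_module hom N, unfolded submodule_T]])
    show "t \<in> carrier TF.Tn" using t by simp
    fix u v w assume c: "u \<in> carrier F" "v \<in> carrier V" "w \<in> carrier F"
    let ?u = "s (cl u)" and ?w = "s (cl w)"
    have d: "?u \<in> carrier F" "?w \<in> carrier F" using sc cl_closed c by auto
    have "lact T (?u \<ominus>\<^bsub>F\<^esub> u) (TF.pt \<one>\<^bsub>F\<^esub> v ?w) \<in> N"
      by (rule JT[OF diff[OF c(1)] pt_closed[OF F.one_closed c(2) d(2)]])
    moreover have "lact T (?u \<ominus>\<^bsub>F\<^esub> u) (TF.pt \<one>\<^bsub>F\<^esub> v ?w) = TF.pt ?u v ?w \<ominus>\<^bsub>T\<^esub> TF.pt u v ?w"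
      unfolding T_lact_pure[OF A.I.Icarr[OF diff[OF c(1)]] F.one_closed c(2) d(2)]
        F.r_one[OF A.I.Icarr[OF diff[OF c(1)]]]
      by (rule mod_hom_minus[OF F_module T_module pt_homs(1)[OF c(2) d(2)] d(1) c(1)])
    moreover have "ract T (TF.pt u v \<one>\<^bsub>F\<^esub>) (?w \<ominus>\<^bsub>F\<^esub> w) \<in> N"
      by (rule TJ[OF diff[OF c(3)] pt_closed[OF c(1,2) F.one_closed]])
    moreover have "ract T (TF.pt u v \<one>\<^bsub>F\<^esub>) (?w \<ominus>\<^bsub>F\<^esub> w) = TF.pt u v ?w \<ominus>\<^bsub>T\<^esub> TF.pt u v w"
      unfolding T_ract_pure[OF A.I.Icarr[OF diff[OF c(3)]] c(1,2) F.one_closed]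
        F.l_one[OF A.I.Icarr[OF diff[OF c(3)]]]
      by (rule mod_hom_minus[OF F_module T_module pt_homs(3)[OF c(1,2)] d(2) c(3)])
    ultimately have "(TF.pt ?u v ?w \<ominus>\<^bsub>T\<^esub> TF.pt u v ?w) \<oplus>\<^bsub>T\<^esub> (TF.pt u v ?w \<ominus>\<^bsub>T\<^esub> TF.pt u v w) \<in> N"
      using add_subgroupD(3)[OF submodule.axioms(1)[OF N]] by simp
    then have "TF.pt ?u v ?w \<ominus>\<^bsub>T\<^esub> TF.pt u v w \<in> N"
      using abelian_group.minus_trans[OF T_ag pt_closed[OF d(1) c(2) d(2)] pt_closed[OF c(1,2) d(2)] pt_closed[OF c]]
      by simp
    then show "TF.pt u v w \<in> {t \<in> carrier T. \<beta> (\<psi> t) \<ominus>\<^bsub>T\<^esub> t \<in> N}"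
      using pt_closed[OF c] \<psi>_pure[OF c] \<beta>_pure[OF cl_closed[OF c(1)] c(2) cl_closed[OF c(3)]] by simp
  qed
  then have "\<zero>\<^bsub>T\<^esub> \<ominus>\<^bsub>T\<^esub> t \<in> N"
    using zero mod_hom_zero[OF B_module T_module \<beta>] by simp
  then have "\<zero>\<^bsub>T\<^esub> \<ominus>\<^bsub>T\<^esub> (\<zero>\<^bsub>T\<^esub> \<ominus>\<^bsub>T\<^esub> t) \<in> N"
    using add_subgroupD(1,5)[OF submodule.axioms(1)[OF N]] by blast
  then show "t \<in> N"
    using abelian_group.minus_add_cancel(3)[OF T_ag T_add(1) t] by simp
qed

text \<open>
  Fix a linear section \<open>s\<close> of \<open>F \<rightarrow> A\<close> and let \<open>q(f) = f - s[f]\<close>, the projection of \<open>F\<close> onto \<open>J\<close> along the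
  image of \<open>s\<close>.  For a word \<open>w\<close> and a letter \<open>y\<close> one has \<open>q(wy) = q(w) y + q(s[w] y)\<close>.  As in the
  Reidemeister-Schreier method, the elements \<open>q(s(c) y)\<close>, for \<open>c\<close> in \<open>A\<close> and \<open>y\<close> a letter, together
  with \<open>q(1)\<close>, therefore generate \<open>J\<close> as a right ideal, and lifting \<open>q\<close> along \<open>\<alpha>\<close> only requires lifts of
  these elements that depend linearly on \<open>c\<close>.  Such lifts \<open>l y c\<close> exist as \<open>A\<close> is projective.  The map
  \<open>\<sigma>\<close> with \<open>\<sigma>(wy) = \<sigma>(w) y + l y [w]\<close> then satisfies \<open>\<alpha> \<sigma> = q\<close>, which is the identity on \<open>J\<close>, and for
  \<open>j \<in> J\<close> the correction term in \<open>\<sigma>(jy) = \<sigma>(j) y + l y [j]\<close> vanishes.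
\<close>

lemma right_linear_section:
  obtains \<sigma> where "\<sigma> \<in> mod_hom K F T" "\<And>j. j \<in> J \<Longrightarrow> \<alpha> (\<sigma> j) = j"
    "\<And>j f. j \<in> J \<Longrightarrow> f \<in> carrier F \<Longrightarrow> \<sigma> (j \<otimes>\<^bsub>F\<^esub> f) = ract T (\<sigma> j) f"
proof -
  obtain s where s: "s \<in> mod_hom K A F" "\<And>c. c \<in> carrier A \<Longrightarrow> cl (s c) = c"
    by (rule linear_section) blast
  note sc = mod_hom_closed[OF s(1)]
  let ?b = "free_basis K"
  have b: "?b w \<in> carrier F" if "w \<in> lists X" for w by (rule free_alg_basis_closed[OF cring_K that])
  define q where "q f = f \<ominus>\<^bsub>F\<^esub> s (cl f)" for f
  have q: "q \<in> mod_hom K F F"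
    unfolding q_def by (rule mod_hom_diff[OF F_module F_module mod_hom_id mod_hom_comp[OF cl_hom s(1)]])
  have q_J: "q f \<in> J" if f: "f \<in> carrier F" for f
    unfolding q_def using A.class_eq_iff[OF f sc[OF cl_closed[OF f]]] s(2)[OF cl_closed[OF f]] by simp
  have right: "(\<lambda>f. f \<otimes>\<^bsub>F\<^esub> ?b [y]) \<in> mod_hom K F F" if "y \<in> X" for y
    by (rule mult_right_hom[OF F_algebra b]) (use that in simp)
  have ex: "\<exists>l. l \<in> mod_hom K A T \<and> (\<forall>c\<in>carrier A. \<alpha> (l c) = q (s c \<otimes>\<^bsub>F\<^esub> ?b [y]))" if y: "y \<in> X" for y
  proof -
    have h: "(\<lambda>c. q (s c \<otimes>\<^bsub>F\<^esub> ?b [y])) \<in> mod_hom K A F"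
      by (rule mod_hom_comp[OF mod_hom_comp[OF s(1) right[OF y]] q])
    have "(\<lambda>c. q (s c \<otimes>\<^bsub>F\<^esub> ?b [y])) ` carrier A \<subseteq> \<alpha> ` carrier T"
      unfolding \<alpha>_image by (intro image_subsetI q_J mod_hom_closed[OF right[OF y] sc])
    then obtain l where "l \<in> mod_hom K A T" "\<And>c. c \<in> carrier A \<Longrightarrow> \<alpha> (l c) = q (s c \<otimes>\<^bsub>F\<^esub> ?b [y])"
      by (rule projective_module_lift[OF projective T_module F_module \<alpha>_hom h]) blast
    then show ?thesis by blast
  qed
  define l where
    "l y = (SOME l. l \<in> mod_hom K A T \<and> (\<forall>c\<in>carrier A. \<alpha> (l c) = q (s c \<otimes>\<^bsub>F\<^esub> ?b [y])))" for y
  have l_spec: "l y \<in> mod_hom K A T \<and> (\<forall>c\<in>carrier A. \<alpha> (l y c) = q (s c \<otimes>\<^bsub>F\<^esub> ?b [y]))" if "y \<in> X" for y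
    unfolding l_def by (rule someI_ex[OF ex[OF that]])
  have l: "l y \<in> mod_hom K A T" "\<And>c. c \<in> carrier A \<Longrightarrow> \<alpha> (l y c) = q (s c \<otimes>\<^bsub>F\<^esub> ?b [y])" if "y \<in> X" for y
    using l_spec[OF that] by (blast, blast)
  have "q \<one>\<^bsub>F\<^esub> \<in> \<alpha> ` carrier T" unfolding \<alpha>_image by (rule q_J[OF F.one_closed])
  then obtain t0 where t0: "t0 \<in> carrier T" "\<alpha> t0 = q \<one>\<^bsub>F\<^esub>" by auto
  \<comment> \<open>The recursion peels off the last letter, hence the list is reversed.\<close>
  define \<sigma>0 where "\<sigma>0 w = rec_list t0 (\<lambda>y w' x. ract T x (?b [y]) \<oplus>\<^bsub>T\<^esub> l y (cl (?b (rev w')))) (rev w)" for w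
  have \<sigma>0_Nil: "\<sigma>0 [] = t0" by (simp add: \<sigma>0_def)
  have \<sigma>0_snoc: "\<sigma>0 (w @ [y]) = ract T (\<sigma>0 w) (?b [y]) \<oplus>\<^bsub>T\<^esub> l y (cl (?b w))" for w y
    by (simp add: \<sigma>0_def)
  have \<sigma>0_closed: "\<sigma>0 w \<in> carrier T" if "w \<in> lists X" for w
    using that
  proof (induction w rule: rev_induct)
    case Nil then show ?case using \<sigma>0_Nil t0 by simp
  next
    case (snoc y w)
    then have w: "w \<in> lists X" and y: "y \<in> X" by auto
    have "[y] \<in> lists X" using y by simp
    then have "ract T (\<sigma>0 w) (?b [y]) \<in> carrier T" by (rule T.ract_closed[OF b snoc.IH[OF w]])
    moreover have "l y (cl (?b w)) \<in> carrier T" by (rule mod_hom_closed[OF l(1)[OF y] cl_closed[OF b[OF w]]])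
    ultimately show ?case unfolding \<sigma>0_snoc by (rule T_add(3))
  qed
  define \<sigma> where "\<sigma> = lin_ext K T \<sigma>0"
  have \<sigma>0_Pi: "\<sigma>0 \<in> lists X \<rightarrow> carrier T" using \<sigma>0_closed by blast
  have \<sigma>: "\<sigma> \<in> mod_hom K F T"
    unfolding \<sigma>_def mod_hom_free_alg by (rule lin_ext_hom[OF T_module \<sigma>0_Pi])
  have \<sigma>_basis: "\<sigma> (?b w) = \<sigma>0 w" if "w \<in> lists X" for w
    unfolding \<sigma>_def by (rule lin_ext_basis[OF T_module \<sigma>0_Pi that])
  note \<sigma>_closed = mod_hom_closed[OF \<sigma>]
  note eqI = free_alg_hom_eqI[OF cring_K]
  have bm: "?b u \<otimes>\<^bsub>F\<^esub> ?b v = ?b (u @ v)" for u v by (rule free_alg_basis_mult[OF cring_K])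
  have \<sigma>_letter: "\<sigma> (f \<otimes>\<^bsub>F\<^esub> ?b [y]) = ract T (\<sigma> f) (?b [y]) \<oplus>\<^bsub>T\<^esub> l y (cl f)"
    if y: "y \<in> X" and f: "f \<in> carrier F" for f y
  proof (rule eqI[OF T_module mod_hom_comp[OF right[OF y] \<sigma>]
        mod_hom_sum[OF T_module mod_hom_comp[OF \<sigma> ract_hom[OF T_bimodule b]] mod_hom_comp[OF cl_hom l(1)[OF y]]] _ f])
    show "[y] \<in> lists X" using y by simp
    fix w assume w: "w \<in> lists X"
    have "w @ [y] \<in> lists X" using w y by simp
    then show "\<sigma> (?b w \<otimes>\<^bsub>F\<^esub> ?b [y]) = ract T (\<sigma> (?b w)) (?b [y]) \<oplus>\<^bsub>T\<^esub> l y (cl (?b w))"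
      by (simp only: bm \<sigma>_basis w \<sigma>0_snoc)
  qed
  have \<alpha>\<sigma>_word: "\<alpha> (\<sigma> (?b w)) = q (?b w)" if "w \<in> lists X" for w
    using that
  proof (induction w rule: rev_induct)
    case Nil then show ?case using \<sigma>_basis[OF Nil] \<sigma>0_Nil t0(2) by simp
  next
    case (snoc y w)
    then have w: "w \<in> lists X" and y: "y \<in> X" and yl: "[y] \<in> lists X" by auto
    let ?s = "s (cl (?b w))"
    have sF: "?s \<in> carrier F" by (rule sc[OF cl_closed[OF b[OF w]]])
    have clF: "cl (?b w) \<in> carrier A" by (rule cl_closed[OF b[OF w]])
    have t: "ract T (\<sigma> (?b w)) (?b [y]) \<in> carrier T" "l y (cl (?b w)) \<in> carrier T"
      using T.ract_closed[OF b[OF yl] \<sigma>_closed[OF b[OF w]]] mod_hom_closed[OF l(1)[OF y] clF] by auto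
    have m: "?s \<otimes>\<^bsub>F\<^esub> ?b [y] \<in> carrier F" "?b w \<otimes>\<^bsub>F\<^esub> ?b [y] \<in> carrier F"
      using F.m_closed[OF sF b[OF yl]] F.m_closed[OF b[OF w] b[OF yl]] by auto
    have "cl (?s \<otimes>\<^bsub>F\<^esub> ?b [y]) = cl (?b w \<otimes>\<^bsub>F\<^esub> ?b [y])"
      by (simp only: cl_mult[OF sF b[OF yl], symmetric] cl_mult[OF b[OF w] b[OF yl], symmetric] s(2)[OF clF])
    then have q2: "q (?s \<otimes>\<^bsub>F\<^esub> ?b [y]) = ?s \<otimes>\<^bsub>F\<^esub> ?b [y] \<ominus>\<^bsub>F\<^esub> s (cl (?b w \<otimes>\<^bsub>F\<^esub> ?b [y]))"
      by (simp only: q_def)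
    have "\<alpha> (\<sigma> (?b w \<otimes>\<^bsub>F\<^esub> ?b [y])) = q (?b w) \<otimes>\<^bsub>F\<^esub> ?b [y] \<oplus>\<^bsub>F\<^esub> q (?s \<otimes>\<^bsub>F\<^esub> ?b [y])"
      unfolding \<sigma>_letter[OF y b[OF w]] mod_hom_add[OF \<alpha>_hom t] \<alpha>_ract[OF b[OF yl] \<sigma>_closed[OF b[OF w]]]
        snoc.IH[OF w] l(2)[OF y clF] ..
    also have "q (?b w) \<otimes>\<^bsub>F\<^esub> ?b [y] = ?b w \<otimes>\<^bsub>F\<^esub> ?b [y] \<ominus>\<^bsub>F\<^esub> ?s \<otimes>\<^bsub>F\<^esub> ?b [y]"
      unfolding q_def by (rule mod_hom_minus[OF F_module F_module right[OF y] b[OF w] sF])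
    also have "\<dots> \<oplus>\<^bsub>F\<^esub> q (?s \<otimes>\<^bsub>F\<^esub> ?b [y]) = q (?b w \<otimes>\<^bsub>F\<^esub> ?b [y])"
      unfolding q2 unfolding q_def
      by (rule F.M.minus_trans[OF m(2,1) sc[OF cl_closed[OF m(2)]]])
    finally show ?case by (simp only: bm)
  qed
  have \<alpha>\<sigma>: "\<alpha> (\<sigma> f) = q f" if f: "f \<in> carrier F" for f
    by (rule eqI[OF F_module mod_hom_comp[OF \<sigma> \<alpha>_hom] q \<alpha>\<sigma>_word f])
  have \<alpha>\<sigma>_J: "\<alpha> (\<sigma> j) = j" if j: "j \<in> J" for j
  proof -
    have jF: "j \<in> carrier F" using j by (rule A.I.Icarr)
    have "s (cl j) = \<zero>\<^bsub>F\<^esub>" using mod_hom_zero[OF A_module F_module s(1)] cl_J[OF j] by simp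
    then show ?thesis
      using \<alpha>\<sigma>[OF jF] F.M.minus_add_cancel(1)[OF jF F.M.zero_closed] F.M.r_zero[OF F.M.minus_closed[OF jF F.M.zero_closed]]
      unfolding q_def by (simp del: free_alg_simps)
  qed
  have word: "\<sigma> (j \<otimes>\<^bsub>F\<^esub> ?b w) = ract T (\<sigma> j) (?b w)" if j: "j \<in> J" and "w \<in> lists X" for j w
    using that(2)
  proof (induction w rule: rev_induct)
    case Nil
    have jF: "j \<in> carrier F" using j by (rule A.I.Icarr)
    show ?case using F.r_one[OF jF] T.ract_one[OF \<sigma>_closed[OF jF]] by simp
  next
    case (snoc y w)
    then have w: "w \<in> lists X" and y: "y \<in> X" and yl: "[y] \<in> lists X" by auto
    have jF: "j \<in> carrier F" using j by (rule A.I.Icarr)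
    have jw: "j \<otimes>\<^bsub>F\<^esub> ?b w \<in> J" by (rule A.I.I_r_closed[OF j b[OF w]])
    note jwF = A.I.Icarr[OF jw]
    have z: "l y (cl (j \<otimes>\<^bsub>F\<^esub> ?b w)) = \<zero>\<^bsub>T\<^esub>"
      unfolding cl_J[OF jw] by (rule mod_hom_zero[OF A_module T_module l(1)[OF y]])
    have c: "ract T (\<sigma> (j \<otimes>\<^bsub>F\<^esub> ?b w)) (?b [y]) \<in> carrier T"
      by (rule T.ract_closed[OF b[OF yl] \<sigma>_closed[OF jwF]])
    have "\<sigma> (j \<otimes>\<^bsub>F\<^esub> ?b (w @ [y])) = \<sigma> ((j \<otimes>\<^bsub>F\<^esub> ?b w) \<otimes>\<^bsub>F\<^esub> ?b [y])"
      by (simp only: F.m_assoc[OF jF b[OF w] b[OF yl]] bm)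
    also have "\<dots> = ract T (\<sigma> (j \<otimes>\<^bsub>F\<^esub> ?b w)) (?b [y])"
      unfolding \<sigma>_letter[OF y jwF] z by (rule abelian_monoid.r_zero[OF abelian_group.axioms(1)[OF T_ag] c])
    also have "\<dots> = ract T (\<sigma> j) (?b w \<otimes>\<^bsub>F\<^esub> ?b [y])"
      unfolding snoc.IH[OF w] by (rule T.ract_mult[OF b[OF w] b[OF yl] \<sigma>_closed[OF jF], symmetric])
    finally show ?case by (simp only: bm)
  qed
  have "\<sigma> (j \<otimes>\<^bsub>F\<^esub> f) = ract T (\<sigma> j) f" if j: "j \<in> J" and f: "f \<in> carrier F" for j f
    by (rule eqI[OF T_module mod_hom_comp[OF mult_left_hom[OF F_algebra A.I.Icarr[OF j]] \<sigma>]
          act_hom(2)[OF T_bimodule \<sigma>_closed[OF A.I.Icarr[OF j]]] word[OF j] f])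
  with \<sigma> \<alpha>\<sigma>_J show thesis by (rule that)
qed

theorem short_exact_sequence:
  "\<exists>f g. short_exact K A (pi2 K X R) f B g (relation_bimod K X R)"
proof -
  obtain \<sigma> where \<sigma>: "\<sigma> \<in> mod_hom K F T" "\<And>j. j \<in> J \<Longrightarrow> \<alpha> (\<sigma> j) = j"
    "\<And>j f. j \<in> J \<Longrightarrow> f \<in> carrier F \<Longrightarrow> \<sigma> (j \<otimes>\<^bsub>F\<^esub> f) = ract T (\<sigma> j) f"
    by (rule right_linear_section) blast
  have B: "bimodule K (quot_algebra F J) B"
    unfolding A_eq[symmetric] by (rule B_bimodule)
  interpret E: peiffer_bimodule K F J T \<alpha> D B \<psi> \<sigma>
    by (rule peiffer_bimodule.intro[OF F_algebra J_ideal T_bimodule B \<alpha>_bimod_hom \<alpha>_image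
          D_subbimodule peiffer_identity \<psi>_hom \<psi>_image \<psi>_lact \<psi>_ract \<psi>_D \<psi>_kernel \<sigma>])
  have "pi2 K X R = quot_bimod (restrict_bimod T H) D"
    by (simp only: pi2_def kernel_eq)
  moreover have "relation_bimod K X R = quot_bimod (restrict_bimod (regular_bimod F) J) (ideal_prod F J J)"
    by (simp only: relation_bimod_def Let_def)
  ultimately show ?thesis
    using E.exact unfolding A_eq by auto
qed

end

theorem theorem3p2:
  fixes K :: "('k, 'r) ring_scheme" and X :: "'x set" and R :: "('x list \<Rightarrow> 'k) set"
  assumes "cring K"
    and "R \<subseteq> carrier (free_alg K X)"
    and "projective_module K (presented_alg K X R)"
  shows "\<exists>f g. short_exact K (presented_alg K X R)
    (pi2 K X R) f
    (tensor_bimod K (presented_alg K X R) (free_mod K R)) g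
    (relation_bimod K X R)"
  by (rule projective_presentation.short_exact_sequence)
    (intro projective_presentation.intro presentation.intro projective_presentation_axioms.intro assms)

end
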